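(* Let $\mathcal F$ be a singular foliation on a manifold $M$, let $U$ be a manifold, and let $\mathbf t_U\colon U\to M$ and $\mathbf s_U\colon U\to M$ be submersions. The following are equivalent: 1) $(U,\mathbf t_U,\mathbf s_U)$ is a bisubmersion for the singular foliation $\mathcal F$ in the sense of Androulidakis–Skandalis, i.e. $$\mathbf t_U^{-1}(\mathcal F)=\Gamma_c(U,\ker d\mathbf t_U)+\Gamma_c(U,\ker d\mathbf s_U)=\mathbf s_U^{-1}(\mathcal F).$$ 2) The map $(\mathbf t_U,\mathbf s_U)\colon U\to M\times M$ is a bisubmersion for $\mathcal F$ regarded as a singular subalgebroid of $TM=Lie(M\times M)$, where $M\times M$ is endowed with the pair groupoid structure.
   Context: A singular foliation on $M$ is a $C^\infty(M)$-submodule $\mathcal F\subset\mathfrak X_c(M)$ of compactly supported vector fields that is involutive and locally finitely generated: each point of $M$ has an open neighbourhood $W$ and finitely many $Y_1,\dots,Y_n\in\mathfrak X(W)$ such that, with $\mathcal F_W:=\{Z|_W: Z\in\mathcal F,\ \mathrm{supp} Z\subset W\}$, one has $fY_j\in\mathcal F_W$ for all $f\in C_c^\infty(W)$ and every element of $\mathcal F_W$ is a $C_c^\infty(W)$-linear combination of the $Y_j$. Singular foliations are exactly the singular subalgebroids of $TM$. For smooth $\varphi\colon U\to V$ and a submodule $\mathcal F\subset\mathfrak X_c(V)$, $\varphi^{-1}(\mathcal F)$ is the set of $X\in\mathfrak X_c(U)$ such that $d\varphi(X)=\sum f_i(Y_i\circ\varphi)$ (finite sum) with $f_i\in C_c^\infty(U)$,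 $Y_i\in\mathcal F$. $Z\in\mathfrak X(U)$ is $\varphi$-related to $Y\in\mathfrak X(V)$ if $\varphi_*(Z(p))=Y(\varphi(p))$ for all $p\in U$. Let $G\rightrightarrows M$ be a Lie groupoid with target $\mathbf t$, source $\mathbf s$, inversion $i$, $Lie(G)=\ker(d\mathbf s)|_M$, and $\mathcal B\subset\Gamma_c(Lie(G))$ a singular subalgebroid (an involutive, locally finitely generated $C^\infty(M)$-submodule). For $\alpha\in\mathcal B$, $\overrightarrow\alpha_g=(R_g)_*\alpha_{\mathbf t(g)}$ is the associated right-invariant vector field, $\overleftarrow\alpha=-i_*\overrightarrow\alpha$ the left-invariant one, and $\overrightarrow{\mathcal B}$, $\overleftarrow{\mathcal B}$ are the $C_c^\infty(G)$-spans of all $\overrightarrow\alpha$, resp. $\overleftarrow\alpha$. A bisubmersion for $\mathcal B$ is a smooth map $\varphi\colon U\to G$ such that: (i) $\mathbf s\circ\varphi$ and $\mathbf t\circ\varphi$ are submersions; (ii) for every $\alpha\in\mathcal B$ there are vector fields on $U$ that are $\varphi$-related to $\overrightarrow\alpha$, resp. to $\overleftarrow\alpha$; (iii) $\varphi^{-1}(\overrightarrow{\mathcal B})=\Gamma_c(U,\ker d(\mathbf s\circ\varphi))$ and $\varphi^{-1}(\overleftarrow{\mathcal B})=\Gamma_c(U,\ker d(\mathbf t\circ\varphi))$. The pair groupoid $M\times M\rightrightarrows M$ has target the first and source the second projection; for it $\overrightarrow X=(X,0)$ and $\overleftarrow X$ corresponds to $(0,X)$ up to the sign fixed by $\overleftarrow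 X=-i_*\overrightarrow X$ (the sign is irrelevant for the definition). *)

theory Defs
  imports "HOL-Analysis.Analysis" "HOL-Library.Function_Algebras"
begin

text \<open>
  Vector fields are functions, and their sums, zero and negation are the pointwise ones of
  HOL-Library.Function_Algebras.
\<close>

section \<open>Smooth maps between finite-dimensional inner product spaces\<close>

text \<open>
  Model spaces of manifolds. The class euclidean_space is not used because it excludes dimension
  zero.
\<close>

class model_space = real_inner +
  assumes finite_dimensional: "\<exists>B. finite B \<and> (\<forall>x. \<exists>a. x = (\<Sum>b\<in>B. a b *\<^sub>R b))"

instance euclidean_space \<subseteq> model_space
proof
  have "x = (\<Sum>b\<in>Basis. (x \<bullet> b) *\<^sub>R b)" for x :: 'a
    by (simp add: euclidean_representation)
  then show "\<exists>B. finite B \<and> (\<forall>x::'a. \<exists>a. x = (\<Sum>b\<in>B. a b *\<^sub>R b))"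
    by (metis finite_Basis)
qed

instance prod :: (model_space, model_space) model_space
proof
  obtain B :: "'a set" where B: "finite B" "\<And>x. \<exists>a. x = (\<Sum>b\<in>B. a b *\<^sub>R b)"
    using finite_dimensional by blast
  obtain C :: "'b set" where C: "finite C" "\<And>x. \<exists>a. x = (\<Sum>b\<in>C. a b *\<^sub>R b)"
    using finite_dimensional by blast
  have fin: "finite ((\<lambda>b. (b, 0)) ` B \<union> (\<lambda>c. (0, c)) ` C :: ('a \<times> 'b) set)"
    (is "finite ?D") using B(1) C(1) by simp
  have "z \<in> span ?D" for z :: "'a \<times> 'b"
  proof -
    obtain a where a: "fst z = (\<Sum>b\<in>B. a b *\<^sub>R b)" using B(2) by blast
    obtain d where d: "snd z = (\<Sum>c\<in>C. d c *\<^sub>R c)" using C(2) by blast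
    have "z = (fst z, 0) + (0, snd z)" by simp
    also have "(fst z, 0) = (\<Sum>b\<in>B. a b *\<^sub>R (b, 0 :: 'b))"
      unfolding a by (simp add: prod_eq_iff fst_sum snd_sum)
    also have "(0, snd z) = (\<Sum>c\<in>C. d c *\<^sub>R (0 :: 'a, c))"
      unfolding d by (simp add: prod_eq_iff fst_sum snd_sum)
    finally have z: "z = (\<Sum>b\<in>B. a b *\<^sub>R (b, 0)) + (\<Sum>c\<in>C. d c *\<^sub>R (0, c))" .
    show ?thesis unfolding z
      by (intro span_add span_sum span_scale span_base) auto
  qed
  then have "\<forall>z. \<exists>a. z = (\<Sum>b\<in>?D. a b *\<^sub>R b)"
    unfolding span_finite[OF fin] by (auto simp: image_iff)
  with fin show "\<exists>B. finite B \<and> (\<forall>z::'a \<times> 'b. \<exists>a. z = (\<Sum>b\<in>B. a b *\<^sub>R b))"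
    by blast
qed

primrec Ck_on :: "nat \<Rightarrow> 'e::real_normed_vector set \<Rightarrow> ('e \<Rightarrow> 'f::real_normed_vector) \<Rightarrow> bool" where
  "Ck_on 0 S f \<longleftrightarrow> continuous_on S f"
| "Ck_on (Suc k) S f \<longleftrightarrow> (\<forall>x\<in>S. f differentiable (at x)) \<and>
     (\<forall>v. Ck_on k S (\<lambda>x. frechet_derivative f (at x) v))"

text \<open>Used for open \<open>S\<close> only.\<close>

definition smooth_on :: "'e::real_normed_vector set \<Rightarrow> ('e \<Rightarrow> 'f::real_normed_vector) \<Rightarrow> bool" where
  "smooth_on S f \<longleftrightarrow> (\<forall>k. Ck_on k S f)"

section \<open>Manifolds\<close>

datatype ('a, 'e) chart = Chart (cdom: "'a set") (cmap: "'a \<Rightarrow> 'e")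

definition cinv :: "('a, 'e) chart \<Rightarrow> 'e \<Rightarrow> 'a" where
  "cinv c = inv_into (cdom c) (cmap c)"

definition is_chart :: "('a::topological_space, 'e::topological_space) chart \<Rightarrow> bool" where
  "is_chart c \<longleftrightarrow> open (cdom c) \<and> open (cmap c ` cdom c) \<and>
     homeomorphism (cdom c) (cmap c ` cdom c) (cmap c) (cinv c)"

type_synonym ('a, 'e) atlas = "('a, 'e) chart set"

text \<open>
  The underlying set of a manifold is the union of its chart domains, an open subset of the ambient
  type; it may be empty. The atlas need not be maximal.
\<close>

definition carrier :: "('a, 'e) atlas \<Rightarrow> 'a set" where
  "carrier A = (\<Union>c\<in>A. cdom c)"

definition manifold ::
    "('a::{t2_space, second_countable_topology}, 'e::model_space) atlas \<Rightarrow> bool" where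
  "manifold A \<longleftrightarrow> (\<forall>c\<in>A. is_chart c) \<and>
     (\<forall>c\<in>A. \<forall>d\<in>A. smooth_on (cmap c ` (cdom c \<inter> cdom d)) (cmap d \<circ> cinv c))"

definition prod_atlas :: "('a, 'e) atlas \<Rightarrow> ('b, 'f) atlas \<Rightarrow> ('a \<times> 'b, 'e \<times> 'f) atlas" where
  "prod_atlas A B =
     {Chart (cdom c \<times> cdom d) (map_prod (cmap c) (cmap d)) | c d. c \<in> A \<and> d \<in> B}"

definition real_line :: "(real, real) atlas" where
  "real_line = {Chart UNIV (\<lambda>x. x)}"

text \<open>In the following, \<open>S\<close> is an open subset of the carrier of \<open>A\<close>.\<close>

definition smooth_map_on ::
    "('a::topological_space, 'e::model_space) atlas \<Rightarrow> ('b::topological_space, 'f::model_space) atlas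
     \<Rightarrow> 'a set \<Rightarrow> ('a \<Rightarrow> 'b) \<Rightarrow> bool" where
  "smooth_map_on A B S \<phi> \<longleftrightarrow> \<phi> ` S \<subseteq> carrier B \<and> continuous_on S \<phi> \<and>
     (\<forall>c\<in>A. \<forall>d\<in>B. smooth_on (cmap c ` {p \<in> cdom c \<inter> S. \<phi> p \<in> cdom d}) (cmap d \<circ> \<phi> \<circ> cinv c))"

abbreviation smooth_map ::
    "('a::topological_space, 'e::model_space) atlas \<Rightarrow> ('b::topological_space, 'f::model_space) atlas
     \<Rightarrow> ('a \<Rightarrow> 'b) \<Rightarrow> bool" where
  "smooth_map A B \<equiv> smooth_map_on A B (carrier A)"

definition Cinf :: "('a, 'e::model_space) atlas \<Rightarrow> 'a set \<Rightarrow> ('a \<Rightarrow> real) set" where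
  "Cinf A S = {f. \<forall>c\<in>A. smooth_on (cmap c ` (cdom c \<inter> S)) (f \<circ> cinv c)}"

definition supp :: "('a::topological_space \<Rightarrow> 'v::zero) \<Rightarrow> 'a set" where
  "supp X = closure {p. X p \<noteq> 0}"

text \<open>Compactly supported functions on \<open>S\<close> are extended by zero outside \<open>S\<close>.\<close>

definition Cinf_c ::
    "('a::topological_space, 'e::model_space) atlas \<Rightarrow> 'a set \<Rightarrow> ('a \<Rightarrow> real) set" where
  "Cinf_c A S = {f \<in> Cinf A S. compact (supp f) \<and> supp f \<subseteq> S}"

section \<open>Tangent vectors and vector fields\<close>

text \<open>
  A tangent vector at \<open>p\<close> is the family of its coordinate vectors in all charts around \<open>p\<close>, related
  by the Jacobians of the coordinate changes; for all other charts the value is zero.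
\<close>

type_synonym ('a, 'e) tvec = "('a, 'e) chart \<Rightarrow> 'e"

definition tangent :: "('a, 'e::model_space) atlas \<Rightarrow> 'a \<Rightarrow> ('a, 'e) tvec set" where
  "tangent A p = {v.
     (\<forall>c\<in>A. \<forall>d\<in>A. p \<in> cdom c \<inter> cdom d \<longrightarrow>
        v d = frechet_derivative (cmap d \<circ> cinv c) (at (cmap c p)) (v c)) \<and>
     (\<forall>c. \<not> (c \<in> A \<and> p \<in> cdom c) \<longrightarrow> v c = 0)}"

definition some_chart :: "('a, 'e) atlas \<Rightarrow> 'a \<Rightarrow> ('a, 'e) chart" where
  "some_chart A p = (SOME c. c \<in> A \<and> p \<in> cdom c)"

text \<open>By the chain rule the differential does not depend on the chart chosen around \<open>p\<close>.\<close>

definition differential ::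
    "('a, 'e::model_space) atlas \<Rightarrow> ('b, 'f::model_space) atlas \<Rightarrow> ('a \<Rightarrow> 'b) \<Rightarrow> 'a
     \<Rightarrow> ('a, 'e) tvec \<Rightarrow> ('b, 'f) tvec" where
  "differential A B \<phi> p v = (\<lambda>d. if d \<in> B \<and> \<phi> p \<in> cdom d
     then let c = some_chart A p
          in frechet_derivative (cmap d \<circ> \<phi> \<circ> cinv c) (at (cmap c p)) (v c)
     else 0)"

definition velocity ::
    "('a, 'e::model_space) atlas \<Rightarrow> (real \<Rightarrow> 'a) \<Rightarrow> real \<Rightarrow> ('a, 'e) tvec" where
  "velocity A \<gamma> \<tau> = (\<lambda>c. if c \<in> A \<and> \<gamma> \<tau> \<in> cdom c
     then vector_derivative (cmap c \<circ> \<gamma>) (at \<tau>) else 0)"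

definition submersion ::
    "('a::topological_space, 'e::model_space) atlas \<Rightarrow> ('b::topological_space, 'f::model_space) atlas
     \<Rightarrow> ('a \<Rightarrow> 'b) \<Rightarrow> bool" where
  "submersion A B \<phi> \<longleftrightarrow> smooth_map A B \<phi> \<and>
     (\<forall>p\<in>carrier A. differential A B \<phi> p ` tangent A p = tangent B (\<phi> p))"

text \<open>
  Smooth sections over \<open>S\<close> of the pull-back along \<open>\<phi>\<close> of the tangent bundle of \<open>B\<close>, extended by zero
  outside \<open>S\<close>.
\<close>

definition fields_along ::
    "('a, 'e::model_space) atlas \<Rightarrow> ('b, 'f::model_space) atlas \<Rightarrow> ('a \<Rightarrow> 'b) \<Rightarrow> 'a set
     \<Rightarrow> ('a \<Rightarrow> ('b, 'f) tvec) set" where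
  "fields_along A B \<phi> S = {Y.
     (\<forall>p\<in>S. Y p \<in> tangent B (\<phi> p)) \<and> (\<forall>p. p \<notin> S \<longrightarrow> Y p = 0) \<and>
     (\<forall>c\<in>A. \<forall>d\<in>B. smooth_on (cmap c ` {p \<in> cdom c \<inter> S. \<phi> p \<in> cdom d}) (\<lambda>x. Y (cinv c x) d))}"

definition vector_fields :: "('a, 'e::model_space) atlas \<Rightarrow> 'a set \<Rightarrow> ('a \<Rightarrow> ('a, 'e) tvec) set" where
  "vector_fields A S = fields_along A A (\<lambda>p. p) S"

text \<open>
  Given the operation \<open>\<Gamma>\<close> sending an open set to the sections over it, the compactly supported
  global sections.
\<close>

definition compact_sections ::
    "('a::topological_space, 'e) atlas \<Rightarrow> ('a set \<Rightarrow> ('a \<Rightarrow> 'v::zero) set) \<Rightarrow> ('a \<Rightarrow> 'v) set" where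
  "compact_sections A \<Gamma> = {X \<in> \<Gamma> (carrier A). compact (supp X) \<and> supp X \<subseteq> carrier A}"

definition fscale ::
    "('a \<Rightarrow> real) \<Rightarrow> ('a \<Rightarrow> 'c \<Rightarrow> 'f::real_vector) \<Rightarrow> 'a \<Rightarrow> 'c \<Rightarrow> 'f"  (infixr "\<cdot>" 75) where
  "f \<cdot> X = (\<lambda>p c. f p *\<^sub>R X p c)"

definition kernel_fields ::
    "('a::topological_space, 'e::model_space) atlas \<Rightarrow> ('b, 'f::model_space) atlas \<Rightarrow> ('a \<Rightarrow> 'b)
     \<Rightarrow> ('a \<Rightarrow> ('a, 'e) tvec) set" where
  "kernel_fields A B \<phi> = {X \<in> compact_sections A (vector_fields A).
     \<forall>p\<in>carrier A. differential A B \<phi> p (X p) = 0}"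

definition related ::
    "('a, 'e::model_space) atlas \<Rightarrow> ('b, 'f::model_space) atlas \<Rightarrow> ('a \<Rightarrow> 'b)
     \<Rightarrow> ('a \<Rightarrow> ('a, 'e) tvec) \<Rightarrow> ('b \<Rightarrow> ('b, 'f) tvec) \<Rightarrow> bool" where
  "related A B \<phi> Z Y \<longleftrightarrow> (\<forall>p\<in>carrier A. differential A B \<phi> p (Z p) = Y (\<phi> p))"

text \<open>In a chart with coordinates \<open>x\<close>: \<open>[X, Y] = D Y(x) X(x) - D X(x) Y(x)\<close>.\<close>

definition lie_bracket ::
    "('a, 'e::model_space) atlas \<Rightarrow> ('a \<Rightarrow> ('a, 'e) tvec) \<Rightarrow> ('a \<Rightarrow> ('a, 'e) tvec)
     \<Rightarrow> 'a \<Rightarrow> ('a, 'e) tvec" where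
  "lie_bracket A X Y = (\<lambda>p c. if c \<in> A \<and> p \<in> cdom c
     then frechet_derivative (\<lambda>x. Y (cinv c x) c) (at (cmap c p)) (X p c)
        - frechet_derivative (\<lambda>x. X (cinv c x) c) (at (cmap c p)) (Y p c)
     else 0)"

section \<open>Singular foliations\<close>

definition submodule ::
    "('a, 'e::model_space) atlas \<Rightarrow> ('a \<Rightarrow> 'c \<Rightarrow> 'f::real_vector) set \<Rightarrow> bool" where
  "submodule A E \<longleftrightarrow> 0 \<in> E \<and> (\<forall>X\<in>E. \<forall>Y\<in>E. X + Y \<in> E) \<and>
     (\<forall>f\<in>Cinf A (carrier A). \<forall>X\<in>E. f \<cdot> X \<in> E)"

text \<open>
  Sections over \<open>W\<close> are extended by zero, so for \<open>supp Z \<subseteq> W\<close> the restriction of \<open>Z\<close> to \<open>W\<close> is \<open>Z\<close>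
  itself, and the restricted module over \<open>W\<close> is \<open>{Z \<in> E. supp Z \<subseteq> W}\<close>.
\<close>

definition locally_finitely_generated ::
    "('a::topological_space, 'e::model_space) atlas
     \<Rightarrow> ('a set \<Rightarrow> ('a \<Rightarrow> 'c \<Rightarrow> 'f::real_vector) set) \<Rightarrow> ('a \<Rightarrow> 'c \<Rightarrow> 'f) set \<Rightarrow> bool" where
  "locally_finitely_generated A \<Gamma> E \<longleftrightarrow> (\<forall>p\<in>carrier A. \<exists>W. open W \<and> p \<in> W \<and> W \<subseteq> carrier A \<and>
     (\<exists>n. \<exists>Y :: nat \<Rightarrow> 'a \<Rightarrow> 'c \<Rightarrow> 'f. (\<forall>j<n. Y j \<in> \<Gamma> W) \<and>
        (\<forall>f\<in>Cinf_c A W. \<forall>j<n. f \<cdot> Y j \<in> {Z \<in> E. supp Z \<subseteq> W}) \<and>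
        (\<forall>Z\<in>{Z \<in> E. supp Z \<subseteq> W}.
           \<exists>f. (\<forall>j<n. f j \<in> Cinf_c A W) \<and> Z = (\<Sum>j<n. f j \<cdot> Y j))))"

definition singular_foliation ::
    "('a::topological_space, 'e::model_space) atlas \<Rightarrow> ('a \<Rightarrow> ('a, 'e) tvec) set \<Rightarrow> bool" where
  "singular_foliation M F \<longleftrightarrow> F \<subseteq> compact_sections M (vector_fields M) \<and> submodule M F \<and>
     (\<forall>X\<in>F. \<forall>Y\<in>F. lie_bracket M X Y \<in> F) \<and> locally_finitely_generated M (vector_fields M) F"

text \<open>The pull-back module \<open>\<phi>\<^sup>-\<^sup>1(F)\<close>.\<close>

definition pullback ::
    "('a::topological_space, 'e::model_space) atlas \<Rightarrow> ('b, 'f::model_space) atlas \<Rightarrow> ('a \<Rightarrow> 'b)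
     \<Rightarrow> ('b \<Rightarrow> ('b, 'f) tvec) set \<Rightarrow> ('a \<Rightarrow> ('a, 'e) tvec) set" where
  "pullback U V \<phi> F = {X \<in> compact_sections U (vector_fields U).
     \<exists>n. \<exists>f :: nat \<Rightarrow> 'a \<Rightarrow> real. \<exists>Y :: nat \<Rightarrow> 'b \<Rightarrow> ('b, 'f) tvec.
       (\<forall>i<n. f i \<in> Cinf_c U (carrier U) \<and> Y i \<in> F) \<and>
       (\<forall>p\<in>carrier U. differential U V \<phi> p (X p) = (\<Sum>i<n. f i \<cdot> (Y i \<circ> \<phi>)) p)}"

text \<open>Bisubmersions of a singular foliation in the sense of Androulidakis and Skandalis.\<close>

definition foliation_bisubmersion ::
    "('m::topological_space, 'e::model_space) atlas \<Rightarrow> ('m \<Rightarrow> ('m, 'e) tvec) set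
     \<Rightarrow> ('u::topological_space, 'd::model_space) atlas \<Rightarrow> ('u \<Rightarrow> 'm) \<Rightarrow> ('u \<Rightarrow> 'm) \<Rightarrow> bool" where
  "foliation_bisubmersion M F U t s \<longleftrightarrow> submersion U M t \<and> submersion U M s \<and>
     pullback U M t F = {X + Y | X Y. X \<in> kernel_fields U M t \<and> Y \<in> kernel_fields U M s} \<and>
     {X + Y | X Y. X \<in> kernel_fields U M t \<and> Y \<in> kernel_fields U M s} = pullback U M s F"

section \<open>Lie groupoids and singular subalgebroids\<close>

record ('g, 'a, 'm, 'e) groupoid =
  arrows :: "('g, 'a) atlas"
  objects :: "('m, 'e) atlas"
  tgt :: "'g \<Rightarrow> 'm"
  src :: "'g \<Rightarrow> 'm"
  one :: "'m \<Rightarrow> 'g"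
  ginv :: "'g \<Rightarrow> 'g"
  mul :: "'g \<Rightarrow> 'g \<Rightarrow> 'g"

text \<open>
  The product \<open>mul G g h\<close> is meaningful if \<open>src G g = tgt G h\<close>. Its smoothness on the embedded
  submanifold of composable pairs is expressed by local smooth extensions to the product manifold.
\<close>

definition lie_groupoid ::
    "('g::{t2_space, second_countable_topology}, 'a::model_space,
      'm::{t2_space, second_countable_topology}, 'e::model_space) groupoid \<Rightarrow> bool" where
  "lie_groupoid G \<longleftrightarrow>
     manifold (arrows G) \<and> manifold (objects G) \<and>
     submersion (arrows G) (objects G) (tgt G) \<and> submersion (arrows G) (objects G) (src G) \<and>
     smooth_map (objects G) (arrows G) (one G) \<and> smooth_map (arrows G) (arrows G) (ginv G) \<and>
     (\<forall>x\<in>carrier (objects G). tgt G (one G x) = x \<and> src G (one G x) = x) \<and>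
     (\<forall>g\<in>carrier (arrows G). mul G (one G (tgt G g)) g = g \<and> mul G g (one G (src G g)) = g) \<and>
     (\<forall>g\<in>carrier (arrows G). tgt G (ginv G g) = src G g \<and> src G (ginv G g) = tgt G g \<and>
        mul G g (ginv G g) = one G (tgt G g) \<and> mul G (ginv G g) g = one G (src G g)) \<and>
     (\<forall>g\<in>carrier (arrows G). \<forall>h\<in>carrier (arrows G). src G g = tgt G h \<longrightarrow>
        mul G g h \<in> carrier (arrows G) \<and>
        tgt G (mul G g h) = tgt G g \<and> src G (mul G g h) = src G h) \<and>
     (\<forall>g\<in>carrier (arrows G). \<forall>h\<in>carrier (arrows G). \<forall>k\<in>carrier (arrows G).
        src G g = tgt G h \<longrightarrow> src G h = tgt G k \<longrightarrow>
        mul G (mul G g h) k = mul G g (mul G h k)) \<and>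
     (\<forall>g\<in>carrier (arrows G). \<forall>h\<in>carrier (arrows G). src G g = tgt G h \<longrightarrow>
        (\<exists>S m. open S \<and> (g, h) \<in> S \<and> S \<subseteq> carrier (arrows G) \<times> carrier (arrows G) \<and>
           smooth_map_on (prod_atlas (arrows G) (arrows G)) (arrows G) S m \<and>
           (\<forall>(g', h')\<in>S. src G g' = tgt G h' \<longrightarrow> m (g', h') = mul G g' h')))"

text \<open>Sections over \<open>S\<close> of \<open>Lie(G)\<close>, the restriction of \<open>ker d(src)\<close> to the units.\<close>

definition lie_sections ::
    "('g, 'a::model_space, 'm, 'e::model_space) groupoid \<Rightarrow> 'm set \<Rightarrow> ('m \<Rightarrow> ('g, 'a) tvec) set" where
  "lie_sections G S = {\<alpha> \<in> fields_along (objects G) (arrows G) (one G) S.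
     \<forall>x\<in>S. differential (arrows G) (objects G) (src G) (one G x) (\<alpha> x) = 0}"

text \<open>
  The differential at the unit \<open>one G (tgt G g)\<close> of right translation \<open>h \<mapsto> mul G h g\<close>. This map is
  defined on the source fibre over \<open>tgt G g\<close> only, so the differential is taken along curves in that
  fibre.
\<close>

definition right_translate ::
    "('g::topological_space, 'a::model_space, 'm, 'e) groupoid \<Rightarrow> 'g
     \<Rightarrow> ('g, 'a) tvec \<Rightarrow> ('g, 'a) tvec" where
  "right_translate G g v = (THE w. \<exists>\<gamma> \<epsilon>. 0 < \<epsilon> \<and>
     smooth_map_on real_line (arrows G) {-\<epsilon><..<\<epsilon>} \<gamma> \<and>
     (\<forall>\<tau>\<in>{-\<epsilon><..<\<epsilon>}. src G (\<gamma> \<tau>) = tgt G g) \<and>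
     \<gamma> 0 = one G (tgt G g) \<and> velocity (arrows G) \<gamma> 0 = v \<and>
     w = velocity (arrows G) (\<lambda>\<tau>. mul G (\<gamma> \<tau>) g) 0)"

definition right_invariant ::
    "('g::topological_space, 'a::model_space, 'm, 'e) groupoid \<Rightarrow> ('m \<Rightarrow> ('g, 'a) tvec)
     \<Rightarrow> 'g \<Rightarrow> ('g, 'a) tvec" where
  "right_invariant G \<alpha> = (\<lambda>g. if g \<in> carrier (arrows G)
     then right_translate G g (\<alpha> (tgt G g)) else 0)"

text \<open>\<open>- i\<^sub>*\<close> of the right-invariant field, where the inversion \<open>i\<close> is its own inverse.\<close>

definition left_invariant ::
    "('g::topological_space, 'a::model_space, 'm, 'e) groupoid \<Rightarrow> ('m \<Rightarrow> ('g, 'a) tvec)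
     \<Rightarrow> 'g \<Rightarrow> ('g, 'a) tvec" where
  "left_invariant G \<alpha> = (\<lambda>g. if g \<in> carrier (arrows G)
     then - differential (arrows G) (arrows G) (ginv G) (ginv G g)
              (right_invariant G \<alpha> (ginv G g))
     else 0)"

definition algebroid_bracket ::
    "('g::topological_space, 'a::model_space, 'm, 'e) groupoid \<Rightarrow> ('m \<Rightarrow> ('g, 'a) tvec)
     \<Rightarrow> ('m \<Rightarrow> ('g, 'a) tvec) \<Rightarrow> 'm \<Rightarrow> ('g, 'a) tvec" where
  "algebroid_bracket G \<alpha> \<beta> = (\<lambda>x. if x \<in> carrier (objects G)
     then lie_bracket (arrows G) (right_invariant G \<alpha>) (right_invariant G \<beta>) (one G x)
     else 0)"

definition singular_subalgebroid ::
    "('g::topological_space, 'a::model_space, 'm::topological_space, 'e::model_space) groupoid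
     \<Rightarrow> ('m \<Rightarrow> ('g, 'a) tvec) set \<Rightarrow> bool" where
  "singular_subalgebroid G B \<longleftrightarrow> B \<subseteq> compact_sections (objects G) (lie_sections G) \<and>
     submodule (objects G) B \<and> (\<forall>\<alpha>\<in>B. \<forall>\<beta>\<in>B. algebroid_bracket G \<alpha> \<beta> \<in> B) \<and>
     locally_finitely_generated (objects G) (lie_sections G) B"

definition Cinf_c_span ::
    "('a::topological_space, 'e::model_space) atlas \<Rightarrow> ('a \<Rightarrow> 'c \<Rightarrow> 'f::real_vector) set
     \<Rightarrow> ('a \<Rightarrow> 'c \<Rightarrow> 'f) set" where
  "Cinf_c_span A E = {\<Sum>i<n. f i \<cdot> Y i | (n::nat) f Y.
     \<forall>i<n. f i \<in> Cinf_c A (carrier A) \<and> Y i \<in> E}"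

definition bisubmersion ::
    "('g::{t2_space, second_countable_topology}, 'a::model_space,
      'm::{t2_space, second_countable_topology}, 'e::model_space) groupoid
     \<Rightarrow> ('m \<Rightarrow> ('g, 'a) tvec) set
     \<Rightarrow> ('u::{t2_space, second_countable_topology}, 'd::model_space) atlas \<Rightarrow> ('u \<Rightarrow> 'g) \<Rightarrow> bool" where
  "bisubmersion G B U \<phi> \<longleftrightarrow>
     lie_groupoid G \<and> singular_subalgebroid G B \<and> manifold U \<and> smooth_map U (arrows G) \<phi> \<and>
     submersion U (objects G) (src G \<circ> \<phi>) \<and> submersion U (objects G) (tgt G \<circ> \<phi>) \<and>
     (\<forall>\<alpha>\<in>B. (\<exists>Z\<in>vector_fields U (carrier U). related U (arrows G) \<phi> Z (right_invariant G \<alpha>)) \<and>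
            (\<exists>Z\<in>vector_fields U (carrier U). related U (arrows G) \<phi> Z (left_invariant G \<alpha>))) \<and>
     pullback U (arrows G) \<phi> (Cinf_c_span (arrows G) (right_invariant G ` B))
       = kernel_fields U (objects G) (src G \<circ> \<phi>) \<and>
     pullback U (arrows G) \<phi> (Cinf_c_span (arrows G) (left_invariant G ` B))
       = kernel_fields U (objects G) (tgt G \<circ> \<phi>)"

section \<open>The pair groupoid\<close>

definition pair_groupoid ::
    "('m, 'e) atlas \<Rightarrow> ('m \<times> 'm, 'e \<times> 'e, 'm, 'e) groupoid" where
  "pair_groupoid M = \<lparr>arrows = prod_atlas M M, objects = M, tgt = fst, src = snd,
     one = (\<lambda>x. (x, x)), ginv = prod.swap, mul = (\<lambda>g h. (fst g, snd h))\<rparr>"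

text \<open>
  The identification \<open>TM = Lie(M \<times> M)\<close> sends \<open>X\<close> to \<open>(X, 0)\<close> along the diagonal, obtained at \<open>x\<close> with
  the differential of \<open>y \<mapsto> (y, x)\<close>.
\<close>

definition pair_section ::
    "('m, 'e::model_space) atlas \<Rightarrow> ('m \<Rightarrow> ('m, 'e) tvec) \<Rightarrow> 'm \<Rightarrow> ('m \<times> 'm, 'e \<times> 'e) tvec" where
  "pair_section M X = (\<lambda>x. differential M (prod_atlas M M) (\<lambda>y. (y, x)) x (X x))"

end

theory Submission
  imports Defs
begin

text \<open>
  Write \<open>\<phi> = (t\<^sub>U, s\<^sub>U)\<close>. In the pair groupoid the right-invariant field of \<open>X \<in> F\<close> is \<open>(X, 0)\<close> and the
  left-invariant one is \<open>(0, -X)\<close> (\<open>right_invariant_pair\<close>, \<open>left_invariant_pair\<close>), and \<open>d\<phi>(Z)\<close> is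
  \<open>(dt\<^sub>U(Z), ds\<^sub>U(Z))\<close>. Hence \<open>d\<phi>(Z)\<close> is a combination of right-invariant fields along \<open>\<phi>\<close> exactly if \<open>dt\<^sub>U(Z)\<close>
  is a combination of the \<open>X \<circ> t\<^sub>U\<close> and \<open>ds\<^sub>U(Z) = 0\<close>; cut-off functions reconcile the coefficients on
  \<open>M \<times> M\<close> with those on \<open>U\<close> (\<open>pullback_invariant_span\<close>). So the conditions of a bisubmersion on pull-backs
  say that \<open>ker ds\<^sub>U\<close> lies in \<open>t\<^sub>U\<^sup>-\<^sup>1(F)\<close> and \<open>ker dt\<^sub>U\<close> in \<open>s\<^sub>U\<^sup>-\<^sup>1(F)\<close>, while those on related fields ask for
  lifts of each \<open>X\<close> along \<open>t\<^sub>U\<close> inside \<open>ker ds\<^sub>U\<close> and along \<open>s\<^sub>U\<close> inside \<open>ker dt\<^sub>U\<close>. The remaining parts, that the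
  pair groupoid is a Lie groupoid and that \<open>F\<close> is a singular subalgebroid of it, hold for every \<open>F\<close>
  (\<open>lie_groupoid_pair\<close>, \<open>singular_subalgebroid_pair\<close>).

  Suppose the foliation condition holds. The inclusions of kernels are immediate. For the lifts, \<open>t\<^sub>U\<close> being a
  submersion, \<open>X\<close> has a lift \<open>Z\<close> near each point (\<open>submersion_local_lift\<close>), which after
  multiplication with a bump function \<open>h\<close> lies in \<open>t\<^sub>U\<^sup>-\<^sup>1(F) = ker dt\<^sub>U + ker ds\<^sub>U\<close>; the component in \<open>ker ds\<^sub>U\<close> still
  projects to \<open>h X\<close>. These local lifts are glued over a countable cover (\<open>related_glue\<close>,
  \<open>related_of_pullback_split\<close>).

  Conversely, if \<open>dt\<^sub>U(Z)\<close> is the sum of the \<open>f\<^sub>i (X\<^sub>i \<circ> t\<^sub>U)\<close> and \<open>Z\<^sub>i\<close> lifts \<open>X\<^sub>i\<close> inside \<open>ker ds\<^sub>U\<close>, then \<open>Z\<close> is the sum of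
  an element of \<open>ker dt\<^sub>U\<close> and the sum of the \<open>f\<^sub>i Z\<^sub>i\<close>, an element of \<open>ker ds\<^sub>U\<close>
  (\<open>pullback_split_of_related\<close>). The same holds with \<open>t\<^sub>U\<close> and \<open>s\<^sub>U\<close> exchanged.

  The first parts develop the calculus that this needs on model spaces and manifolds: closure properties of
  smooth maps, bump functions, and coordinates with respect to smooth frames by Gram-Schmidt, from which
  the local lifts are built.
\<close>

section \<open>Calculus of smooth maps between normed spaces\<close>

lemma differentiable_cong_open:
  assumes "open S" "x \<in> S" "\<And>y. y \<in> S \<Longrightarrow> f y = g y"
  shows "f differentiable (at x) \<longleftrightarrow> g differentiable (at x)"
    and "frechet_derivative f (at x) = frechet_derivative g (at x)"
proof -
  have *: "(f has_derivative f') (at x) \<longleftrightarrow> (g has_derivative f') (at x)" for f'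
    using assms has_derivative_transform_within_open[of f f' x UNIV S g]
      has_derivative_transform_within_open[of g f' x UNIV S f] by auto
  then show "f differentiable (at x) \<longleftrightarrow> g differentiable (at x)"
    by (auto simp: differentiable_def)
  show "frechet_derivative f (at x) = frechet_derivative g (at x)"
    by (simp add: frechet_derivative_def *)
qed

lemma Ck_on_cong:
  assumes "open S" "\<And>x. x \<in> S \<Longrightarrow> f x = g x"
  shows "Ck_on k S f \<longleftrightarrow> Ck_on k S g"
  using assms(2)
proof (induction k arbitrary: f g)
  case 0
  then show ?case by (simp cong: continuous_on_cong)
next
  case (Suc k)
  have "Ck_on k S (\<lambda>x. frechet_derivative f (at x) v)
    \<longleftrightarrow> Ck_on k S (\<lambda>x. frechet_derivative g (at x) v)" for v
    by (rule Suc.IH) (simp add: differentiable_cong_open(2)[OF assms(1) _ Suc.prems])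
  then show ?case
    using differentiable_cong_open(1)[OF assms(1) _ Suc.prems] by auto
qed

lemma Ck_on_subset: "Ck_on k S f \<Longrightarrow> T \<subseteq> S \<Longrightarrow> Ck_on k T f"
proof (induction k arbitrary: f)
  case 0
  then show ?case by (auto intro: continuous_on_subset)
next
  case (Suc k)
  then have "Ck_on k T (\<lambda>x. frechet_derivative f (at x) v)" for v by simp
  with Suc.prems show ?case by auto
qed

lemma Ck_on_Suc_imp: "Ck_on (Suc k) S f \<Longrightarrow> Ck_on k S f"
proof (induction k arbitrary: f)
  case 0
  then show ?case
    by (auto intro!: continuous_at_imp_continuous_on differentiable_imp_continuous_within)
next
  case (Suc k)
  then show ?case by (metis Ck_on.simps(2))
qed

lemma Ck_on_local:
  assumes "\<And>x. x \<in> S \<Longrightarrow> \<exists>T. open T \<and> x \<in> T \<and> T \<subseteq> S \<and> Ck_on k T f"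
  shows "Ck_on k S f"
  using assms
proof (induction k arbitrary: f)
  case 0
  have "isCont f x" if "x \<in> S" for x
    using 0[OF that] by (metis Ck_on.simps(1) continuous_on_eq_continuous_at)
  then show ?case by (simp add: continuous_at_imp_continuous_on)
next
  case (Suc k)
  show ?case
    unfolding Ck_on.simps
  proof (intro conjI ballI allI)
    fix x assume "x \<in> S"
    then show "f differentiable (at x)" using Suc.prems by fastforce
  next
    fix v
    show "Ck_on k S (\<lambda>x. frechet_derivative f (at x) v)"
      by (rule Suc.IH) (use Suc.prems in fastforce)
  qed
qed

lemma Ck_on_const: "Ck_on k S (\<lambda>x. c)"
proof (induction k arbitrary: c)
  case (Suc k)
  then show ?case by simp
qed simp

lemma Ck_on_bounded_linear_comp:
  assumes "bounded_linear L" "Ck_on k S f" "open S"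
  shows "Ck_on k S (\<lambda>x. L (f x))"
  using assms(2)
proof (induction k arbitrary: f)
  case 0
  then show ?case
    by (simp add: bounded_linear.continuous_on[OF assms(1)])
next
  case (Suc k)
  have der: "((\<lambda>x. L (f x)) has_derivative (\<lambda>v. L (frechet_derivative f (at x) v))) (at x)"
    if "x \<in> S" for x
    using Suc.prems that
    by (auto simp: frechet_derivative_works intro: bounded_linear.has_derivative[OF assms(1)])
  have "Ck_on k S (\<lambda>x. frechet_derivative (\<lambda>x. L (f x)) (at x) v)" for v
  proof -
    have "Ck_on k S (\<lambda>x. L (frechet_derivative f (at x) v))"
      using Suc by auto
    then show ?thesis
      by (subst Ck_on_cong[OF assms(3)]) (simp_all add: frechet_derivative_at[OF der, symmetric])
  qed
  then show ?case using der by (auto simp: differentiable_def)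
qed

lemma Ck_on_bounded_linear:
  assumes "bounded_linear L" "open S"
  shows "Ck_on k S L"
proof (cases k)
  case 0
  then show ?thesis by (simp add: linear_continuous_on assms(1))
next
  case (Suc j)
  have der: "(L has_derivative L) (at x)" for x
    using bounded_linear_imp_has_derivative[OF assms(1)] .
  then show ?thesis
    using Suc by (auto simp: frechet_derivative_at[OF der, symmetric] Ck_on_const differentiable_def)
qed

lemma Ck_on_add:
  assumes "Ck_on k S f" "Ck_on k S g" "open S"
  shows "Ck_on k S (\<lambda>x. f x + g x)"
  using assms(1,2)
proof (induction k arbitrary: f g)
  case 0
  then show ?case by (simp add: continuous_on_add)
next
  case (Suc k)
  have der: "((\<lambda>x. f x + g x) has_derivative
      (\<lambda>v. frechet_derivative f (at x) v + frechet_derivative g (at x) v)) (at x)"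
    if "x \<in> S" for x
    using Suc.prems that
    by (auto simp: frechet_derivative_works intro: has_derivative_add)
  have "Ck_on k S (\<lambda>x. frechet_derivative (\<lambda>x. f x + g x) (at x) v)" for v
  proof -
    have "Ck_on k S (\<lambda>x. frechet_derivative f (at x) v + frechet_derivative g (at x) v)"
      using Suc by auto
    then show ?thesis
      by (subst Ck_on_cong[OF assms(3)]) (simp_all add: frechet_derivative_at[OF der, symmetric])
  qed
  then show ?case using der by (auto simp: differentiable_def)
qed

lemma Ck_on_bilinear:
  assumes bl: "bounded_bilinear b" and "Ck_on k S f" "Ck_on k S g" "open S"
  shows "Ck_on k S (\<lambda>x. b (f x) (g x))"
  using assms(2,3)
proof (induction k arbitrary: f g)
  case 0
  then show ?case by (simp add: bounded_bilinear.continuous_on[OF bl])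
next
  case (Suc k)
  have der: "((\<lambda>x. b (f x) (g x)) has_derivative
      (\<lambda>v. b (f x) (frechet_derivative g (at x) v) + b (frechet_derivative f (at x) v) (g x))) (at x)"
    if "x \<in> S" for x
    using Suc.prems that
    by (auto simp: frechet_derivative_works intro: bounded_bilinear.FDERIV[OF bl])
  have "Ck_on k S (\<lambda>x. frechet_derivative (\<lambda>x. b (f x) (g x)) (at x) v)" for v
  proof -
    have "Ck_on k S (\<lambda>x. b (f x) (frechet_derivative g (at x) v)
        + b (frechet_derivative f (at x) v) (g x))"
      by (intro Ck_on_add[OF _ _ assms(4)] Suc.IH Ck_on_Suc_imp[OF Suc.prems(1)]
            Ck_on_Suc_imp[OF Suc.prems(2)])
         (use Suc.prems in auto)
    then show ?thesis
      by (subst Ck_on_cong[OF assms(4)]) (simp_all add: frechet_derivative_at[OF der, symmetric])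
  qed
  then show ?case using der by (auto simp: differentiable_def)
qed

lemma Ck_on_sum:
  assumes "\<And>i. i \<in> I \<Longrightarrow> Ck_on k S (f i)" "open S"
  shows "Ck_on k S (\<lambda>x. \<Sum>i\<in>I. f i x)"
  using assms(1)
proof (induction I rule: infinite_finite_induct)
  case (insert i I)
  then have "Ck_on k S (\<lambda>x. f i x + (\<Sum>i\<in>I. f i x))"
    by (intro Ck_on_add[OF _ _ assms(2)]) auto
  with insert.hyps show ?case by simp
qed (simp_all add: Ck_on_const)

text \<open>
  The class of model spaces only provides a finite spanning set; Gram-Schmidt turns it into
  coordinates.
\<close>

lemma ex_orthonormal_basis:
  "\<exists>B::'e::model_space set. finite B \<and> (\<forall>x. x = (\<Sum>b\<in>B. (x \<bullet> b) *\<^sub>R b)) \<and>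
     (\<forall>b\<in>B. \<forall>c\<in>B. b \<bullet> c = (if b = c then 1 else 0))"
proof -
  obtain B :: "'e set" where B: "finite B" "\<And>x. \<exists>a. x = (\<Sum>b\<in>B. a b *\<^sub>R b)"
    using finite_dimensional by blast
  obtain C where C: "finite C" "span C = span B" "pairwise orthogonal C"
    using basis_orthogonal[OF B(1)] by blast
  have "x \<in> span B" for x
  proof -
    obtain a where a: "x = (\<Sum>b\<in>B. a b *\<^sub>R b)" using B(2) by blast
    show ?thesis unfolding a by (intro span_sum span_scale span_base)
  qed
  then have spC: "x \<in> span C" for x using C(2) by simp
  define D where "D = (\<lambda>c. c /\<^sub>R norm c) ` (C - {0})"
  have fin: "finite D" using C(1) by (simp add: D_def)
  have orth: "b \<bullet> c = (if b = c then 1 else 0)" if "b \<in> D" "c \<in> D" for b c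
  proof -
    obtain b' where b': "b' \<in> C" "b' \<noteq> 0" "b = b' /\<^sub>R norm b'" using \<open>b \<in> D\<close> by (auto simp: D_def)
    obtain c' where c': "c' \<in> C" "c' \<noteq> 0" "c = c' /\<^sub>R norm c'" using \<open>c \<in> D\<close> by (auto simp: D_def)
    show ?thesis
    proof (cases "b' = c'")
      case True
      then show ?thesis using b' c' by (simp add: power2_norm_eq_inner[symmetric] power2_eq_square)
    next
      case False
      then have "b' \<bullet> c' = 0" using C(3) b' c' by (auto simp: pairwise_def orthogonal_def)
      then have "b \<bullet> c = 0" using b' c' by simp
      moreover have "c \<bullet> c \<noteq> 0" using c' by simp
      ultimately show ?thesis by auto
    qed
  qed
  have "c \<in> span D" if "c \<in> C" for c
  proof (cases "c = 0")
    case False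
    then have "c /\<^sub>R norm c \<in> span D" using that by (auto simp: D_def intro: span_base)
    then have "norm c *\<^sub>R (c /\<^sub>R norm c) \<in> span D" by (rule span_scale)
    then show ?thesis using False by simp
  qed (simp add: span_zero)
  then have "span C \<subseteq> span D" by (simp add: span_minimal subsetI)
  then have spD: "x \<in> span D" for x using spC by blast
  have "x = (\<Sum>b\<in>D. (x \<bullet> b) *\<^sub>R b)" for x
  proof -
    obtain a where a: "x = (\<Sum>b\<in>D. a b *\<^sub>R b)"
      using spD[of x] by (auto simp: span_finite[OF fin])
    have "x \<bullet> b = a b" if "b \<in> D" for b
    proof -
      have "x \<bullet> b = (\<Sum>c\<in>D. a c * (c \<bullet> b))" unfolding a by (simp add: inner_sum_left)
      also have "\<dots> = (\<Sum>c\<in>D. if c = b then a c else 0)"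
        by (rule sum.cong) (use orth that in auto)
      also have "\<dots> = a b" using that fin by (simp add: sum.delta)
      finally show ?thesis .
    qed
    then have "(\<Sum>b\<in>D. (x \<bullet> b) *\<^sub>R b) = (\<Sum>b\<in>D. a b *\<^sub>R b)" by simp
    then show ?thesis using a by simp
  qed
  with fin orth show ?thesis by blast
qed

definition obasis :: "'e::model_space set" where
  "obasis = (SOME B. finite B \<and> (\<forall>x. x = (\<Sum>b\<in>B. (x \<bullet> b) *\<^sub>R b)) \<and>
     (\<forall>b\<in>B. \<forall>c\<in>B. b \<bullet> c = (if b = c then 1 else 0)))"

lemma finite_obasis [simp]: "finite (obasis :: 'e::model_space set)"
  and obasis_expansion: "(x :: 'e) = (\<Sum>b\<in>obasis. (x \<bullet> b) *\<^sub>R b)"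
  and inner_obasis: "(b :: 'e) \<in> obasis \<Longrightarrow> c \<in> obasis \<Longrightarrow> b \<bullet> c = (if b = c then 1 else 0)"
proof -
  have *: "finite (obasis :: 'e set) \<and> (\<forall>x::'e. x = (\<Sum>b\<in>obasis. (x \<bullet> b) *\<^sub>R b)) \<and>
     (\<forall>b\<in>obasis. \<forall>c\<in>obasis. b \<bullet> (c::'e) = (if b = c then 1 else 0))"
    unfolding obasis_def by (rule someI_ex[OF ex_orthonormal_basis])
  show "finite (obasis :: 'e set)" using * by (rule conjunct1)
  show "x = (\<Sum>b\<in>obasis. (x \<bullet> b) *\<^sub>R b)" for x :: 'e
    using *[THEN conjunct2, THEN conjunct1] by (rule spec)
  show "b \<in> obasis \<Longrightarrow> c \<in> obasis \<Longrightarrow> b \<bullet> c = (if b = c then 1 else 0)" for b c :: 'e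
    using *[THEN conjunct2, THEN conjunct2] by simp
qed

lemma linear_obasis_expansion:
  assumes "linear L"
  shows "L v = (\<Sum>b\<in>obasis. (v \<bullet> b) *\<^sub>R L b)"
proof -
  have "L v = L (\<Sum>b\<in>obasis. (v \<bullet> b) *\<^sub>R b)"
    by (rule arg_cong[OF obasis_expansion])
  also have "\<dots> = (\<Sum>b\<in>obasis. (v \<bullet> b) *\<^sub>R L b)"
    by (simp add: linear_sum[OF assms] linear_scale[OF assms])
  finally show ?thesis .
qed

text \<open>
  Since \<open>Ck_on\<close> only speaks of derivatives in fixed directions, the varying direction
  \<open>D f(x) v\<close> in the chain rule is expanded in an orthonormal basis of the middle space.
\<close>

lemma Ck_on_compose:
  fixes f :: "'a::real_normed_vector \<Rightarrow> 'b::model_space" and g :: "'b \<Rightarrow> 'c::real_normed_vector"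
  assumes "Ck_on k S f" "Ck_on k T g" "f ` S \<subseteq> T" "open S"
  shows "Ck_on k S (\<lambda>x. g (f x))"
  using assms(1,2)
proof (induction k arbitrary: g)
  case 0
  then show ?case using assms(3) by (auto intro: continuous_on_compose2)
next
  case (Suc k)
  have der: "((\<lambda>x. g (f x)) has_derivative
      (\<lambda>v. frechet_derivative g (at (f x)) (frechet_derivative f (at x) v))) (at x)"
    if "x \<in> S" for x
  proof -
    have "(f has_derivative frechet_derivative f (at x)) (at x)"
         "(g has_derivative frechet_derivative g (at (f x))) (at (f x))"
      using Suc.prems that assms(3) by (auto simp: frechet_derivative_works)
    then show ?thesis by (rule has_derivative_compose)
  qed
  have "Ck_on k S (\<lambda>x. frechet_derivative (\<lambda>x. g (f x)) (at x) v)" for v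
  proof -
    have "Ck_on k S (\<lambda>x. (frechet_derivative f (at x) v \<bullet> b) *\<^sub>R frechet_derivative g (at (f x)) b)"
      for b
      by (intro Ck_on_bilinear[OF bounded_bilinear_scaleR _ _ assms(4)] Suc.IH
            Ck_on_bounded_linear_comp[OF bounded_linear_inner_left _ assms(4)]
            Ck_on_Suc_imp[OF Suc.prems(1)])
         (use Suc.prems in auto)
    then have "Ck_on k S (\<lambda>x. \<Sum>b\<in>obasis. (frechet_derivative f (at x) v \<bullet> b) *\<^sub>R
        frechet_derivative g (at (f x)) b)"
      by (intro Ck_on_sum[OF _ assms(4)])
    moreover have "frechet_derivative g (at (f x)) (frechet_derivative f (at x) v)
        = (\<Sum>b\<in>obasis. (frechet_derivative f (at x) v \<bullet> b) *\<^sub>R frechet_derivative g (at (f x)) b)"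
      if "x \<in> S" for x
    proof -
      have "g differentiable (at (f x))" using Suc.prems that assms(3) by auto
      then show ?thesis by (intro linear_obasis_expansion linear_frechet_derivative)
    qed
    ultimately show ?thesis
      by (subst Ck_on_cong[OF assms(4)]) (simp_all add: frechet_derivative_at[OF der, symmetric])
  qed
  then show ?case using der by (auto simp: differentiable_def)
qed

text \<open>
  The derivative is a polynomial in \<open>inverse\<close> itself, so each order of differentiability gives the next.
\<close>

lemma Ck_on_inverse: "Ck_on k (- {0}) (inverse :: real \<Rightarrow> real)"
proof (induction k)
  case 0
  then show ?case by (simp add: continuous_on_inverse)
next
  case (Suc k)
  have op: "open (- {0::real})" by (simp add: open_Compl)
  have der: "(inverse has_derivative (\<lambda>v. - (inverse x * v * inverse x))) (at x)"
    if "x \<in> - {0}" for x :: real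
    using has_derivative_inverse'[of x UNIV] that by simp
  have "Ck_on k (- {0}) (\<lambda>x::real. frechet_derivative inverse (at x) v)" for v
  proof -
    have "Ck_on k (- {0}) (\<lambda>x::real. (- v) *\<^sub>R (inverse x * inverse x))"
      by (intro Ck_on_bounded_linear_comp[OF bounded_linear_scaleR_right _ op]
            Ck_on_bilinear[OF bounded_bilinear_mult _ _ op] Suc)
    then show ?thesis
      by (subst Ck_on_cong[OF op]) (simp_all add: frechet_derivative_at[OF der, symmetric] mult_ac)
  qed
  then show ?case using der by (auto simp: differentiable_def)
qed

lemma smooth_onD: "smooth_on S f \<Longrightarrow> Ck_on k S f"
  by (simp add: smooth_on_def)

lemma smooth_on_cong:
  assumes "open S" "\<And>x. x \<in> S \<Longrightarrow> f x = g x"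
  shows "smooth_on S f \<longleftrightarrow> smooth_on S g"
  using Ck_on_cong[OF assms] by (simp add: smooth_on_def)

lemma smooth_on_subset: "smooth_on S f \<Longrightarrow> T \<subseteq> S \<Longrightarrow> smooth_on T f"
  by (auto simp: smooth_on_def intro: Ck_on_subset)

lemma smooth_on_local:
  assumes "\<And>x. x \<in> S \<Longrightarrow> \<exists>T. open T \<and> x \<in> T \<and> T \<subseteq> S \<and> smooth_on T f"
  shows "smooth_on S f"
  unfolding smooth_on_def
proof (intro allI Ck_on_local)
  fix k x assume "x \<in> S"
  from assms[OF this] obtain T where "open T" "x \<in> T" "T \<subseteq> S" "smooth_on T f" by blast
  then show "\<exists>T. open T \<and> x \<in> T \<and> T \<subseteq> S \<and> Ck_on k T f"
    using smooth_onD[of T f k] by blast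
qed

lemma smooth_on_const: "smooth_on S (\<lambda>x. c)"
  by (simp add: smooth_on_def Ck_on_const)

lemma smooth_on_bounded_linear_comp:
  "bounded_linear L \<Longrightarrow> smooth_on S f \<Longrightarrow> open S \<Longrightarrow> smooth_on S (\<lambda>x. L (f x))"
  by (simp add: smooth_on_def Ck_on_bounded_linear_comp)

lemma smooth_on_bounded_linear: "bounded_linear L \<Longrightarrow> open S \<Longrightarrow> smooth_on S L"
  by (simp add: smooth_on_def Ck_on_bounded_linear)

lemma smooth_on_ident: "open S \<Longrightarrow> smooth_on S (\<lambda>x. x)"
  by (rule smooth_on_bounded_linear) (simp_all add: bounded_linear_ident)

lemma smooth_on_add:
  "smooth_on S f \<Longrightarrow> smooth_on S g \<Longrightarrow> open S \<Longrightarrow> smooth_on S (\<lambda>x. f x + g x)"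
  by (simp add: smooth_on_def Ck_on_add)

lemma smooth_on_sum:
  "(\<And>i. i \<in> I \<Longrightarrow> smooth_on S (f i)) \<Longrightarrow> open S \<Longrightarrow> smooth_on S (\<lambda>x. \<Sum>i\<in>I. f i x)"
  by (simp add: smooth_on_def Ck_on_sum)

lemma smooth_on_bilinear:
  "bounded_bilinear b \<Longrightarrow> smooth_on S f \<Longrightarrow> smooth_on S g \<Longrightarrow> open S \<Longrightarrow>
     smooth_on S (\<lambda>x. b (f x) (g x))"
  by (simp add: smooth_on_def Ck_on_bilinear)

lemmas smooth_on_scaleR = smooth_on_bilinear[OF bounded_bilinear_scaleR]
  and smooth_on_mult = smooth_on_bilinear[OF bounded_bilinear_mult]
  and smooth_on_inner = smooth_on_bilinear[OF bounded_bilinear_inner]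

lemma smooth_on_minus:
  "smooth_on S f \<Longrightarrow> open S \<Longrightarrow> smooth_on S (\<lambda>x. - f x)"
  by (rule smooth_on_bounded_linear_comp[OF bounded_linear_minus[OF bounded_linear_ident]])

lemma smooth_on_diff:
  "smooth_on S f \<Longrightarrow> smooth_on S g \<Longrightarrow> open S \<Longrightarrow> smooth_on S (\<lambda>x. f x - g x)"
  using smooth_on_add[of S f "\<lambda>x. - g x"] smooth_on_minus[of S g] by simp

lemma smooth_on_Pair:
  assumes "smooth_on S f" "smooth_on S g" "open S"
  shows "smooth_on S (\<lambda>x. (f x, g x))"
proof -
  have "smooth_on S (\<lambda>x. (f x, 0) + (0, g x))"
    using assms
    by (intro smooth_on_add smooth_on_bounded_linear_comp[of "\<lambda>u. (u, 0)"]
          smooth_on_bounded_linear_comp[of "\<lambda>u. (0, u)"]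
          bounded_linear_Pair bounded_linear_ident bounded_linear_zero)
  then show ?thesis by simp
qed

lemma smooth_on_compose:
  fixes f :: "'a::real_normed_vector \<Rightarrow> 'b::model_space"
  assumes "smooth_on S f" "smooth_on T g" "f ` S \<subseteq> T" "open S"
  shows "smooth_on S (\<lambda>x. g (f x))"
  unfolding smooth_on_def
  by (intro allI Ck_on_compose[OF smooth_onD[OF assms(1)] smooth_onD[OF assms(2)] assms(3,4)])

lemma smooth_on_divide:
  fixes f g :: "'a::real_normed_vector \<Rightarrow> real"
  assumes "smooth_on S f" "smooth_on S g" "\<And>x. x \<in> S \<Longrightarrow> g x \<noteq> 0" "open S"
  shows "smooth_on S (\<lambda>x. f x / g x)"
proof -
  have "smooth_on (- {0}) (inverse :: real \<Rightarrow> real)" by (simp add: smooth_on_def Ck_on_inverse)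
  then have "smooth_on S (\<lambda>x. inverse (g x))"
    using assms by (intro smooth_on_compose[of S g "- {0}" inverse]) auto
  with assms show ?thesis unfolding divide_inverse by (intro smooth_on_mult)
qed

lemma smooth_on_imp_differentiable: "smooth_on S f \<Longrightarrow> x \<in> S \<Longrightarrow> f differentiable (at x)"
  using smooth_onD[of S f "Suc 0"] by simp

lemma smooth_on_imp_has_derivative:
  "smooth_on S f \<Longrightarrow> x \<in> S \<Longrightarrow> (f has_derivative frechet_derivative f (at x)) (at x)"
  by (rule frechet_derivative_works[THEN iffD1, OF smooth_on_imp_differentiable])

lemma smooth_on_imp_continuous_on: "smooth_on S f \<Longrightarrow> continuous_on S f"
  using smooth_onD[of S f 0] by simp

lemma smooth_on_frechet_derivative:
  "smooth_on S f \<Longrightarrow> smooth_on S (\<lambda>x. frechet_derivative f (at x) v)"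
  unfolding smooth_on_def using Ck_on.simps(2)[of _ S f] by simp

section \<open>Bump functions on model spaces\<close>

text \<open>
  In coordinates the ball is a closed part of a cube, and a cube is a finite sum of segments.
\<close>

lemma compact_cball_model: "compact (cball (x::'e::model_space) r)"
proof -
  have "compact {(\<Sum>b\<in>C. a b *\<^sub>R b) | a. \<forall>b\<in>C. \<bar>a b\<bar> \<le> R}" if "finite C" for C :: "'e set" and R
    using that
  proof induction
    case empty
    then show ?case by simp
  next
    case (insert c C)
    have "compact ((\<lambda>t. t *\<^sub>R c) ` {-R..R})"
      by (intro compact_continuous_image continuous_intros) simp
    from compact_sums[OF this insert.IH]
    have "compact {x + y | x y. x \<in> (\<lambda>t. t *\<^sub>R c) ` {-R..R} \<and>
        y \<in> {(\<Sum>b\<in>C. a b *\<^sub>R b) | a. \<forall>b\<in>C. \<bar>a b\<bar> \<le> R}}" .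
    also have "\<dots> = {(\<Sum>b\<in>insert c C. a b *\<^sub>R b) | a. \<forall>b\<in>insert c C. \<bar>a b\<bar> \<le> R}"
      (is "?A = ?B")
    proof
      show "?A \<subseteq> ?B"
      proof clarsimp
        fix t a assume *: "- R \<le> t" "t \<le> R" "\<forall>b\<in>C. \<bar>a b\<bar> \<le> R"
        have "(\<Sum>b\<in>C. a b *\<^sub>R b) = (\<Sum>b\<in>C. (a(c := t)) b *\<^sub>R b)"
          using insert.hyps by (intro sum.cong) auto
        then show "\<exists>a'. t *\<^sub>R c + (\<Sum>b\<in>C. a b *\<^sub>R b) = (\<Sum>b\<in>insert c C. a' b *\<^sub>R b) \<and>
            \<bar>a' c\<bar> \<le> R \<and> (\<forall>b\<in>C. \<bar>a' b\<bar> \<le> R)"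
          using * insert.hyps by (intro exI[of _ "a(c := t)"]) auto
      qed
      show "?B \<subseteq> ?A"
      proof clarsimp
        fix a assume *: "\<bar>a c\<bar> \<le> R" "\<forall>b\<in>C. \<bar>a b\<bar> \<le> R"
        then show "\<exists>x y. (\<Sum>b\<in>insert c C. a b *\<^sub>R b) = x + y \<and> x \<in> (\<lambda>t. t *\<^sub>R c) ` {- R..R} \<and>
            (\<exists>a. y = (\<Sum>b\<in>C. a b *\<^sub>R b) \<and> (\<forall>b\<in>C. \<bar>a b\<bar> \<le> R))"
          using insert.hyps
          by (intro exI[of _ "a c *\<^sub>R c"] exI[of _ "\<Sum>b\<in>C. a b *\<^sub>R b"] conjI
                exI[of _ a] image_eqI[of _ _ "a c"]) auto
      qed
    qed
    finally show ?case .
  qed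
  then have cpt: "compact {(\<Sum>b\<in>obasis. a b *\<^sub>R b) | a. \<forall>b\<in>(obasis::'e set). \<bar>a b\<bar> \<le> R}" for R
    by simp
  define R where "R = norm x + r"
  have "cball x r \<subseteq> {(\<Sum>b\<in>obasis. a b *\<^sub>R b) | a. \<forall>b\<in>(obasis::'e set). \<bar>a b\<bar> \<le> R}"
  proof
    fix y assume "y \<in> cball x r"
    then have "norm y \<le> R"
      using norm_triangle_sub[of y x] by (simp add: R_def dist_norm norm_minus_commute)
    moreover have "\<bar>y \<bullet> b\<bar> \<le> norm y" if "b \<in> obasis" for b
    proof -
      have "norm b = 1" using inner_obasis[OF that that] by (simp add: norm_eq_sqrt_inner)
      then show ?thesis using Cauchy_Schwarz_ineq2[of y b] by simp
    qed
    ultimately have "\<forall>b\<in>obasis. \<bar>y \<bullet> b\<bar> \<le> R" by fastforce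
    then show "y \<in> {(\<Sum>b\<in>obasis. a b *\<^sub>R b) | a. \<forall>b\<in>(obasis::'e set). \<bar>a b\<bar> \<le> R}"
      using obasis_expansion[of y] by blast
  qed
  then show ?thesis
    using compact_Int_closed[OF cpt[of R] closed_cball[of x r]] by (simp add: Int_absorb1)
qed

text \<open>
  The powers of \<open>1/x\<close> are there to make the family closed under differentiation.
\<close>

definition flat :: "nat \<Rightarrow> real \<Rightarrow> real" where
  "flat k x = (if x > 0 then inverse x ^ k * exp (- inverse x) else 0)"

lemma flat_tendsto_0: "(flat k \<longlongrightarrow> 0) (at_right 0)"
proof -
  have "((\<lambda>x::real. inverse x ^ k / exp (inverse x)) \<longlongrightarrow> 0) (at_right 0)"
    using filterlim_compose[OF tendsto_power_div_exp_0 filterlim_inverse_at_top_right] .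
  moreover have "\<forall>\<^sub>F x::real in at_right 0. inverse x ^ k / exp (inverse x) = flat k x"
    using eventually_at_right_less
    by (rule eventually_mono) (simp add: flat_def exp_minus divide_inverse)
  ultimately show ?thesis by (rule Lim_transform_eventually)
qed

lemma flat_has_derivative:
  "(flat k has_real_derivative (flat (k + 2) x - real k * flat (k + 1) x)) (at x)"
proof -
  consider "x > 0" | "x = 0" | "x < 0" by linarith
  then show ?thesis
  proof cases
    case 1
    have inv: "(inverse has_real_derivative - (inverse x * inverse x)) (at x)"
      using DERIV_inverse[of x] 1 by (simp add: power2_eq_square)
    have pow: "((\<lambda>y. inverse y ^ k) has_real_derivative - real k * inverse x ^ (k + 1)) (at x)"
      by (rule DERIV_cong[OF DERIV_power[OF inv]]) (cases k; simp add: algebra_simps)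
    have ex: "((\<lambda>y. exp (- inverse y)) has_real_derivative exp (- inverse x) * (inverse x * inverse x)) (at x)"
      by (rule DERIV_cong[OF DERIV_fun_exp[OF DERIV_minus[OF inv]]]) simp
    have "((\<lambda>x. inverse x ^ k * exp (- inverse x)) has_real_derivative
        (flat (k + 2) x - real k * flat (k + 1) x)) (at x)"
      by (rule DERIV_cong[OF DERIV_mult[OF pow ex]]) (use 1 in \<open>simp add: flat_def\<close>)
    moreover have "open {0::real<..}" "x \<in> {0<..}" using 1 by auto
    ultimately show ?thesis
      by (rule has_field_derivative_transform_within_open) (simp add: flat_def)
  next
    case 3
    have "((\<lambda>x. 0) has_real_derivative (flat (k + 2) x - real k * flat (k + 1) x)) (at x)"
      using 3 by (simp add: flat_def)
    moreover have "open {..<0::real}" "x \<in> {..<0}" using 3 by auto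
    ultimately show ?thesis
      by (rule has_field_derivative_transform_within_open) (simp add: flat_def)
  next
    case 2
    have "((\<lambda>h. flat k h / h) \<longlongrightarrow> 0) (at 0)"
    proof (rule filterlim_split_at)
      have "((\<lambda>h. 0) \<longlongrightarrow> (0::real)) (at_left 0)" by simp
      moreover have "\<forall>\<^sub>F h in at_left 0. 0 = flat k h / h"
        by (auto simp: eventually_at_left_field flat_def intro: exI[of _ "-1"])
      ultimately show "((\<lambda>h. flat k h / h) \<longlongrightarrow> 0) (at_left 0)" by (rule Lim_transform_eventually)
      have "\<forall>\<^sub>F h in at_right 0. flat (Suc k) h = flat k h / h"
        using eventually_at_right_less
        by (rule eventually_mono) (simp add: flat_def divide_inverse mult_ac)
      with flat_tendsto_0 show "((\<lambda>h. flat k h / h) \<longlongrightarrow> 0) (at_right 0)"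
        by (rule Lim_transform_eventually)
    qed
    then show ?thesis using 2 by (simp add: has_field_derivative_iff flat_def)
  qed
qed

lemma smooth_on_flat: "smooth_on UNIV (flat k)"
  unfolding smooth_on_def
proof
  fix n show "Ck_on n UNIV (flat k)"
  proof (induction n arbitrary: k)
    case 0
    show ?case using DERIV_isCont[OF flat_has_derivative]
      by (auto intro: continuous_at_imp_continuous_on)
  next
    case (Suc n)
    have der: "(flat k has_derivative (\<lambda>v. (flat (k + 2) x - real k * flat (k + 1) x) * v)) (at x)"
      for x using flat_has_derivative[of k x] by (simp add: has_field_derivative_def)
    have "Ck_on n UNIV (\<lambda>x. (flat (k + 2) x + (- real k) * flat (k + 1) x) * v)" for v
      by (intro Ck_on_bilinear[OF bounded_bilinear_mult] Ck_on_add Suc Ck_on_const) auto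
    then show ?case
      using der by (auto simp: frechet_derivative_at[OF der, symmetric] differentiable_def)
  qed
qed

text \<open>
  With \<open>a = r\<^sup>2 - |x - x\<^sub>0|\<^sup>2\<close> and \<open>b = |x - x\<^sub>0|\<^sup>2 - (r/2)\<^sup>2\<close>, never both nonpositive, the quotient
  \<open>flat 0 a / (flat 0 a + flat 0 b)\<close> is smooth.
\<close>

lemma ex_bump:
  fixes x0 :: "'e::model_space"
  assumes "0 < r"
  shows "\<exists>h::'e \<Rightarrow> real. smooth_on UNIV h \<and> (\<forall>x. norm (x - x0) \<le> r / 2 \<longrightarrow> h x = 1) \<and>
           (\<forall>x. r \<le> norm (x - x0) \<longrightarrow> h x = 0)"
proof -
  define a b where "a = (\<lambda>x. r\<^sup>2 - (x - x0) \<bullet> (x - x0))" and "b = (\<lambda>x. (x - x0) \<bullet> (x - x0) - (r/2)\<^sup>2)"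
  have sa: "smooth_on UNIV a" and sb: "smooth_on UNIV b" unfolding a_def b_def
    by (intro smooth_on_diff smooth_on_inner smooth_on_const smooth_on_ident open_UNIV)+
  have pos: "flat 0 (a x) + flat 0 (b x) \<noteq> 0" for x
  proof -
    have "0 < a x \<or> 0 < b x"
    proof (rule ccontr)
      assume "\<not> ?thesis"
      then have "r\<^sup>2 \<le> (r/2)\<^sup>2" by (simp add: a_def b_def)
      then show False using assms by (simp add: power2_eq_square)
    qed
    moreover have "0 \<le> flat 0 z" "0 < z \<Longrightarrow> 0 < flat 0 z" for z by (simp_all add: flat_def)
    ultimately have "0 < flat 0 (a x) + flat 0 (b x)"
      by (metis add_nonneg_pos add_pos_nonneg)
    then show ?thesis by simp
  qed
  define h where "h = (\<lambda>x. flat 0 (a x) / (flat 0 (a x) + flat 0 (b x)))"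
  have "smooth_on UNIV h" unfolding h_def
    by (intro smooth_on_divide smooth_on_add smooth_on_compose[OF sa smooth_on_flat]
          smooth_on_compose[OF sb smooth_on_flat] pos) auto
  moreover have "h x = 1" if "norm (x - x0) \<le> r / 2" for x
  proof -
    have "(norm (x - x0))\<^sup>2 \<le> (r/2)\<^sup>2" using that by (intro power_mono) auto
    then have "flat 0 (b x) = 0" by (simp add: flat_def b_def power2_norm_eq_inner)
    then show ?thesis using pos[of x] by (simp add: h_def)
  qed
  moreover have "h x = 0" if "r \<le> norm (x - x0)" for x
  proof -
    have "r\<^sup>2 \<le> (norm (x - x0))\<^sup>2" using that assms by (intro power_mono) auto
    then have "flat 0 (a x) = 0" by (simp add: flat_def a_def power2_norm_eq_inner)
    then show ?thesis by (simp add: h_def)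
  qed
  ultimately show ?thesis by blast
qed

section \<open>Smooth frames\<close>

definition smooth_comb ::
    "'e::real_normed_vector set \<Rightarrow> 'i set \<Rightarrow> ('i \<Rightarrow> 'e \<Rightarrow> 'f::real_normed_vector) \<Rightarrow> ('e \<Rightarrow> 'f) \<Rightarrow> bool"
  where "smooth_comb V I u f \<longleftrightarrow>
    (\<exists>k. (\<forall>i\<in>I. smooth_on V (k i)) \<and> (\<forall>x\<in>V. f x = (\<Sum>i\<in>I. k i x *\<^sub>R u i x)))"

lemma smooth_comb_subset: "smooth_comb V I u f \<Longrightarrow> W \<subseteq> V \<Longrightarrow> smooth_comb W I u f"
  unfolding smooth_comb_def by (meson smooth_on_subset subsetD)

lemma smooth_comb_generator:
  assumes "finite I" "i \<in> I"
  shows "smooth_comb V I u (u i)"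
  unfolding smooth_comb_def
proof (intro exI conjI ballI)
  show "smooth_on V ((\<lambda>j x. if j = i then 1 else 0) j)" for j by (cases "j = i") (simp_all add: smooth_on_const)
  show "u i x = (\<Sum>j\<in>I. (\<lambda>j x. if j = i then 1 else 0) j x *\<^sub>R u j x)" for x
  proof -
    have "(\<Sum>j\<in>I. (\<lambda>j x. if j = i then 1 else 0) j x *\<^sub>R u j x) = (\<Sum>j\<in>I. if j = i then u j x else 0)"
      by (intro sum.cong) auto
    then show ?thesis using assms by (simp add: sum.delta)
  qed
qed

lemma smooth_comb_add:
  assumes "smooth_comb V I u f" "smooth_comb V I u g" "open V"
  shows "smooth_comb V I u (\<lambda>x. f x + g x)"
proof -
  obtain k l where "\<forall>i\<in>I. smooth_on V (k i)" "\<forall>x\<in>V. f x = (\<Sum>i\<in>I. k i x *\<^sub>R u i x)"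
    "\<forall>i\<in>I. smooth_on V (l i)" "\<forall>x\<in>V. g x = (\<Sum>i\<in>I. l i x *\<^sub>R u i x)"
    using assms unfolding smooth_comb_def by blast
  then show ?thesis unfolding smooth_comb_def using assms(3)
    by (intro exI[of _ "\<lambda>i x. k i x + l i x"])
       (auto simp: scaleR_add_left sum.distrib intro: smooth_on_add)
qed

lemma smooth_comb_scale:
  assumes "smooth_comb V I u f" "smooth_on V c" "open V"
  shows "smooth_comb V I u (\<lambda>x. c x *\<^sub>R f x)"
proof -
  obtain k where "\<forall>i\<in>I. smooth_on V (k i)" "\<forall>x\<in>V. f x = (\<Sum>i\<in>I. k i x *\<^sub>R u i x)"
    using assms unfolding smooth_comb_def by blast
  then show ?thesis unfolding smooth_comb_def using assms(2,3)
    by (intro exI[of _ "\<lambda>i x. c x * k i x"])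
       (auto simp: scaleR_sum_right intro: smooth_on_mult)
qed

lemma smooth_comb_sum:
  assumes "finite C" "\<And>c. c \<in> C \<Longrightarrow> smooth_comb V I u (f c)" "open V"
  shows "smooth_comb V I u (\<lambda>x. \<Sum>c\<in>C. f c x)"
  using assms(1,2)
proof induction
  case empty
  show ?case unfolding smooth_comb_def
    by (intro exI[of _ "\<lambda>i x. 0"]) (simp add: smooth_on_const)
next
  case (insert c C)
  then have "smooth_comb V I u (\<lambda>x. f c x + (\<Sum>c\<in>C. f c x))"
    by (intro smooth_comb_add[OF _ _ assms(3)]) auto
  with insert.hyps show ?case by simp
qed

text \<open>Gram-Schmidt with parameters: the denominators stay invertible near \<open>x0\<close>.\<close>

lemma smooth_gram_schmidt:
  fixes u :: "'f::model_space \<Rightarrow> 'e::real_normed_vector \<Rightarrow> 'f"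
  assumes "open S" "x0 \<in> S" "finite I" "I \<subseteq> obasis"
    and u: "\<And>b. b \<in> obasis \<Longrightarrow> smooth_on S (u b)" "\<And>b. b \<in> obasis \<Longrightarrow> u b x0 = b"
  shows "\<exists>V q. open V \<and> x0 \<in> V \<and> V \<subseteq> S \<and>
     (\<forall>b\<in>I. smooth_on V (q b) \<and> smooth_comb V obasis u (q b) \<and> q b x0 = b \<and>
        (\<forall>x\<in>V. q b x \<noteq> 0 \<and> (\<forall>c\<in>I. c \<noteq> b \<longrightarrow> q b x \<bullet> q c x = 0)))"
  using assms(3,4)
proof induction
  case empty
  then show ?case using assms by auto
next
  case (insert c I)
  then have "I \<subseteq> obasis" by simp
  from insert.IH[OF this] obtain V q where V: "open V" "x0 \<in> V" "V \<subseteq> S"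
    and Q: "\<forall>b\<in>I. smooth_on V (q b) \<and> smooth_comb V obasis u (q b) \<and> q b x0 = b \<and>
        (\<forall>x\<in>V. q b x \<noteq> 0 \<and> (\<forall>c\<in>I. c \<noteq> b \<longrightarrow> q b x \<bullet> q c x = 0))"
    by (elim exE conjE)
  then have q: "\<And>b. b \<in> I \<Longrightarrow> smooth_on V (q b)" "\<And>b. b \<in> I \<Longrightarrow> smooth_comb V obasis u (q b)"
      "\<And>b. b \<in> I \<Longrightarrow> q b x0 = b" "\<And>b x. b \<in> I \<Longrightarrow> x \<in> V \<Longrightarrow> q b x \<noteq> 0"
      "\<And>b c x. b \<in> I \<Longrightarrow> c \<in> I \<Longrightarrow> x \<in> V \<Longrightarrow> b \<noteq> c \<Longrightarrow> q b x \<bullet> q c x = 0"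
    by (simp_all add: Ball_def)
  \<comment> \<open>the next vector of the frame: \<open>u c\<close> minus its projections to the vectors found so far\<close>
  define p where "p = (\<lambda>b x. (u c x \<bullet> q b x) / (q b x \<bullet> q b x))"
  define w where "w = (\<lambda>x. u c x + (\<Sum>b\<in>I. (- p b x) *\<^sub>R q b x))"
  have c: "c \<in> obasis" using insert.prems by auto
  have uV: "smooth_on V (u c)" using u(1)[OF c] V smooth_on_subset by blast
  have sp: "smooth_on V (\<lambda>x. - p b x)" if "b \<in> I" for b
    unfolding p_def
    by (intro smooth_on_minus smooth_on_divide smooth_on_inner uV q(1) that V) (use q(4) that in auto)
  have sw: "smooth_on V w" unfolding w_def
    by (intro smooth_on_add uV smooth_on_sum smooth_on_scaleR sp q(1) V)
  have cw: "smooth_comb V obasis u w" unfolding w_def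
    by (intro smooth_comb_add smooth_comb_sum smooth_comb_scale sp q(2) V insert.hyps
          smooth_comb_generator finite_obasis c)
  have w0: "w x0 = c"
  proof -
    have "p b x0 = 0" if "b \<in> I" for b
    proof -
      have "b \<in> obasis" "b \<noteq> c" using that insert by auto
      then have "u c x0 \<bullet> q b x0 = 0" using u(2)[OF c] q(3)[OF that] c by (simp add: inner_obasis)
      then show ?thesis by (simp add: p_def)
    qed
    then show ?thesis by (simp add: w_def u(2)[OF c])
  qed
  have worth: "w x \<bullet> q b x = 0" if "b \<in> I" "x \<in> V" for b x
  proof -
    have "w x \<bullet> q b x = u c x \<bullet> q b x + (\<Sum>d\<in>I. - p d x * (q d x \<bullet> q b x))"
      by (simp add: w_def inner_add_left inner_sum_left)
    also have "(\<Sum>d\<in>I. - p d x * (q d x \<bullet> q b x)) = (\<Sum>d\<in>I. if d = b then - p b x * (q b x \<bullet> q b x) else 0)"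
      using q(5) that by (intro sum.cong) auto
    also have "\<dots> = - p b x * (q b x \<bullet> q b x)" using insert.hyps that by (simp add: sum.delta)
    also have "\<dots> = - (u c x \<bullet> q b x)" using q(4)[OF that] by (simp add: p_def)
    finally show ?thesis by simp
  qed
  define V' where "V' = V \<inter> w -` (- {0})"
  have "open V'" unfolding V'_def
    using continuous_on_open_vimage[OF V(1)] smooth_on_imp_continuous_on[OF sw]
    by (metis Int_commute open_Compl closed_singleton)
  moreover have "c \<noteq> 0" using inner_obasis[OF c c] by auto
  then have "x0 \<in> V'" using V w0 by (simp add: V'_def)
  moreover have V'V: "V' \<subseteq> V" by (simp add: V'_def)
  moreover have "V' \<subseteq> S" using V'V V by blast
  moreover have "\<forall>b\<in>insert c I. smooth_on V' ((q(c := w)) b) \<and> smooth_comb V' obasis u ((q(c := w)) b) \<and>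
      (q(c := w)) b x0 = b \<and>
        (\<forall>x\<in>V'. (q(c := w)) b x \<noteq> 0 \<and> (\<forall>d\<in>insert c I. d \<noteq> b \<longrightarrow> (q(c := w)) b x \<bullet> (q(c := w)) d x = 0))"
  proof
    fix b assume b: "b \<in> insert c I"
    show "smooth_on V' ((q(c := w)) b) \<and> smooth_comb V' obasis u ((q(c := w)) b) \<and>
      (q(c := w)) b x0 = b \<and>
        (\<forall>x\<in>V'. (q(c := w)) b x \<noteq> 0 \<and> (\<forall>d\<in>insert c I. d \<noteq> b \<longrightarrow> (q(c := w)) b x \<bullet> (q(c := w)) d x = 0))"
    proof (cases "b = c")
      case True
      have "w x \<noteq> 0" if "x \<in> V'" for x using that by (simp add: V'_def)
      with True smooth_on_subset[OF sw V'V] smooth_comb_subset[OF cw V'V] w0 worth V'V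
      show ?thesis by auto
    next
      case False
      then have bI: "b \<in> I" using b by simp
      have "q b x \<bullet> w x = 0" if "x \<in> V'" for x
        using worth[OF bI, of x] that V'V by (auto simp: inner_commute)
      with False bI q(3)[OF bI] q(4)[OF bI] q(5)[OF bI] V'V
        smooth_on_subset[OF q(1)[OF bI] V'V] smooth_comb_subset[OF q(2)[OF bI] V'V]
      show ?thesis by auto
    qed
  qed
  ultimately show ?case by blast
qed

text \<open>
  Such a family is linearly independent and has as many members as an orthonormal basis, so it spans.
\<close>

lemma orthogonal_family_expansion:
  fixes q :: "'f::model_space \<Rightarrow> 'f"
  assumes nz: "\<And>b. b \<in> obasis \<Longrightarrow> q b \<noteq> 0"
    and orth: "\<And>b c. b \<in> obasis \<Longrightarrow> c \<in> obasis \<Longrightarrow> b \<noteq> c \<Longrightarrow> q b \<bullet> q c = 0"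
  shows "y = (\<Sum>b\<in>obasis. ((y \<bullet> q b) / (q b \<bullet> q b)) *\<^sub>R q b)"
proof -
  have inj: "inj_on q obasis"
    using nz orth by (metis inj_onI inner_eq_zero_iff)
  have ind: "independent (q ` obasis)"
  proof (rule pairwise_orthogonal_independent)
    show "pairwise orthogonal (q ` obasis)" using orth by (auto simp: pairwise_def orthogonal_def)
  qed (use nz in auto)
  have spo: "z \<in> span obasis" for z :: 'f
  proof -
    have "(\<Sum>b\<in>obasis. (z \<bullet> b) *\<^sub>R b) \<in> span obasis" by (intro span_sum span_scale span_base)
    then show ?thesis using obasis_expansion[of z] by argo
  qed
  have "y \<in> span (q ` obasis)"
  proof (rule ccontr)
    assume y: "y \<notin> span (q ` obasis)"
    then have "independent (insert y (q ` obasis))" using ind by (simp add: independent_insert)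
    then have "card (insert y (q ` obasis)) \<le> card (obasis :: 'f set)"
      using independent_span_bound[OF finite_obasis] spo by blast
    moreover have "y \<notin> q ` obasis" using y span_base[of y "q ` obasis"] by argo
    ultimately show False by (simp add: card_image[OF inj] card_insert_disjoint)
  qed
  then obtain s where "y = (\<Sum>z\<in>q ` obasis. s z *\<^sub>R z)"
    unfolding span_finite[OF finite_imageI[OF finite_obasis]] by (elim rangeE)
  also have "\<dots> = (\<Sum>b\<in>obasis. s (q b) *\<^sub>R q b)"
    by (simp only: sum.reindex[OF inj] o_def)
  finally have y: "y = (\<Sum>b\<in>obasis. s (q b) *\<^sub>R q b)" .
  have coef: "(y \<bullet> q b) / (q b \<bullet> q b) = s (q b)" if b: "b \<in> obasis" for b
  proof -
    have "y \<bullet> q b = (\<Sum>d\<in>obasis. s (q d) * (q d \<bullet> q b))"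
      by (subst y) (simp add: inner_sum_left)
    also have "\<dots> = s (q b) * (q b \<bullet> q b) + (\<Sum>d\<in>obasis - {b}. s (q d) * (q d \<bullet> q b))"
      by (rule sum.remove[OF finite_obasis b])
    also have "(\<Sum>d\<in>obasis - {b}. s (q d) * (q d \<bullet> q b)) = 0"
    proof (rule sum.neutral, rule ballI)
      fix d assume "d \<in> obasis - {b}"
      then have "q d \<bullet> q b = 0" by (intro orth b) auto
      then show "s (q d) * (q d \<bullet> q b) = 0" by simp
    qed
    finally show ?thesis using nz[OF b] by simp
  qed
  have "(\<Sum>b\<in>obasis. ((y \<bullet> q b) / (q b \<bullet> q b)) *\<^sub>R q b) = (\<Sum>b\<in>obasis. s (q b) *\<^sub>R q b)"
    by (rule sum.cong[OF refl]) (simp only: coef)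
  with y show ?thesis by (rule trans[OF _ sym])
qed

text \<open>
  For an orthogonal frame the coefficients of \<open>Y\<close> are quotients of inner products, hence smooth;
  Gram-Schmidt reduces the general case to this one.
\<close>

lemma smooth_frame_coordinates:
  fixes u :: "'f::model_space \<Rightarrow> 'e::real_normed_vector \<Rightarrow> 'f"
  assumes "open S" "x0 \<in> S" "smooth_on S Y"
    and u: "\<And>b. b \<in> obasis \<Longrightarrow> smooth_on S (u b)" "\<And>b. b \<in> obasis \<Longrightarrow> u b x0 = b"
  shows "\<exists>V. open V \<and> x0 \<in> V \<and> V \<subseteq> S \<and> smooth_comb V obasis u Y"
proof -
  have "\<exists>V q. open V \<and> x0 \<in> V \<and> V \<subseteq> S \<and>
     (\<forall>b\<in>obasis. smooth_on V (q b) \<and> smooth_comb V obasis u (q b) \<and> q b x0 = b \<and>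
        (\<forall>x\<in>V. q b x \<noteq> 0 \<and> (\<forall>c\<in>obasis. c \<noteq> b \<longrightarrow> q b x \<bullet> q c x = 0)))"
    by (rule smooth_gram_schmidt[OF assms(1,2) finite_obasis subset_refl u])
  then obtain V q where V: "open V" "x0 \<in> V" "V \<subseteq> S"
    and Q: "\<forall>b\<in>obasis. smooth_on V (q b) \<and> smooth_comb V obasis u (q b) \<and> q b x0 = b \<and>
        (\<forall>x\<in>V. q b x \<noteq> 0 \<and> (\<forall>c\<in>obasis. c \<noteq> b \<longrightarrow> q b x \<bullet> q c x = 0))"
    by (elim exE conjE)
  then have q: "\<And>b. b \<in> obasis \<Longrightarrow> smooth_on V (q b)"
      "\<And>b. b \<in> obasis \<Longrightarrow> smooth_comb V obasis u (q b)"
      "\<And>b x. b \<in> obasis \<Longrightarrow> x \<in> V \<Longrightarrow> q b x \<noteq> 0"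
      "\<And>b c x. b \<in> obasis \<Longrightarrow> c \<in> obasis \<Longrightarrow> x \<in> V \<Longrightarrow> b \<noteq> c \<Longrightarrow> q b x \<bullet> q c x = 0"
    by (simp_all add: Ball_def)
  have YV: "smooth_on V Y" using assms V smooth_on_subset by blast
  have "smooth_comb V obasis u (\<lambda>x. \<Sum>b\<in>obasis. ((Y x \<bullet> q b x) / (q b x \<bullet> q b x)) *\<^sub>R q b x)"
    by (intro smooth_comb_sum smooth_comb_scale q(2) smooth_on_divide smooth_on_inner YV q(1) V)
       (use q(3) in auto)
  moreover have "Y x = (\<Sum>b\<in>obasis. ((Y x \<bullet> q b x) / (q b x \<bullet> q b x)) *\<^sub>R q b x)" if "x \<in> V" for x
    using q(3,4) that by (intro orthogonal_family_expansion) auto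
  ultimately have "smooth_comb V obasis u Y" unfolding smooth_comb_def by simp
  with V show ?thesis by blast
qed

section \<open>Smooth functions and smooth maps on manifolds\<close>

lemma manifold_chart: "manifold A \<Longrightarrow> c \<in> A \<Longrightarrow> is_chart c"
  by (simp add: manifold_def)

lemma
  assumes "is_chart c"
  shows open_cdom: "open (cdom c)"
    and open_cmap_image: "open (cmap c ` cdom c)"
    and continuous_cmap: "continuous_on (cdom c) (cmap c)"
    and continuous_cinv: "continuous_on (cmap c ` cdom c) (cinv c)"
    and cinv_cmap: "p \<in> cdom c \<Longrightarrow> cinv c (cmap c p) = p"
    and cmap_cinv: "x \<in> cmap c ` cdom c \<Longrightarrow> cmap c (cinv c x) = x"
    and cinv_in_cdom: "x \<in> cmap c ` cdom c \<Longrightarrow> cinv c x \<in> cdom c"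
  using assms by (auto simp: is_chart_def homeomorphism_def)

lemma open_chart_image:
  assumes "is_chart c" "open T"
  shows "open (cmap c ` (cdom c \<inter> T))"
proof -
  have "cmap c ` (cdom c \<inter> T) = cinv c -` (cdom c \<inter> T) \<inter> cmap c ` cdom c"
    using cinv_cmap[OF assms(1)] cmap_cinv[OF assms(1)] by (force intro: rev_image_eqI)
  moreover have "open (cinv c -` (cdom c \<inter> T) \<inter> cmap c ` cdom c)"
  proof -
    have "\<forall>B. open B \<longrightarrow> open (cinv c -` B \<inter> cmap c ` cdom c)"
      by (rule continuous_on_open_vimage[OF open_cmap_image[OF assms(1)], THEN iffD1])
         (rule continuous_cinv[OF assms(1)])
    moreover have "open (cdom c \<inter> T)" using open_cdom[OF assms(1)] assms(2) by (rule open_Int)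
    ultimately show ?thesis by blast
  qed
  ultimately show ?thesis by simp
qed

lemma open_carrier: "manifold A \<Longrightarrow> open (carrier A)"
  unfolding carrier_def using manifold_chart open_cdom by blast

lemma carrier_chart: "p \<in> carrier A \<Longrightarrow> \<exists>c\<in>A. p \<in> cdom c"
  by (simp add: carrier_def)

lemma cdom_subset_carrier: "c \<in> A \<Longrightarrow> cdom c \<subseteq> carrier A"
  by (auto simp: carrier_def)

text \<open>
  The common notion behind functions, maps and vector fields: smoothness, chart by chart, of a
  function with values in a normed space.
\<close>

definition smooth_fun ::
    "('a, 'e::model_space) atlas \<Rightarrow> 'a set \<Rightarrow> ('a \<Rightarrow> 'v::real_normed_vector) \<Rightarrow> bool" where
  "smooth_fun A S f \<longleftrightarrow> (\<forall>c\<in>A. smooth_on (cmap c ` (cdom c \<inter> S)) (\<lambda>x. f (cinv c x)))"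

lemma Cinf_iff: "f \<in> Cinf A S \<longleftrightarrow> smooth_fun A S f"
  by (simp add: Cinf_def smooth_fun_def o_def)

lemma smooth_map_on_iff:
  "smooth_map_on A B S \<phi> \<longleftrightarrow> \<phi> ` S \<subseteq> carrier B \<and> continuous_on S \<phi> \<and>
     (\<forall>d\<in>B. smooth_fun A (S \<inter> \<phi> -` cdom d) (\<lambda>p. cmap d (\<phi> p)))"
proof -
  have eq: "{p \<in> C \<inter> S. \<phi> p \<in> D} = C \<inter> (S \<inter> \<phi> -` D)" for C D by auto
  show ?thesis unfolding smooth_map_on_def smooth_fun_def o_def eq by blast
qed

lemma fields_along_iff:
  "Y \<in> fields_along A B \<phi> S \<longleftrightarrow> (\<forall>p\<in>S. Y p \<in> tangent B (\<phi> p)) \<and> (\<forall>p. p \<notin> S \<longrightarrow> Y p = 0) \<and>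
     (\<forall>d\<in>B. smooth_fun A (S \<inter> \<phi> -` cdom d) (\<lambda>p. Y p d))"
proof -
  have eq: "{p \<in> C \<inter> S. \<phi> p \<in> D} = C \<inter> (S \<inter> \<phi> -` D)" for C D by auto
  show ?thesis unfolding fields_along_def smooth_fun_def eq by blast
qed

lemma vector_fields_iff:
  "Y \<in> vector_fields A S \<longleftrightarrow> (\<forall>p\<in>S. Y p \<in> tangent A p) \<and> (\<forall>p. p \<notin> S \<longrightarrow> Y p = 0) \<and>
     (\<forall>d\<in>A. smooth_fun A (S \<inter> cdom d) (\<lambda>p. Y p d))"
  by (simp add: vector_fields_def fields_along_iff)

lemma smooth_fun_subset: "smooth_fun A S f \<Longrightarrow> T \<subseteq> S \<Longrightarrow> smooth_fun A T f"
  unfolding smooth_fun_def by (meson Int_mono image_mono smooth_on_subset subset_refl)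

lemma smooth_fun_cong:
  assumes "manifold A" "open S" "\<And>p. p \<in> S \<Longrightarrow> f p = g p"
  shows "smooth_fun A S f \<longleftrightarrow> smooth_fun A S g"
proof -
  have "smooth_on (cmap c ` (cdom c \<inter> S)) (\<lambda>x. f (cinv c x)) \<longleftrightarrow>
      smooth_on (cmap c ` (cdom c \<inter> S)) (\<lambda>x. g (cinv c x))" if "c \<in> A" for c
  proof (rule smooth_on_cong)
    have c: "is_chart c" using assms(1) that by (rule manifold_chart)
    then show "open (cmap c ` (cdom c \<inter> S))" using assms(2) by (rule open_chart_image)
    show "x \<in> cmap c ` (cdom c \<inter> S) \<Longrightarrow> f (cinv c x) = g (cinv c x)" for x
      using assms(3) cinv_cmap[OF c] by auto
  qed
  then show ?thesis by (simp add: smooth_fun_def)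
qed

text \<open>
  Coordinate changes are smooth, so it does not matter which chart around a point is used.
\<close>

lemma smooth_fun_chartI:
  fixes f :: "'a::{t2_space, second_countable_topology} \<Rightarrow> 'v::real_normed_vector"
  assumes A: "manifold A" and "open S"
    and loc: "\<And>p. p \<in> S \<Longrightarrow> p \<in> carrier A \<Longrightarrow> \<exists>c\<in>A. \<exists>T. open T \<and> p \<in> T \<and> p \<in> cdom c \<and>
      smooth_on (cmap c ` (cdom c \<inter> T)) (\<lambda>x. f (cinv c x))"
  shows "smooth_fun A S f"
  unfolding smooth_fun_def
proof
  fix d assume d: "d \<in> A"
  note cd = manifold_chart[OF A d]
  show "smooth_on (cmap d ` (cdom d \<inter> S)) (\<lambda>x. f (cinv d x))"
  proof (rule smooth_on_local)
    fix x assume "x \<in> cmap d ` (cdom d \<inter> S)"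
    then obtain p where p: "p \<in> cdom d" "p \<in> S" "x = cmap d p" by auto
    then have "p \<in> carrier A" using d by (auto simp: carrier_def)
    from loc[OF p(2) this] obtain c T where c: "c \<in> A" "open T" "p \<in> T" "p \<in> cdom c"
      and sm: "smooth_on (cmap c ` (cdom c \<inter> T)) (\<lambda>x. f (cinv c x))" by blast
    note cc = manifold_chart[OF A c(1)]
    define V where "V = cmap d ` (cdom d \<inter> (cdom c \<inter> T \<inter> S))"
    have "open V" unfolding V_def
      by (rule open_chart_image[OF cd]) (intro open_Int open_cdom[OF cc] c assms)
    have Vx: "x \<in> V" using p c by (auto simp: V_def)
    have VS: "V \<subseteq> cmap d ` (cdom d \<inter> S)" by (auto simp: V_def)
    have "smooth_on (cmap d ` (cdom d \<inter> cdom c)) (cmap c \<circ> cinv d)"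
      using A d c by (auto simp: manifold_def)
    then have "smooth_on V (cmap c \<circ> cinv d)"
      by (rule smooth_on_subset) (auto simp: V_def)
    moreover have "(cmap c \<circ> cinv d) ` V \<subseteq> cmap c ` (cdom c \<inter> T)"
      by (auto simp: V_def cinv_cmap[OF cd])
    ultimately have "smooth_on V (\<lambda>x. f (cinv c ((cmap c \<circ> cinv d) x)))"
      by (rule smooth_on_compose[OF _ sm _ \<open>open V\<close>])
    then have "smooth_on V (\<lambda>x. f (cinv d x))"
      by (rule smooth_on_cong[OF \<open>open V\<close>, THEN iffD1, rotated])
         (auto simp: V_def cinv_cmap[OF cd] cinv_cmap[OF cc])
    with \<open>open V\<close> Vx VS
    show "\<exists>T. open T \<and> x \<in> T \<and> T \<subseteq> cmap d ` (cdom d \<inter> S) \<and> smooth_on T (\<lambda>x. f (cinv d x))"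
      by blast
  qed
qed

lemma smooth_fun_local:
  fixes f :: "'a::{t2_space, second_countable_topology} \<Rightarrow> 'v::real_normed_vector"
  assumes A: "manifold A" and "open S"
    and loc: "\<And>p. p \<in> S \<Longrightarrow> p \<in> carrier A \<Longrightarrow> \<exists>T. open T \<and> p \<in> T \<and> smooth_fun A T f"
  shows "smooth_fun A S f"
proof (rule smooth_fun_chartI[OF A assms(2)])
  fix p assume p: "p \<in> S" "p \<in> carrier A"
  from loc[OF p] obtain T where T: "open T" "p \<in> T" "smooth_fun A T f" by blast
  from carrier_chart[OF p(2)] obtain c where "c \<in> A" "p \<in> cdom c" by blast
  with T show "\<exists>c\<in>A. \<exists>T. open T \<and> p \<in> T \<and> p \<in> cdom c \<and>
      smooth_on (cmap c ` (cdom c \<inter> T)) (\<lambda>x. f (cinv c x))"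
    unfolding smooth_fun_def by blast
qed

lemma smooth_fun_const: "smooth_fun A S (\<lambda>p. v)"
  by (simp add: smooth_fun_def smooth_on_const)

context
  fixes A :: "('a::{t2_space, second_countable_topology}, 'e::model_space) atlas" and S :: "'a set"
  assumes A: "manifold A" and S: "open S"
begin

lemma smooth_fun_add:
  "smooth_fun A S f \<Longrightarrow> smooth_fun A S g \<Longrightarrow> smooth_fun A S (\<lambda>p. f p + g p)"
  unfolding smooth_fun_def
  by (intro ballI, rule smooth_on_add) (simp_all add: open_chart_image[OF manifold_chart[OF A] S])

lemma smooth_fun_minus:
  "smooth_fun A S f \<Longrightarrow> smooth_fun A S (\<lambda>p. - f p)"
  unfolding smooth_fun_def
  by (intro ballI, rule smooth_on_minus) (simp_all add: open_chart_image[OF manifold_chart[OF A] S])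

lemma smooth_fun_scaleR:
  "smooth_fun A S f \<Longrightarrow> smooth_fun A S g \<Longrightarrow> smooth_fun A S (\<lambda>p. f p *\<^sub>R g p)"
  unfolding smooth_fun_def
  by (intro ballI, rule smooth_on_scaleR) (simp_all add: open_chart_image[OF manifold_chart[OF A] S])

lemma smooth_fun_Pair:
  "smooth_fun A S f \<Longrightarrow> smooth_fun A S g \<Longrightarrow> smooth_fun A S (\<lambda>p. (f p, g p))"
  unfolding smooth_fun_def
  by (intro ballI, rule smooth_on_Pair) (simp_all add: open_chart_image[OF manifold_chart[OF A] S])

lemma smooth_fun_mult:
  fixes f g :: "'a \<Rightarrow> real"
  shows "smooth_fun A S f \<Longrightarrow> smooth_fun A S g \<Longrightarrow> smooth_fun A S (\<lambda>p. f p * g p)"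
  using smooth_fun_scaleR[of f g] by simp

lemma smooth_fun_sum:
  "(\<And>i. i \<in> I \<Longrightarrow> smooth_fun A S (f i)) \<Longrightarrow> smooth_fun A S (\<lambda>p. \<Sum>i\<in>I. f i p)"
  by (induction I rule: infinite_finite_induct) (simp_all add: smooth_fun_const smooth_fun_add)

lemma smooth_fun_prod:
  fixes f :: "'i \<Rightarrow> 'a \<Rightarrow> real"
  shows "(\<And>i. i \<in> I \<Longrightarrow> smooth_fun A S (f i)) \<Longrightarrow> smooth_fun A S (\<lambda>p. \<Prod>i\<in>I. f i p)"
  by (induction I rule: infinite_finite_induct) (simp_all add: smooth_fun_const smooth_fun_mult)

lemma smooth_fun_compose:
  fixes f :: "'a \<Rightarrow> 'f::model_space"
  assumes "smooth_fun A S f" "smooth_on T g" "f ` S \<subseteq> T"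
  shows "smooth_fun A S (\<lambda>p. g (f p))"
  unfolding smooth_fun_def
proof
  fix c assume c: "c \<in> A"
  note cc = manifold_chart[OF A c]
  have "smooth_on (cmap c ` (cdom c \<inter> S)) (\<lambda>x. f (cinv c x))"
    using assms(1) c by (simp add: smooth_fun_def)
  moreover have "(\<lambda>x. f (cinv c x)) ` cmap c ` (cdom c \<inter> S) \<subseteq> T"
    using assms(3) by (auto simp: cinv_cmap[OF cc])
  ultimately show "smooth_on (cmap c ` (cdom c \<inter> S)) (\<lambda>x. g (f (cinv c x)))"
    by (rule smooth_on_compose[OF _ assms(2) _ open_chart_image[OF cc S]])
qed

end

lemma smooth_fun_cmap: "manifold A \<Longrightarrow> c \<in> A \<Longrightarrow> smooth_fun A (cdom c) (cmap c)"
  by (auto simp: smooth_fun_def manifold_def o_def Int_commute)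

lemma smooth_fun_chart_rep:
  "smooth_fun A S f \<Longrightarrow> c \<in> A \<Longrightarrow> smooth_on (cmap c ` (cdom c \<inter> S)) (\<lambda>x. f (cinv c x))"
  by (simp add: smooth_fun_def)

lemma smooth_fun_of_chart_rep:
  fixes g :: "'e::model_space \<Rightarrow> 'v::real_normed_vector"
  assumes "manifold A" "open S" "c \<in> A" "S \<subseteq> cdom c" "smooth_on (cmap c ` S) g"
  shows "smooth_fun A S (\<lambda>p. g (cmap c p))"
  by (rule smooth_fun_compose[OF assms(1,2) smooth_fun_subset[OF smooth_fun_cmap] assms(5)])
     (use assms in auto)

lemma smooth_map_on_carrier: "smooth_map_on A B S \<phi> \<Longrightarrow> p \<in> S \<Longrightarrow> \<phi> p \<in> carrier B"
  by (auto simp: smooth_map_on_def)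

lemma smooth_map_on_open_vimage:
  assumes "smooth_map_on A B S \<phi>" "open S" "open T"
  shows "open (S \<inter> \<phi> -` T)"
proof -
  have "continuous_on S \<phi>" using assms(1) by (simp add: smooth_map_on_def)
  then have "\<forall>T. open T \<longrightarrow> open (\<phi> -` T \<inter> S)"
    by (rule continuous_on_open_vimage[OF assms(2), THEN iffD1])
  with assms(3) show ?thesis unfolding Int_commute[of S] by blast
qed

text \<open>
  Near each point the function factors through a chart of \<open>B\<close>.
\<close>

lemma smooth_fun_pullback:
  fixes f :: "'b::{t2_space, second_countable_topology} \<Rightarrow> 'v::real_normed_vector"
  assumes A: "manifold A" and B: "manifold B"
    and "open S" and \<phi>: "smooth_map_on A B S \<phi>" and "open T" "smooth_fun B T f"
    and sub: "\<And>p. p \<in> S \<Longrightarrow> \<phi> p \<in> T"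
  shows "smooth_fun A S (\<lambda>p. f (\<phi> p))"
proof (rule smooth_fun_local[OF A \<open>open S\<close>])
  fix p assume "p \<in> S"
  from carrier_chart[OF smooth_map_on_carrier[OF \<phi> this]]
  obtain d where d: "d \<in> B" "\<phi> p \<in> cdom d" by blast
  note cd = manifold_chart[OF B d(1)]
  define W where "W = S \<inter> \<phi> -` cdom d"
  have "open W" unfolding W_def using \<phi> \<open>open S\<close> open_cdom[OF cd] by (rule smooth_map_on_open_vimage)
  have "smooth_fun A W (\<lambda>p. cmap d (\<phi> p))" using \<phi> d by (simp add: smooth_map_on_iff W_def)
  moreover have "smooth_on (cmap d ` (cdom d \<inter> T)) (\<lambda>x. f (cinv d x))"
    using assms(6) d by (simp add: smooth_fun_def)
  moreover have "(\<lambda>p. cmap d (\<phi> p)) ` W \<subseteq> cmap d ` (cdom d \<inter> T)" using sub by (auto simp: W_def)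
  ultimately have "smooth_fun A W (\<lambda>p. f (cinv d (cmap d (\<phi> p))))"
    by (rule smooth_fun_compose[OF A \<open>open W\<close>])
  then have "smooth_fun A W (\<lambda>p. f (\<phi> p))"
    by (rule smooth_fun_cong[OF A \<open>open W\<close>, THEN iffD1, rotated])
       (auto simp: W_def cinv_cmap[OF cd])
  with \<open>open W\<close> d \<open>p \<in> S\<close> show "\<exists>T. open T \<and> p \<in> T \<and> smooth_fun A T (\<lambda>p. f (\<phi> p))"
    by (intro exI[of _ W]) (simp add: W_def)
qed

lemma smooth_map_on_compose:
  fixes C :: "('c::{t2_space, second_countable_topology}, 'g::model_space) atlas"
  assumes A: "manifold A" and B: "manifold B" and C: "manifold C"
    and S: "open S" and T: "open T"
    and \<phi>: "smooth_map_on A B S \<phi>" and \<psi>: "smooth_map_on B C T \<psi>"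
    and sub: "\<And>p. p \<in> S \<Longrightarrow> \<phi> p \<in> T"
  shows "smooth_map_on A C S (\<lambda>p. \<psi> (\<phi> p))"
  unfolding smooth_map_on_iff
proof (intro conjI ballI)
  show "(\<lambda>p. \<psi> (\<phi> p)) ` S \<subseteq> carrier C" using \<psi> sub by (auto simp: smooth_map_on_def)
  show "continuous_on S (\<lambda>p. \<psi> (\<phi> p))"
    using \<phi> \<psi> sub by (auto simp: smooth_map_on_def intro: continuous_on_compose2)
  fix d assume d: "d \<in> C"
  let ?T = "T \<inter> \<psi> -` cdom d"
  have oT: "open ?T"
    by (rule smooth_map_on_open_vimage[OF \<psi> T open_cdom[OF manifold_chart[OF C d]]])
  have eq: "S \<inter> (\<lambda>p. \<psi> (\<phi> p)) -` cdom d = S \<inter> \<phi> -` ?T" using sub by auto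
  have oS: "open (S \<inter> \<phi> -` ?T)" by (rule smooth_map_on_open_vimage[OF \<phi> S oT])
  have \<phi>': "smooth_map_on A B (S \<inter> \<phi> -` ?T) \<phi>"
    using \<phi> unfolding smooth_map_on_iff
    by (auto intro: continuous_on_subset elim!: smooth_fun_subset)
  have "smooth_fun B ?T (\<lambda>q. cmap d (\<psi> q))" using \<psi> d by (simp add: smooth_map_on_iff)
  then show "smooth_fun A (S \<inter> (\<lambda>p. \<psi> (\<phi> p)) -` cdom d) (\<lambda>p. cmap d (\<psi> (\<phi> p)))"
    unfolding eq by (rule smooth_fun_pullback[OF A B oS \<phi>' oT]) auto
qed

section \<open>Tangent vectors\<close>

abbreviation tscale :: "real \<Rightarrow> ('c \<Rightarrow> 'f::real_vector) \<Rightarrow> 'c \<Rightarrow> 'f" where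
  "tscale r v \<equiv> (\<lambda>c. r *\<^sub>R v c)"

lemma fscale_apply: "(f \<cdot> X) p = tscale (f p) (X p)"
  by (simp add: fscale_def)

lemma chart_rep_smooth:
  assumes "manifold A" "smooth_map A B \<phi>" "c \<in> A" "d \<in> B"
  shows "smooth_on (cmap c ` (cdom c \<inter> \<phi> -` cdom d)) (cmap d \<circ> \<phi> \<circ> cinv c)"
proof -
  have eq: "{p \<in> cdom c \<inter> carrier A. \<phi> p \<in> cdom d} = cdom c \<inter> \<phi> -` cdom d"
    using cdom_subset_carrier[OF assms(3)] by auto
  have "smooth_on (cmap c ` {p \<in> cdom c \<inter> carrier A. \<phi> p \<in> cdom d}) (cmap d \<circ> \<phi> \<circ> cinv c)"
    using assms(2-4) unfolding smooth_map_on_def by blast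
  then show ?thesis unfolding eq .
qed

lemma chart_rep_has_derivative:
  assumes "manifold A" "smooth_map A B \<phi>" "c \<in> A" "d \<in> B" "p \<in> cdom c" "\<phi> p \<in> cdom d"
  shows "((cmap d \<circ> \<phi> \<circ> cinv c) has_derivative
      frechet_derivative (cmap d \<circ> \<phi> \<circ> cinv c) (at (cmap c p))) (at (cmap c p))"
  by (rule smooth_on_imp_has_derivative[OF chart_rep_smooth[OF assms(1-4)]]) (use assms in auto)

text \<open>
  The middle chart \<open>d\<close> is arbitrary. With \<open>\<phi>\<close> or \<open>\<psi>\<close> the identity the rule expresses independence of the
  chart, and with both the identity the cocycle condition for the Jacobians of coordinate changes.
\<close>

lemma chart_rep_chain:
  assumes A: "manifold A" and B: "manifold B"
    and \<phi>: "smooth_map A B \<phi>" and \<psi>: "smooth_map B C \<psi>"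
    and c: "c \<in> A" "p \<in> cdom c" and d: "d \<in> B" "\<phi> p \<in> cdom d" and e: "e \<in> C" "\<psi> (\<phi> p) \<in> cdom e"
  shows "frechet_derivative (cmap e \<circ> (\<lambda>q. \<psi> (\<phi> q)) \<circ> cinv c) (at (cmap c p)) v
    = frechet_derivative (cmap e \<circ> \<psi> \<circ> cinv d) (at (cmap d (\<phi> p)))
        (frechet_derivative (cmap d \<circ> \<phi> \<circ> cinv c) (at (cmap c p)) v)"
proof -
  note cc = manifold_chart[OF A c(1)] and cd = manifold_chart[OF B d(1)]
  let ?f = "cmap d \<circ> \<phi> \<circ> cinv c" and ?g = "cmap e \<circ> \<psi> \<circ> cinv d"
  have f: "(?f has_derivative frechet_derivative ?f (at (cmap c p))) (at (cmap c p))"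
    by (rule chart_rep_has_derivative[OF A \<phi> c(1) d(1) c(2) d(2)])
  have "(?g has_derivative frechet_derivative ?g (at (cmap d (\<phi> p)))) (at (cmap d (\<phi> p)))"
    by (rule chart_rep_has_derivative[OF B \<psi> d(1) e(1) d(2) e(2)])
  then have g: "(?g has_derivative frechet_derivative ?g (at (cmap d (\<phi> p)))) (at (?f (cmap c p)))"
    by (simp add: cinv_cmap[OF cc c(2)])
  have fg: "((\<lambda>x. ?g (?f x)) has_derivative
      (\<lambda>v. frechet_derivative ?g (at (cmap d (\<phi> p))) (frechet_derivative ?f (at (cmap c p)) v)))
      (at (cmap c p))"
    by (rule has_derivative_compose[OF f g])
  define V where "V = cmap c ` (cdom c \<inter> (carrier A \<inter> \<phi> -` cdom d))"
  have "open V" unfolding V_def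
    by (intro open_chart_image[OF cc] smooth_map_on_open_vimage[OF \<phi> open_carrier[OF A]]
          open_cdom[OF cd])
  have "cmap c p \<in> V" using c d cdom_subset_carrier[OF c(1)] by (auto simp: V_def)
  have "frechet_derivative (cmap e \<circ> (\<lambda>q. \<psi> (\<phi> q)) \<circ> cinv c) (at (cmap c p))
      = frechet_derivative (\<lambda>x. ?g (?f x)) (at (cmap c p))"
    by (rule differentiable_cong_open(2)[OF \<open>open V\<close> \<open>cmap c p \<in> V\<close>])
       (auto simp: V_def cinv_cmap[OF cd] cinv_cmap[OF cc])
  also have "\<dots> = (\<lambda>v. frechet_derivative ?g (at (cmap d (\<phi> p))) (frechet_derivative ?f (at (cmap c p)) v))"
    by (rule frechet_derivative_at[OF fg, symmetric])
  finally show ?thesis by simp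
qed

lemma smooth_map_ident: "manifold A \<Longrightarrow> smooth_map A A (\<lambda>p. p)"
  unfolding smooth_map_on_iff
  by (auto intro: smooth_fun_subset[OF smooth_fun_cmap])

text \<open>
  Coordinates in one chart determine those in all others through the Jacobians; the values at other
  charts have to be zero, as for every tangent vector.
\<close>

definition coord_vector ::
    "('a, 'e::model_space) atlas \<Rightarrow> ('a, 'e) chart \<Rightarrow> 'a \<Rightarrow> 'e \<Rightarrow> ('a, 'e) tvec" where
  "coord_vector A c p x = (\<lambda>d. if d \<in> A \<and> p \<in> cdom d
     then frechet_derivative (cmap d \<circ> cinv c) (at (cmap c p)) x else 0)"

lemma tangentD:
  "v \<in> tangent A p \<Longrightarrow> c \<in> A \<Longrightarrow> d \<in> A \<Longrightarrow> p \<in> cdom c \<Longrightarrow> p \<in> cdom d \<Longrightarrow>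
     v d = frechet_derivative (cmap d \<circ> cinv c) (at (cmap c p)) (v c)"
  "v \<in> tangent A p \<Longrightarrow> \<not> (c \<in> A \<and> p \<in> cdom c) \<Longrightarrow> v c = 0"
  unfolding tangent_def by blast+

lemma tangentI:
  "(\<And>c d. c \<in> A \<Longrightarrow> d \<in> A \<Longrightarrow> p \<in> cdom c \<Longrightarrow> p \<in> cdom d \<Longrightarrow>
     v d = frechet_derivative (cmap d \<circ> cinv c) (at (cmap c p)) (v c)) \<Longrightarrow>
   (\<And>c. \<not> (c \<in> A \<and> p \<in> cdom c) \<Longrightarrow> v c = 0) \<Longrightarrow> v \<in> tangent A p"
  unfolding tangent_def by blast

lemma tangent_eqI:
  assumes "v \<in> tangent A p" "w \<in> tangent A p" "c \<in> A" "p \<in> cdom c" "v c = w c"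
  shows "v = w"
proof
  fix d show "v d = w d"
  proof (cases "d \<in> A \<and> p \<in> cdom d")
    case True
    then show ?thesis
      using tangentD(1)[OF assms(1,3) _ assms(4), of d] tangentD(1)[OF assms(2,3) _ assms(4), of d]
      by (simp add: assms(5))
  next
    case False
    then show ?thesis using tangentD(2)[OF assms(1) False] tangentD(2)[OF assms(2) False] by simp
  qed
qed

lemma transition_derivative_ident:
  assumes "manifold A" "c \<in> A" "p \<in> cdom c"
  shows "frechet_derivative (cmap c \<circ> cinv c) (at (cmap c p)) v = v"
proof -
  note cc = manifold_chart[OF assms(1,2)]
  have "frechet_derivative (cmap c \<circ> cinv c) (at (cmap c p)) = frechet_derivative (\<lambda>x. x) (at (cmap c p))"
    by (rule differentiable_cong_open(2)[OF open_cmap_image[OF cc]])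
       (use assms in \<open>auto simp: cinv_cmap[OF cc]\<close>)
  then show ?thesis by simp
qed

lemma coord_vector_tangent:
  assumes A: "manifold A" and c: "c \<in> A" "p \<in> cdom c"
  shows "coord_vector A c p x \<in> tangent A p" and "coord_vector A c p x c = x"
proof -
  show "coord_vector A c p x c = x"
    using transition_derivative_ident[OF assms] c by (simp add: coord_vector_def)
  show "coord_vector A c p x \<in> tangent A p"
  proof (rule tangentI)
    fix d e assume de: "d \<in> A" "e \<in> A" "p \<in> cdom d" "p \<in> cdom e"
    have "frechet_derivative (cmap e \<circ> cinv c) (at (cmap c p)) x
      = frechet_derivative (cmap e \<circ> cinv d) (at (cmap d p))
          (frechet_derivative (cmap d \<circ> cinv c) (at (cmap c p)) x)"
      using chart_rep_chain[OF A A smooth_map_ident[OF A] smooth_map_ident[OF A] c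
          de(1,3) de(2,4), unfolded o_def]
      unfolding o_def .
    with de show "coord_vector A c p x e
      = frechet_derivative (cmap e \<circ> cinv d) (at (cmap d p)) (coord_vector A c p x d)"
      unfolding coord_vector_def by (simp only: simp_thms if_True)
  next
    fix d assume "\<not> (d \<in> A \<and> p \<in> cdom d)"
    then show "coord_vector A c p x d = 0" by (simp only: coord_vector_def if_False)
  qed
qed

lemma transition_linear:
  assumes "manifold A" "c \<in> A" "d \<in> A" "p \<in> cdom c" "p \<in> cdom d"
  shows "linear (frechet_derivative (cmap d \<circ> cinv c) (at (cmap c p)))"
  using has_derivative_linear[OF chart_rep_has_derivative[OF assms(1) smooth_map_ident[OF assms(1)] assms(2-)]]
  by (simp add: o_def)

lemma tangent_zero:
  assumes "manifold A"
  shows "0 \<in> tangent A p"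
proof (rule tangentI)
  fix c d assume cd: "c \<in> A" "d \<in> A" "p \<in> cdom c" "p \<in> cdom d"
  show "0 d = frechet_derivative (cmap d \<circ> cinv c) (at (cmap c p)) (0 c)"
    by (simp only: zero_fun_apply linear_0[OF transition_linear[OF assms cd]])
qed (simp only: zero_fun_apply)

lemma tangent_add:
  assumes "manifold A" "v \<in> tangent A p" "w \<in> tangent A p"
  shows "v + w \<in> tangent A p"
proof (rule tangentI)
  fix c d assume cd: "c \<in> A" "d \<in> A" "p \<in> cdom c" "p \<in> cdom d"
  show "(v + w) d = frechet_derivative (cmap d \<circ> cinv c) (at (cmap c p)) ((v + w) c)"
    using tangentD(1)[OF assms(2) cd] tangentD(1)[OF assms(3) cd]
    by (simp only: plus_fun_def linear_add[OF transition_linear[OF assms(1) cd]])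
qed (simp add: tangentD(2)[OF assms(2)] tangentD(2)[OF assms(3)])

lemma tangent_scale:
  assumes "manifold A" "v \<in> tangent A p"
  shows "tscale r v \<in> tangent A p"
proof (rule tangentI)
  fix c d assume cd: "c \<in> A" "d \<in> A" "p \<in> cdom c" "p \<in> cdom d"
  show "tscale r v d = frechet_derivative (cmap d \<circ> cinv c) (at (cmap c p)) (tscale r v c)"
    using tangentD(1)[OF assms(2) cd]
    by (simp only: linear_scale[OF transition_linear[OF assms(1) cd]])
qed (simp add: tangentD(2)[OF assms(2)])

section \<open>Differentials\<close>

lemma differential_notin:
  "\<not> (d \<in> B \<and> \<phi> p \<in> cdom d) \<Longrightarrow> differential A B \<phi> p v d = 0"
  by (auto simp: differential_def)

lemma some_chart:
  assumes "p \<in> carrier A"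
  shows "some_chart A p \<in> A \<and> p \<in> cdom (some_chart A p)"
  unfolding some_chart_def
  by (rule someI_ex) (use carrier_chart[OF assms] in blast)

text \<open>
  The chain rule replaces the chart chosen in the definition by an arbitrary one.
\<close>

lemma differential_chart:
  assumes A: "manifold A" and \<phi>: "smooth_map A B \<phi>" and v: "v \<in> tangent A p"
    and c: "c \<in> A" "p \<in> cdom c" and d: "d \<in> B" "\<phi> p \<in> cdom d"
  shows "differential A B \<phi> p v d = frechet_derivative (cmap d \<circ> \<phi> \<circ> cinv c) (at (cmap c p)) (v c)"
proof -
  define e where "e = some_chart A p"
  have e: "e \<in> A" "p \<in> cdom e"
    using some_chart[of p A] cdom_subset_carrier[OF c(1)] c(2) by (auto simp: e_def)
  have "differential A B \<phi> p v d = frechet_derivative (cmap d \<circ> \<phi> \<circ> cinv e) (at (cmap e p)) (v e)"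
    using d by (simp add: differential_def e_def Let_def)
  also have "v e = frechet_derivative (cmap e \<circ> cinv c) (at (cmap c p)) (v c)"
    by (rule tangentD(1)[OF v c(1) e(1) c(2) e(2)])
  also have "frechet_derivative (cmap d \<circ> \<phi> \<circ> cinv e) (at (cmap e p)) \<dots>
      = frechet_derivative (cmap d \<circ> \<phi> \<circ> cinv c) (at (cmap c p)) (v c)"
    using chart_rep_chain[OF A A smooth_map_ident[OF A] \<phi> c e d, of "v c"] by (simp add: o_def)
  finally show ?thesis .
qed

lemma differential_tangent:
  assumes A: "manifold A" and B: "manifold B" and \<phi>: "smooth_map A B \<phi>"
    and p: "p \<in> carrier A" and v: "v \<in> tangent A p"
  shows "differential A B \<phi> p v \<in> tangent B (\<phi> p)"
proof -
  obtain c where c: "c \<in> A" "p \<in> cdom c" using carrier_chart[OF p] by blast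
  have "differential A B \<phi> p v e
      = frechet_derivative (cmap e \<circ> cinv d) (at (cmap d (\<phi> p))) (differential A B \<phi> p v d)"
    if "d \<in> B" "e \<in> B" "\<phi> p \<in> cdom d" "\<phi> p \<in> cdom e" for d e
    using chart_rep_chain[OF A B \<phi> smooth_map_ident[OF B] c that(1,3,2,4), of "v c"]
      differential_chart[OF A \<phi> v c that(1,3)] differential_chart[OF A \<phi> v c that(2,4)]
    unfolding o_def by metis
  then show ?thesis
  proof (rule tangentI)
    show "\<not> (c \<in> B \<and> \<phi> p \<in> cdom c) \<Longrightarrow> differential A B \<phi> p v c = 0" for c
      by (rule differential_notin)
  qed
qed

context
  fixes A :: "('a::{t2_space, second_countable_topology}, 'e::model_space) atlas"
    and B :: "('b::{t2_space, second_countable_topology}, 'f::model_space) atlas"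
    and \<phi> p
  assumes A: "manifold A" and \<phi>: "smooth_map A B \<phi>" and p: "p \<in> carrier A"
begin

lemma differential_some_chart_linear:
  "d \<in> B \<Longrightarrow> \<phi> p \<in> cdom d \<Longrightarrow>
     linear (frechet_derivative (cmap d \<circ> \<phi> \<circ> cinv (some_chart A p)) (at (cmap (some_chart A p) p)))"
  by (rule has_derivative_linear[OF chart_rep_has_derivative[OF A \<phi>]])
     (simp_all add: some_chart[OF p])

lemma differential_add:
  "differential A B \<phi> p (v + w) = differential A B \<phi> p v + differential A B \<phi> p w"
proof
  fix d show "differential A B \<phi> p (v + w) d = (differential A B \<phi> p v + differential A B \<phi> p w) d"
    using linear_add[OF differential_some_chart_linear[of d]] by (simp add: differential_def Let_def)
qed

lemma differential_scale:
  "differential A B \<phi> p (tscale r v) = tscale r (differential A B \<phi> p v)"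
proof
  fix d show "differential A B \<phi> p (tscale r v) d = tscale r (differential A B \<phi> p v) d"
    using linear_scale[OF differential_some_chart_linear[of d]] by (simp add: differential_def Let_def)
qed

lemma differential_zero: "differential A B \<phi> p 0 = 0"
proof -
  have "tscale 0 (0 :: ('a, 'e) tvec) = 0" "tscale 0 (differential A B \<phi> p 0) = 0"
    by (simp_all add: fun_eq_iff)
  with differential_scale[of 0 0] show ?thesis by metis
qed

lemma differential_minus: "differential A B \<phi> p (- v) = - differential A B \<phi> p v"
proof -
  have "tscale (-1) v = - v" "tscale (-1) (differential A B \<phi> p v) = - differential A B \<phi> p v"
    by (simp_all add: fun_eq_iff)
  with differential_scale[of "-1" v] show ?thesis by metis
qed

lemma differential_sum:
  "differential A B \<phi> p (\<Sum>i\<in>I. v i) = (\<Sum>i\<in>I. differential A B \<phi> p (v i))"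
proof (induction I rule: infinite_finite_induct)
  case (insert i I)
  show ?case by (simp only: sum.insert[OF insert.hyps] differential_add insert.IH)
next
  case (infinite I)
  show ?case by (simp only: sum.infinite[OF infinite] differential_zero)
qed (simp only: sum.empty differential_zero)

end

section \<open>Supports, bump functions and modules of fields\<close>

lemma sum_fun_apply: "(\<Sum>i\<in>I. f i) x = (\<Sum>i\<in>I. f i x)"
  by (induction I rule: infinite_finite_induct) simp_all

lemma not_in_supp: "p \<notin> supp X \<Longrightarrow> X p = 0"
  using closure_subset[of "{p. X p \<noteq> 0}"] by (auto simp: supp_def)

lemma supp_mono:
  "(\<And>p. Y p = 0 \<Longrightarrow> X p = 0) \<Longrightarrow> supp X \<subseteq> supp Y"
  unfolding supp_def by (rule closure_mono) blast

lemma supp_minimal: "closed K \<Longrightarrow> (\<And>p. p \<notin> K \<Longrightarrow> X p = 0) \<Longrightarrow> supp X \<subseteq> K"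
  unfolding supp_def by (rule closure_minimal) blast

lemma closed_supp: "closed (supp X)"
  by (simp add: supp_def)

lemma compact_supp_subset: "compact (supp Y) \<Longrightarrow> supp X \<subseteq> supp Y \<Longrightarrow> compact (supp X)"
  using compact_Int_closed[OF _ closed_supp, of "supp Y" X] by (simp add: Int_absorb1)

lemma supp_add: "supp (X + Y) \<subseteq> supp X \<union> supp (Y :: _ \<Rightarrow> _::monoid_add)"
  by (rule supp_minimal) (auto simp: closed_supp not_in_supp)

lemma supp_fscale: "supp (f \<cdot> X) \<subseteq> supp f" "supp (f \<cdot> X) \<subseteq> supp X"
  by (rule supp_mono; simp add: fscale_apply fun_eq_iff)+

lemma Cinf_cD:
  assumes "f \<in> Cinf_c A S"
  shows "smooth_fun A S f" "compact (supp f)" "supp f \<subseteq> S" "p \<notin> S \<Longrightarrow> f p = 0"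
  using assms not_in_supp[of p f] by (auto simp: Cinf_c_def Cinf_iff)

lemma Cinf_cI: "smooth_fun A S f \<Longrightarrow> compact (supp f) \<Longrightarrow> supp f \<subseteq> S \<Longrightarrow> f \<in> Cinf_c A S"
  by (simp add: Cinf_c_def Cinf_iff)

text \<open>Extension by zero: the product vanishes near every point outside the support of \<open>h\<close>.\<close>

lemma smooth_fun_extend:
  fixes A :: "('a::{t2_space, second_countable_topology}, 'e::model_space) atlas"
    and f :: "'a \<Rightarrow> 'v::real_normed_vector"
  assumes A: "manifold A" and "open S" "open W" and h: "h \<in> Cinf_c A W"
    and f: "smooth_fun A (S \<inter> W) f"
  shows "smooth_fun A S (\<lambda>p. h p *\<^sub>R f p)"
proof (rule smooth_fun_local[OF A \<open>open S\<close>])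
  fix p assume p: "p \<in> S"
  show "\<exists>T. open T \<and> p \<in> T \<and> smooth_fun A T (\<lambda>p. h p *\<^sub>R f p)"
  proof (cases "p \<in> W")
    case True
    have "smooth_fun A (S \<inter> W) h" using Cinf_cD(1)[OF h] by (rule smooth_fun_subset) simp
    then have "smooth_fun A (S \<inter> W) (\<lambda>p. h p *\<^sub>R f p)"
      using f by (rule smooth_fun_scaleR[OF A open_Int[OF assms(2,3)]])
    with True p assms show ?thesis by (intro exI[of _ "S \<inter> W"]) auto
  next
    case False
    have op: "open (- supp h)" using closed_supp by (rule open_Compl)
    have "smooth_fun A (- supp h) (\<lambda>p. h p *\<^sub>R f p) \<longleftrightarrow> smooth_fun A (- supp h) (\<lambda>p. 0 :: 'v)"
      by (rule smooth_fun_cong[OF A op]) (simp add: not_in_supp)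
    then have "smooth_fun A (- supp h) (\<lambda>p. h p *\<^sub>R f p)" by (simp add: smooth_fun_const)
    moreover have "p \<in> - supp h" using False Cinf_cD(3)[OF h] by auto
    ultimately show ?thesis using op by blast
  qed
qed

lemma Cinf_c_mono:
  fixes A :: "('a::{t2_space, second_countable_topology}, 'e::model_space) atlas"
  assumes A: "manifold A" and "open S" "open W" "W \<subseteq> S" and h: "h \<in> Cinf_c A W"
  shows "h \<in> Cinf_c A S"
proof (rule Cinf_cI)
  have "smooth_fun A S (\<lambda>p. h p *\<^sub>R (1::real))"
    by (rule smooth_fun_extend[OF A assms(2,3) h smooth_fun_const])
  then show "smooth_fun A S h" by simp
qed (use Cinf_cD[OF h] assms in auto)

lemma Cinf_c_mult:
  fixes A :: "('a::{t2_space, second_countable_topology}, 'e::model_space) atlas"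
  assumes A: "manifold A" and "open S" and h: "h \<in> Cinf_c A S" and f: "smooth_fun A S f"
  shows "(\<lambda>p. h p * f p) \<in> Cinf_c A S"
proof (rule Cinf_cI)
  show "smooth_fun A S (\<lambda>p. h p * f p)"
    by (rule smooth_fun_mult[OF A assms(2) Cinf_cD(1)[OF h] f])
  have sub: "supp (\<lambda>p. h p * f p) \<subseteq> supp h" by (rule supp_mono) simp
  show "compact (supp (\<lambda>p. h p * f p))" using Cinf_cD(2)[OF h] sub by (rule compact_supp_subset)
  show "supp (\<lambda>p. h p * f p) \<subseteq> S" using sub Cinf_cD(3)[OF h] by blast
qed

text \<open>
  A bump function in a chart extends by zero, because the image of the closed ball that contains its
  support is compact, hence closed in the Hausdorff space.
\<close>

lemma ex_bump_at_point:
  fixes A :: "('a::{t2_space, second_countable_topology}, 'e::model_space) atlas"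
  assumes A: "manifold A" and W: "open W" "p \<in> W" and p: "p \<in> carrier A"
  shows "\<exists>h V. h \<in> Cinf_c A W \<and> open V \<and> p \<in> V \<and> V \<subseteq> W \<and> (\<forall>q\<in>V. h q = 1)"
proof -
  obtain c where c: "c \<in> A" "p \<in> cdom c" using carrier_chart[OF p] by blast
  note cc = manifold_chart[OF A c(1)]
  let ?x = "cmap c p"
  define W' where "W' = cdom c \<inter> W"
  have oW': "open W'" unfolding W'_def using open_cdom[OF cc] W(1) by (rule open_Int)
  have "open (cmap c ` W')" unfolding W'_def by (rule open_chart_image[OF cc W(1)])
  moreover have "?x \<in> cmap c ` W'" using c W by (simp add: W'_def)
  ultimately obtain r where r: "0 < r" "cball ?x r \<subseteq> cmap c ` W'"
    using open_contains_cball by blast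
  obtain g :: "'e \<Rightarrow> real" where g: "smooth_on UNIV g" "\<And>y. norm (y - ?x) \<le> r / 2 \<Longrightarrow> g y = 1"
    "\<And>y. r \<le> norm (y - ?x) \<Longrightarrow> g y = 0"
    using ex_bump[OF r(1), of ?x] by blast
  define h where "h = (\<lambda>q. if q \<in> cdom c then g (cmap c q) else 0)"
  define K where "K = cinv c ` cball ?x r"
  have "compact K" unfolding K_def
  proof (rule compact_continuous_image[OF _ compact_cball_model])
    show "continuous_on (cball ?x r) (cinv c)"
      by (rule continuous_on_subset[OF continuous_cinv[OF cc]]) (use r in \<open>auto simp: W'_def\<close>)
  qed
  then have "closed K" by (rule compact_imp_closed)
  have KW: "K \<subseteq> W'" using r(2) by (auto simp: K_def W'_def cinv_cmap[OF cc])
  have h0: "h q = 0" if "q \<notin> K" for q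
  proof (cases "q \<in> cdom c")
    case True
    then have "cmap c q \<notin> cball ?x r" using that cinv_cmap[OF cc True] by (force simp: K_def)
    then show ?thesis using g(3)[of "cmap c q"] True
      by (simp add: h_def dist_norm norm_minus_commute)
  qed (simp add: h_def)
  have sK: "supp h \<subseteq> K" by (rule supp_minimal[OF \<open>closed K\<close> h0])
  have cs: "compact (supp h)"
    using compact_Int_closed[OF \<open>compact K\<close> closed_supp[of h]] sK by (simp add: Int_absorb1)
  have "smooth_fun A W' (\<lambda>q. g (cmap c q))"
    by (rule smooth_fun_of_chart_rep[OF A oW' c(1) _ smooth_on_subset[OF g(1)]])
       (auto simp: W'_def)
  then have "smooth_fun A W' h"
    by (rule smooth_fun_cong[OF A oW', THEN iffD1, rotated]) (auto simp: h_def W'_def)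
  then have "h \<in> Cinf_c A W'" using cs sK KW by (intro Cinf_cI) auto
  then have hW: "h \<in> Cinf_c A W"
    by (rule Cinf_c_mono[OF A W(1) oW', rotated]) (simp add: W'_def)
  define V where "V = cmap c -` ball ?x (r / 2) \<inter> W'"
  have "continuous_on W' (cmap c)"
    by (rule continuous_on_subset[OF continuous_cmap[OF cc]]) (simp add: W'_def)
  then have "\<forall>B. open B \<longrightarrow> open (cmap c -` B \<inter> W')"
    by (rule continuous_on_open_vimage[OF oW', THEN iffD1])
  then have "open V" unfolding V_def by simp
  moreover have "p \<in> V" using r c W by (simp add: V_def W'_def)
  moreover have "V \<subseteq> W" by (auto simp: V_def W'_def)
  moreover have "h q = 1" if "q \<in> V" for q
    using that g(2)[of "cmap c q"]
    by (auto simp: V_def W'_def h_def dist_norm norm_minus_commute)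
  ultimately show ?thesis using hW by blast
qed

text \<open>
  If \<open>h\<close> is 1 on one set and \<open>k\<close> on another, then \<open>h + k (1 - h)\<close> is 1 on both; compactness
  leaves finitely many such steps.
\<close>

lemma ex_plateau:
  fixes A :: "('a::{t2_space, second_countable_topology}, 'e::model_space) atlas"
  assumes A: "manifold A" and K: "compact K" "K \<subseteq> carrier A"
  shows "\<exists>h\<in>Cinf_c A (carrier A). \<forall>q\<in>K. h q = 1"
proof -
  note oc = open_carrier[OF A]
  define G where "G = {V. open V \<and> (\<exists>h\<in>Cinf_c A (carrier A). \<forall>q\<in>V. h q = 1)}"
  have "K \<subseteq> \<Union>G"
  proof
    fix p assume "p \<in> K"
    then have "p \<in> carrier A" using K by blast
    from ex_bump_at_point[OF A oc this this] show "p \<in> \<Union>G" unfolding G_def by blast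
  qed
  then obtain G' where G': "G' \<subseteq> G" "finite G'" "K \<subseteq> \<Union>G'"
    by (rule compactE[OF K(1)]) (simp_all add: G_def)
  have "\<exists>h\<in>Cinf_c A (carrier A). \<forall>q\<in>\<Union>G'. h q = 1" using G'(2,1)
  proof induction
    case empty
    have "supp (\<lambda>_::'a. 0::real) = {}" by (simp add: supp_def)
    then have "(\<lambda>_. 0) \<in> Cinf_c A (carrier A)"
      by (intro Cinf_cI) (simp_all add: smooth_fun_const)
    then show ?case by blast
  next
    case (insert V G')
    then obtain h where h: "h \<in> Cinf_c A (carrier A)" "\<forall>q\<in>\<Union>G'. h q = 1" by auto
    from insert.prems obtain k where k: "k \<in> Cinf_c A (carrier A)" "\<forall>q\<in>V. k q = 1"
      by (auto simp: G_def)
    let ?l = "\<lambda>q. h q + k q * (1 - h q)"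
    have sm: "smooth_fun A (carrier A) (\<lambda>q. 1 + - h q)"
      by (intro smooth_fun_add smooth_fun_minus smooth_fun_const A oc Cinf_cD(1)[OF h(1)])
    have "smooth_fun A (carrier A) (\<lambda>q. h q + k q * (1 + - h q))"
      by (intro smooth_fun_add smooth_fun_mult A oc Cinf_cD(1)[OF h(1)] Cinf_cD(1)[OF k(1)] sm)
    then have sml: "smooth_fun A (carrier A) ?l" by simp
    have sub: "supp ?l \<subseteq> supp h \<union> supp k"
      by (rule supp_minimal) (auto simp: closed_supp not_in_supp)
    have "compact (supp h \<union> supp k)" using Cinf_cD(2)[OF h(1)] Cinf_cD(2)[OF k(1)] by (rule compact_Un)
    from compact_Int_closed[OF this closed_supp[of ?l]] have "compact (supp ?l)"
      using sub by (simp only: Int_absorb1)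
    then have "?l \<in> Cinf_c A (carrier A)"
      using sml sub Cinf_cD(3)[OF h(1)] Cinf_cD(3)[OF k(1)] by (intro Cinf_cI) auto
    moreover have "\<forall>q\<in>\<Union>(insert V G'). ?l q = 1" using h(2) k(2) by auto
    ultimately show ?case by (intro bexI[of _ ?l])
  qed
  then show ?thesis using G'(3) by blast
qed

context
  fixes A :: "('a::{t2_space, second_countable_topology}, 'e::model_space) atlas"
    and B :: "('b::{t2_space, second_countable_topology}, 'f::model_space) atlas"
    and \<phi> S
  assumes A: "manifold A" and B: "manifold B" and S: "open S" and \<phi>: "smooth_map_on A B S \<phi>"
begin

lemma fields_along_open: "d \<in> B \<Longrightarrow> open (S \<inter> \<phi> -` cdom d)"
  by (rule smooth_map_on_open_vimage[OF \<phi> S open_cdom[OF manifold_chart[OF B]]])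

lemma fields_along_zero: "0 \<in> fields_along A B \<phi> S"
  by (simp add: fields_along_iff tangent_zero[OF B] smooth_fun_const)

lemma fields_along_add:
  assumes "X \<in> fields_along A B \<phi> S" "Y \<in> fields_along A B \<phi> S"
  shows "X + Y \<in> fields_along A B \<phi> S"
  unfolding fields_along_iff
proof (intro conjI ballI allI impI)
  show "p \<in> S \<Longrightarrow> (X + Y) p \<in> tangent B (\<phi> p)" for p
    using assms tangent_add[OF B] by (simp add: fields_along_iff)
  show "p \<notin> S \<Longrightarrow> (X + Y) p = 0" for p
    using assms by (simp add: fields_along_iff)
  show "smooth_fun A (S \<inter> \<phi> -` cdom d) (\<lambda>p. (X + Y) p d)" if "d \<in> B" for d
    unfolding plus_fun_apply
    by (rule smooth_fun_add[OF A fields_along_open[OF that]])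
       (use assms that in \<open>simp_all add: fields_along_iff\<close>)
qed

lemma fields_along_scale:
  assumes "smooth_fun A S f" "X \<in> fields_along A B \<phi> S"
  shows "f \<cdot> X \<in> fields_along A B \<phi> S"
  unfolding fields_along_iff fscale_apply
proof (intro conjI ballI allI impI)
  show "p \<in> S \<Longrightarrow> tscale (f p) (X p) \<in> tangent B (\<phi> p)" for p
    using assms tangent_scale[OF B] by (simp add: fields_along_iff)
  show "p \<notin> S \<Longrightarrow> tscale (f p) (X p) = 0" for p
    using assms by (simp add: fields_along_iff fun_eq_iff)
  show "smooth_fun A (S \<inter> \<phi> -` cdom d) (\<lambda>p. tscale (f p) (X p) d)" if "d \<in> B" for d
    by (rule smooth_fun_scaleR[OF A fields_along_open[OF that] smooth_fun_subset[OF assms(1)]])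
       (use assms that in \<open>simp_all add: fields_along_iff\<close>)
qed

end

context
  fixes A :: "('a::{t2_space, second_countable_topology}, 'e::model_space) atlas"
  assumes A: "manifold A"
begin

lemmas vector_fields_closed =
  fields_along_zero[OF A A open_carrier[OF A] smooth_map_ident[OF A], folded vector_fields_def]
  fields_along_add[OF A A open_carrier[OF A] smooth_map_ident[OF A], folded vector_fields_def]
  fields_along_scale[OF A A open_carrier[OF A] smooth_map_ident[OF A], folded vector_fields_def]

lemma compact_fields_zero: "0 \<in> compact_sections A (vector_fields A)"
proof -
  have "supp (0 :: 'a \<Rightarrow> ('a, 'e) tvec) = {}" by (simp add: supp_def)
  then show ?thesis by (simp add: compact_sections_def vector_fields_closed(1))
qed

lemma compact_fields_add:
  assumes "X \<in> compact_sections A (vector_fields A)" "Y \<in> compact_sections A (vector_fields A)"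
  shows "X + Y \<in> compact_sections A (vector_fields A)"
proof -
  have "compact (supp X \<union> supp Y)" using assms by (auto simp: compact_sections_def)
  from compact_Int_closed[OF this closed_supp[of "X + Y"]] have "compact (supp (X + Y))"
    using supp_add[of X Y] by (simp only: Int_absorb1)
  then show ?thesis using assms supp_add[of X Y] vector_fields_closed(2)
    by (auto simp: compact_sections_def)
qed

lemma compact_fields_scale:
  assumes "smooth_fun A (carrier A) f" "X \<in> compact_sections A (vector_fields A)"
  shows "f \<cdot> X \<in> compact_sections A (vector_fields A)"
  using assms vector_fields_closed(3) supp_fscale(2)[of f X] compact_supp_subset[of X "f \<cdot> X"]
  by (auto simp: compact_sections_def)

lemma compact_fields_scale_c:
  assumes "f \<in> Cinf_c A (carrier A)" "X \<in> vector_fields A (carrier A)"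
  shows "f \<cdot> X \<in> compact_sections A (vector_fields A)"
  using Cinf_cD(1-3)[OF assms(1)] assms(2) vector_fields_closed(3) supp_fscale(1)[of f X]
    compact_supp_subset[of f "f \<cdot> X"]
  by (auto simp: compact_sections_def)

end

lemma compact_fieldsD:
  assumes "X \<in> compact_sections A (vector_fields A)"
  shows "X \<in> vector_fields A (carrier A)" "p \<in> carrier A \<Longrightarrow> X p \<in> tangent A p"
    "p \<notin> carrier A \<Longrightarrow> X p = 0" "compact (supp X)" "supp X \<subseteq> carrier A"
  using assms by (auto simp: compact_sections_def vector_fields_iff)

section \<open>Lifting vector fields\<close>

lemma smooth_coord_vector:
  fixes A :: "('a::{t2_space, second_countable_topology}, 'e::model_space) atlas"
  assumes A: "manifold A" and c: "c \<in> A" and d: "d \<in> A"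
  shows "smooth_fun A (cdom c \<inter> cdom d) (\<lambda>p. coord_vector A c p x d)"
proof -
  have op: "open (cdom c \<inter> cdom d)"
    by (intro open_Int open_cdom manifold_chart[OF A] c d)
  have "smooth_on (cmap c ` (cdom c \<inter> cdom d))
      (\<lambda>y. frechet_derivative (cmap d \<circ> cinv c) (at y) x)"
    using A c d by (intro smooth_on_frechet_derivative) (simp add: manifold_def)
  then have "smooth_fun A (cdom c \<inter> cdom d)
      (\<lambda>p. frechet_derivative (cmap d \<circ> cinv c) (at (cmap c p)) x)"
    by (rule smooth_fun_of_chart_rep[OF A op c Int_lower1])
  then show ?thesis
    by (rule smooth_fun_cong[OF A op, THEN iffD1, rotated]) (simp add: coord_vector_def d)
qed

text \<open>
  A right inverse of the differential at one point, kept constant in coordinates, sends the basis to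
  fields whose images still form a frame nearby; the coordinates of \<open>X\<close> in that frame are the
  coefficients of the lift.
\<close>

lemma submersion_local_lift:
  fixes U :: "('u::{t2_space, second_countable_topology}, 'd::model_space) atlas"
    and M :: "('m::{t2_space, second_countable_topology}, 'e::model_space) atlas"
  assumes U: "manifold U" and M: "manifold M" and t: "submersion U M t"
    and X: "X \<in> vector_fields M (carrier M)" and p: "p \<in> carrier U"
  shows "\<exists>V h Z. open V \<and> p \<in> V \<and> h \<in> Cinf_c U (carrier U) \<and> (\<forall>q\<in>V. h q = 1) \<and>
    Z \<in> compact_sections U (vector_fields U) \<and>
    (\<forall>q\<in>carrier U. differential U M t q (Z q) = tscale (h q) (X (t q)))"
proof -
  have tm: "smooth_map U M t" using t by (simp add: submersion_def)
  obtain c where c: "c \<in> U" "p \<in> cdom c" using carrier_chart[OF p] by blast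
  obtain d where d: "d \<in> M" "t p \<in> cdom d"
    using carrier_chart[OF smooth_map_on_carrier[OF tm p]] by blast
  note cc = manifold_chart[OF U c(1)] and cd = manifold_chart[OF M d(1)]
  define S where "S = carrier U \<inter> t -` cdom d"
  define P where "P = cdom c \<inter> S"
  have oS: "open S" unfolding S_def
    by (rule smooth_map_on_open_vimage[OF tm open_carrier[OF U] open_cdom[OF cd]])
  have oP: "open P" unfolding P_def using open_cdom[OF cc] oS by (rule open_Int)
  have pP: "p \<in> P" using c d p by (simp add: P_def S_def)
  \<comment> \<open>everything takes place on \<open>Q\<close>, the part of the chart around \<open>p\<close> that \<open>t\<close> maps to the chart \<open>d\<close>\<close>
  define Q where "Q = cmap c ` P"
  have oQ: "open Q" unfolding Q_def P_def by (rule open_chart_image[OF cc oS])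
  have pQ: "cmap c p \<in> Q" using pP by (simp add: Q_def)
  define D where "D = (\<lambda>x. frechet_derivative (cmap d \<circ> t \<circ> cinv c) (at x))"
  have Deq: "differential U M t q v d = D (cmap c q) (v c)" if "q \<in> P" "v \<in> tangent U q" for q v
    unfolding D_def
    by (rule differential_chart[OF U tm that(2) c(1) _ d(1)]) (use that in \<open>auto simp: P_def S_def\<close>)
  have "\<exists>x. D (cmap c p) x = b" for b
  proof -
    have "coord_vector M d (t p) b \<in> tangent M (t p)" by (rule coord_vector_tangent[OF M d])
    also have "tangent M (t p) = differential U M t p ` tangent U p"
      using t p by (simp add: submersion_def)
    finally obtain v where v: "v \<in> tangent U p" "coord_vector M d (t p) b = differential U M t p v"
      by blast
    have "D (cmap c p) (v c) = coord_vector M d (t p) b d"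
      unfolding v(2) by (rule Deq[OF pP v(1), symmetric])
    then show ?thesis using coord_vector_tangent(2)[OF M d] by metis
  qed
  \<comment> \<open>a right inverse of the differential at \<open>p\<close>, in coordinates\<close>
  then obtain r where r: "\<And>b. D (cmap c p) (r b) = b" by metis
  have sD: "smooth_on Q (\<lambda>x. D x (r b))" for b
    unfolding D_def
    by (intro smooth_on_frechet_derivative smooth_on_subset[OF chart_rep_smooth[OF U tm c(1) d(1)]])
       (auto simp: Q_def P_def S_def)
  have "smooth_fun U P (\<lambda>q. X (t q) d)"
  proof (rule smooth_fun_pullback[OF U M oP])
    show "smooth_map_on U M P t"
      using tm unfolding smooth_map_on_iff
      by (auto simp: P_def S_def intro: continuous_on_subset elim!: smooth_fun_subset)
    show "open (carrier M \<inter> cdom d)" using open_carrier[OF M] open_cdom[OF cd] by (rule open_Int)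
    show "smooth_fun M (carrier M \<inter> cdom d) (\<lambda>p. X p d)" using X d by (simp add: vector_fields_iff)
    show "q \<in> P \<Longrightarrow> t q \<in> carrier M \<inter> cdom d" for q
      using d by (auto simp: P_def S_def carrier_def)
  qed
  from smooth_fun_chart_rep[OF this c(1)]
  have sX: "smooth_on Q (\<lambda>x. X (t (cinv c x)) d)" by (simp add: Q_def P_def Int_absorb1 Int_assoc)
  have "\<exists>V. open V \<and> cmap c p \<in> V \<and> V \<subseteq> Q \<and>
      smooth_comb V obasis (\<lambda>b x. D x (r b)) (\<lambda>x. X (t (cinv c x)) d)"
    by (rule smooth_frame_coordinates[OF oQ pQ sX sD r])
  then obtain V a where V: "open V" "cmap c p \<in> V" "V \<subseteq> Q"
    and a: "\<And>b. b \<in> obasis \<Longrightarrow> smooth_on V (a b)"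
      "\<And>x. x \<in> V \<Longrightarrow> X (t (cinv c x)) d = (\<Sum>b\<in>obasis. a b x *\<^sub>R D x (r b))"
    unfolding smooth_comb_def by blast
  define W where "W = cmap c -` V \<inter> cdom c"
  have "\<forall>B. open B \<longrightarrow> open (cmap c -` B \<inter> cdom c)"
    by (rule continuous_on_open_vimage[OF open_cdom[OF cc], THEN iffD1, OF continuous_cmap[OF cc]])
  then have oW: "open W" unfolding W_def using V(1) by blast
  have pW: "p \<in> W" using V(2) c by (simp add: W_def)
  have WP: "W \<subseteq> P"
  proof
    fix q assume "q \<in> W"
    then obtain q' where "q' \<in> P" "cmap c q = cmap c q'" "q \<in> cdom c"
      using V(3) by (auto simp: W_def Q_def)
    then show "q \<in> P" using cinv_cmap[OF cc] by (metis IntD1 P_def)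
  qed
  have Wc: "W \<subseteq> cdom c" by (simp add: W_def)
  have WU: "W \<subseteq> carrier U" using WP by (auto simp: P_def S_def)
  obtain h N where h: "h \<in> Cinf_c U W" "open N" "p \<in> N" "\<And>q. q \<in> N \<Longrightarrow> h q = 1"
    using ex_bump_at_point[OF U oW pW p] by blast
  have hU: "h \<in> Cinf_c U (carrier U)" by (rule Cinf_c_mono[OF U open_carrier[OF U] oW WU h(1)])
  define Y where "Y = (\<lambda>q. \<Sum>b\<in>obasis. tscale (a b (cmap c q)) (coord_vector U c q (r b)))"
  define Z where "Z = h \<cdot> Y"
  have Ytan: "Y q \<in> tangent U q" if q: "q \<in> W" for q
  proof -
    have "(\<Sum>b\<in>J. tscale (a b (cmap c q)) (coord_vector U c q (r b))) \<in> tangent U q" if "finite J" for J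
      using that
    proof induction
      case empty
      show ?case unfolding sum.empty by (rule tangent_zero[OF U])
    next
      case (insert b J)
      show ?case unfolding sum.insert[OF insert.hyps]
        by (intro tangent_add tangent_scale coord_vector_tangent U c insert.IH) (use q Wc in auto)
    qed
    then show ?thesis unfolding Y_def by simp
  qed
  have "Z \<in> vector_fields U (carrier U)"
    unfolding vector_fields_iff
  proof (intro conjI ballI allI impI)
    show "Z q \<in> tangent U q" for q
    proof (cases "q \<in> W")
      case True
      then show ?thesis unfolding Z_def fscale_apply by (intro tangent_scale[OF U] Ytan)
    next
      case False
      then have "Z q = 0" using Cinf_cD(4)[OF h(1)] by (simp add: Z_def fscale_apply fun_eq_iff)
      then show ?thesis by (simp only: tangent_zero[OF U])
    qed
    show "q \<notin> carrier U \<Longrightarrow> Z q = 0" for q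
      using Cinf_cD(4)[OF hU] by (simp add: Z_def fscale_apply fun_eq_iff)
    show "smooth_fun U (carrier U \<inter> cdom e) (\<lambda>q. Z q e)" if e: "e \<in> U" for e
      unfolding Z_def fscale_apply
    proof (rule smooth_fun_extend[OF U _ oW h(1)])
      note oe = open_cdom[OF manifold_chart[OF U e]]
      show "open (carrier U \<inter> cdom e)" using open_carrier[OF U] oe by (rule open_Int)
      have oR: "open (carrier U \<inter> cdom e \<inter> W)" by (intro open_Int open_carrier[OF U] oe oW)
      have "smooth_fun U (carrier U \<inter> cdom e \<inter> W)
          (\<lambda>q. \<Sum>b\<in>obasis. a b (cmap c q) *\<^sub>R coord_vector U c q (r b) e)"
      proof (intro smooth_fun_sum[OF U oR] smooth_fun_scaleR[OF U oR])
        fix b :: 'e assume "b \<in> obasis"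
        have "smooth_fun U W (\<lambda>q. a b (cmap c q))"
          by (rule smooth_fun_of_chart_rep[OF U oW c(1) Wc smooth_on_subset[OF a(1)[OF \<open>b \<in> obasis\<close>]]])
             (auto simp: W_def)
        then show "smooth_fun U (carrier U \<inter> cdom e \<inter> W) (\<lambda>q. a b (cmap c q))"
          by (rule smooth_fun_subset) simp
        show "smooth_fun U (carrier U \<inter> cdom e \<inter> W) (\<lambda>q. coord_vector U c q (r b) e)"
          by (rule smooth_fun_subset[OF smooth_coord_vector[OF U c(1) e]]) (use Wc in auto)
      qed
      then show "smooth_fun U (carrier U \<inter> cdom e \<inter> W) (\<lambda>q. Y q e)"
        by (simp only: Y_def sum_fun_apply)
    qed
  qed
  moreover have "supp Z \<subseteq> supp h" unfolding Z_def by (rule supp_fscale)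
  ultimately have "Z \<in> compact_sections U (vector_fields U)"
    using Cinf_cD(2,3)[OF hU] compact_supp_subset[of h Z] by (auto simp: compact_sections_def)
  moreover have "differential U M t q (Z q) = tscale (h q) (X (t q))" if q: "q \<in> carrier U" for q
  proof (cases "q \<in> W")
    case False
    then have "Z q = 0" "tscale (h q) (X (t q)) = 0"
      using Cinf_cD(4)[OF h(1)] by (simp_all add: Z_def fscale_apply fun_eq_iff)
    then show ?thesis by (simp only: differential_zero[OF U tm q])
  next
    case True
    then have qP: "q \<in> P" and qc: "q \<in> cdom c" using WP Wc by auto
    then have tq: "t q \<in> cdom d" by (simp add: P_def S_def)
    have "differential U M t q (Y q) = X (t q)"
    proof (rule tangent_eqI[OF _ _ d(1) tq])
      show "differential U M t q (Y q) \<in> tangent M (t q)"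
        by (rule differential_tangent[OF U M tm q Ytan[OF True]])
      show "X (t q) \<in> tangent M (t q)"
        using X smooth_map_on_carrier[OF tm q] by (simp add: vector_fields_iff)
      have "differential U M t q (Y q) d = (\<Sum>b\<in>obasis. a b (cmap c q) *\<^sub>R
          differential U M t q (coord_vector U c q (r b)) d)"
        by (simp only: Y_def differential_sum[OF U tm q] differential_scale[OF U tm q] sum_fun_apply)
      also have "\<dots> = (\<Sum>b\<in>obasis. a b (cmap c q) *\<^sub>R D (cmap c q) (r b))"
        by (simp only: Deq[OF qP coord_vector_tangent(1)[OF U c(1) qc]]
              coord_vector_tangent(2)[OF U c(1) qc])
      also have "\<dots> = X (t q) d"
        using a(2)[of "cmap c q"] True by (simp add: W_def cinv_cmap[OF cc qc])
      finally show "differential U M t q (Y q) d = X (t q) d" .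
    qed
    then show ?thesis unfolding Z_def fscale_apply differential_scale[OF U tm q] by simp
  qed
  ultimately show ?thesis using h(2-4) hU by blast
qed

lemma telescoping_bumps:
  fixes h :: "nat \<Rightarrow> real"
  shows "(\<Sum>n<N. (\<Prod>j<n. 1 - h j) * h n) = 1 - (\<Prod>j<N. 1 - h j)"
  by (induction N) (simp_all add: algebra_simps)

text \<open>
  Let \<open>h\<^sub>n = 1\<close> on \<open>V\<^sub>n\<close>, where the \<open>V\<^sub>n\<close> are a countable cover, and let \<open>Z\<^sub>n\<close> be related to \<open>Y\<close> up to
  the factor \<open>h\<^sub>n\<close>. Then the sum of the fields \<open>(1 - h\<^sub>0) \<dots> (1 - h\<^bsub>n-1\<^esub>) Z\<^sub>n\<close> is finite
  on each \<open>V\<^sub>m\<close>, as all terms with \<open>n > m\<close> vanish there, and the factors telescope to 1.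
\<close>

lemma related_glue:
  fixes U :: "('u::{t2_space, second_countable_topology}, 'd::model_space) atlas"
    and N :: "('b::{t2_space, second_countable_topology}, 'f::model_space) atlas"
  assumes U: "manifold U" and \<phi>: "smooth_map U N \<phi>"
    and loc: "\<And>p. p \<in> carrier U \<Longrightarrow> \<exists>V h Z. open V \<and> p \<in> V \<and> smooth_fun U (carrier U) h \<and>
      (\<forall>q\<in>V. h q = (1::real)) \<and> Z \<in> vector_fields U (carrier U) \<and>
      (\<forall>q\<in>carrier U. differential U N \<phi> q (Z q) = tscale (h q) (Y (\<phi> q)))"
  shows "\<exists>Z\<in>vector_fields U (carrier U). related U N \<phi> Z Y"
proof (cases "carrier U = {}")
  case True
  then show ?thesis
    using vector_fields_closed(1)[OF U] by (intro bexI[of _ 0]) (simp_all add: related_def)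
next
  case False
  define good where "good = (\<lambda>V h Z. smooth_fun U (carrier U) h \<and>
      (\<forall>q\<in>V. h q = (1::real)) \<and> Z \<in> vector_fields U (carrier U) \<and>
      (\<forall>q\<in>carrier U. differential U N \<phi> q (Z q) = tscale (h q) (Y (\<phi> q))))"
  define G where "G = {V. open V \<and> (\<exists>h Z. good V h Z)}"
  obtain G' where G': "G' \<subseteq> G" "countable G'" "\<Union>G' = \<Union>G"
    using Lindelof[of G] unfolding G_def by blast
  have cov: "carrier U \<subseteq> \<Union>G'"
    unfolding G'(3)
  proof
    fix p assume "p \<in> carrier U"
    from loc[OF this] obtain V h Z where "open V" "p \<in> V" "good V h Z"
      unfolding good_def by (elim exE conjE) simp
    then show "p \<in> \<Union>G" unfolding G_def by blast
  qed
  then have "G' \<noteq> {}" using False by auto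
  define v where "v = from_nat_into G'"
  have rv: "range v = G'" unfolding v_def by (rule range_from_nat_into[OF \<open>G' \<noteq> {}\<close> G'(2)])
  have vG: "v n \<in> G" for n using rv G'(1) by blast
  then have ov: "open (v n)" for n by (simp add: G_def)
  have "\<forall>n. \<exists>hZ. good (v n) (fst hZ) (snd hZ)" using vG by (simp add: G_def)
  then obtain hZ where "\<forall>n. good (v n) (fst (hZ n)) (snd (hZ n))" by (rule choice[THEN exE])
  moreover define h Z where "h = (\<lambda>n. fst (hZ n))" and "Z = (\<lambda>n. snd (hZ n))"
  ultimately have hZ: "good (v n) (h n) (Z n)" for n by simp
  note hZ' = hZ[unfolded good_def]
  have h: "smooth_fun U (carrier U) (h n)" "q \<in> v n \<Longrightarrow> h n q = 1" for n q
    using hZ'[of n] by simp_all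
  have Z: "Z n \<in> vector_fields U (carrier U)"
    "q \<in> carrier U \<Longrightarrow> differential U N \<phi> q (Z n q) = tscale (h n q) (Y (\<phi> q))" for n q
    using hZ'[of n] by simp_all
  define k where "k = (\<lambda>n q. \<Prod>j<n. 1 - h j q)"
  define L where "L = (\<lambda>n q. \<Sum>i<n. tscale (k i q) (Z i q))"
  \<comment> \<open>any \<open>n\<close> with \<open>q \<in> v n\<close> gives the same value, since later terms vanish\<close>
  define R where "R = (\<lambda>q. L (Suc (LEAST n. q \<in> v n)) q)"
  have k0: "k n q = 0" if "q \<in> v m" "m < n" for q m n
    unfolding k_def by (rule prod_zero) (use that h(2)[OF that(1)] in auto)
  have Lstab: "L n q = L (Suc m) q" if "q \<in> v m" "m < n" for q m n
    unfolding L_def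
  proof (rule sum.mono_neutral_right)
    show "\<forall>i\<in>{..<n} - {..<Suc m}. tscale (k i q) (Z i q) = 0"
      using k0[OF that(1)] by (auto simp: fun_eq_iff)
  qed (use that in auto)
  have RL: "R q = L (Suc m) q" if "q \<in> v m" for q m
  proof -
    have "q \<in> v (LEAST n. q \<in> v n)" "(LEAST n. q \<in> v n) \<le> m"
      using that by (auto intro: LeastI Least_le)
    then show ?thesis unfolding R_def using Lstab[of q "LEAST n. q \<in> v n" "Suc m"] by simp
  qed
  have sk: "smooth_fun U (carrier U) (k n)" for n
  proof -
    have "smooth_fun U (carrier U) (\<lambda>q. \<Prod>j<n. 1 + - h j q)"
      by (intro smooth_fun_prod smooth_fun_add smooth_fun_minus smooth_fun_const U open_carrier[OF U] h)
    then show ?thesis by (simp add: k_def)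
  qed
  have Lf: "L n \<in> vector_fields U (carrier U)" for n
  proof (induction n)
    case 0
    have "L 0 = 0" by (simp add: L_def fun_eq_iff)
    then show ?case using vector_fields_closed(1)[OF U] by (simp only:)
  next
    case (Suc n)
    have "L (Suc n) = L n + k n \<cdot> Z n" by (simp add: L_def fun_eq_iff fscale_apply)
    then show ?case
      using vector_fields_closed(2)[OF U Suc vector_fields_closed(3)[OF U sk Z(1)]] by (simp only:)
  qed
  have inv: "\<exists>m. q \<in> v m" if "q \<in> carrier U" for q
    using cov that rv by blast
  have RV: "R \<in> vector_fields U (carrier U)"
    unfolding vector_fields_iff
  proof (intro conjI ballI allI impI)
    fix q assume q: "q \<in> carrier U"
    then obtain m where "q \<in> v m" using inv by blast
    then show "R q \<in> tangent U q" using Lf[of "Suc m"] q by (simp add: RL[of _ m] vector_fields_iff)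
  next
    fix q assume "q \<notin> carrier U"
    then show "R q = 0" unfolding R_def using Lf by (simp add: vector_fields_iff)
  next
    fix d assume d: "d \<in> U"
    note od = open_cdom[OF manifold_chart[OF U d]]
    show "smooth_fun U (carrier U \<inter> cdom d) (\<lambda>q. R q d)"
    proof (rule smooth_fun_local[OF U open_Int[OF open_carrier[OF U] od]])
      fix p assume p: "p \<in> carrier U \<inter> cdom d"
      then obtain m where m: "p \<in> v m" using inv by blast
      let ?T = "carrier U \<inter> cdom d \<inter> v m"
      have oT: "open ?T" by (intro open_Int open_carrier[OF U] od ov)
      have "smooth_fun U ?T (\<lambda>q. L (Suc m) q d)"
        using Lf[of "Suc m"] d by (auto simp: vector_fields_iff intro: smooth_fun_subset)
      then have "smooth_fun U ?T (\<lambda>q. R q d)"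
        by (rule smooth_fun_cong[OF U oT, THEN iffD1, rotated]) (simp add: RL[of _ m])
      with oT m p show "\<exists>T. open T \<and> p \<in> T \<and> smooth_fun U T (\<lambda>q. R q d)" by blast
    qed
  qed
  have "differential U N \<phi> q (R q) = Y (\<phi> q)" if q: "q \<in> carrier U" for q
  proof -
    obtain m where m: "q \<in> v m" using inv[OF q] by blast
    have "differential U N \<phi> q (R q) = (\<Sum>i<Suc m. tscale (k i q) (tscale (h i q) (Y (\<phi> q))))"
      unfolding RL[OF m] L_def
      by (simp only: differential_sum[OF U \<phi> q] differential_scale[OF U \<phi> q] Z(2)[OF q])
    also have "\<dots> = tscale (\<Sum>i<Suc m. k i q * h i q) (Y (\<phi> q))"
      by (simp only: fun_eq_iff sum_fun_apply scaleR_scaleR scaleR_sum_left simp_thms)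
    also have "(\<Sum>i<Suc m. k i q * h i q) = 1"
      using h(2)[OF m] unfolding k_def telescoping_bumps by simp
    finally show ?thesis by simp
  qed
  with RV show ?thesis unfolding related_def by blast
qed

section \<open>Product manifolds\<close>

abbreviation pchart :: "('a, 'e) chart \<Rightarrow> ('b, 'f) chart \<Rightarrow> ('a \<times> 'b, 'e \<times> 'f) chart" where
  "pchart c d \<equiv> Chart (cdom c \<times> cdom d) (map_prod (cmap c) (cmap d))"

lemma prod_atlasE:
  assumes "k \<in> prod_atlas M N"
  obtains c d where "c \<in> M" "d \<in> N" "k = pchart c d"
  using assms by (auto simp: prod_atlas_def)

lemma pchart_in_prod_atlas: "c \<in> M \<Longrightarrow> d \<in> N \<Longrightarrow> pchart c d \<in> prod_atlas M N"
  by (auto simp: prod_atlas_def)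

lemma pchart_image: "map_prod f g ` (A \<times> B) = f ` A \<times> g ` B"
  by auto

lemma carrier_prod: "carrier (prod_atlas M N) = carrier M \<times> carrier N"
  by (fastforce simp: carrier_def prod_atlas_def)

lemma cinv_pchart:
  assumes "is_chart c" "is_chart d" "x \<in> cmap c ` cdom c" "y \<in> cmap d ` cdom d"
  shows "cinv (pchart c d) (x, y) = (cinv c x, cinv d y)"
proof -
  have inj: "inj_on (map_prod (cmap c) (cmap d)) (cdom c \<times> cdom d)"
    by (rule inj_on_inverseI[of _ "map_prod (cinv c) (cinv d)"])
       (auto simp: cinv_cmap[OF assms(1)] cinv_cmap[OF assms(2)])
  have "(x, y) = map_prod (cmap c) (cmap d) (cinv c x, cinv d y)"
    using cmap_cinv[OF assms(1,3)] cmap_cinv[OF assms(2,4)] by simp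
  moreover have "(cinv c x, cinv d y) \<in> cdom c \<times> cdom d"
    using cinv_in_cdom[OF assms(1,3)] cinv_in_cdom[OF assms(2,4)] by simp
  ultimately show ?thesis unfolding cinv_def[of "pchart c d"] chart.sel
    using inv_into_f_f[OF inj] by metis
qed

lemma is_chart_pchart:
  assumes c: "is_chart c" and d: "is_chart d"
  shows "is_chart (pchart c d)"
proof -
  have op: "open (cmap c ` cdom c \<times> cmap d ` cdom d)"
    by (intro open_Times open_cmap_image c d)
  have "homeomorphism (cdom c \<times> cdom d) (cmap c ` cdom c \<times> cmap d ` cdom d)
      (map_prod (cmap c) (cmap d)) (cinv (pchart c d))"
    unfolding homeomorphism_def
  proof (intro conjI ballI)
    show "continuous_on (cdom c \<times> cdom d) (map_prod (cmap c) (cmap d))"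
      unfolding map_prod_def case_prod_beta
      by (intro continuous_on_Pair continuous_on_compose2[OF continuous_cmap[OF c]]
            continuous_on_compose2[OF continuous_cmap[OF d]] continuous_on_fst continuous_on_snd
            continuous_on_id) auto
    have "continuous_on (cmap c ` cdom c \<times> cmap d ` cdom d) (\<lambda>z. (cinv c (fst z), cinv d (snd z)))"
      by (intro continuous_on_Pair continuous_on_compose2[OF continuous_cinv[OF c]]
            continuous_on_compose2[OF continuous_cinv[OF d]] continuous_on_fst continuous_on_snd
            continuous_on_id) auto
    then show "continuous_on (cmap c ` cdom c \<times> cmap d ` cdom d) (cinv (pchart c d))"
      by (rule continuous_on_cong[THEN iffD1, rotated -1]) (auto simp: cinv_pchart[OF c d])
    show "map_prod (cmap c) (cmap d) ` (cdom c \<times> cdom d) = cmap c ` cdom c \<times> cmap d ` cdom d"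
      by (rule pchart_image)
    show "cinv (pchart c d) (map_prod (cmap c) (cmap d) p) = p" if "p \<in> cdom c \<times> cdom d" for p
      using that by (auto simp: cinv_pchart[OF c d] cinv_cmap[OF c] cinv_cmap[OF d])
    show "map_prod (cmap c) (cmap d) (cinv (pchart c d) z) = z"
      if "z \<in> cmap c ` cdom c \<times> cmap d ` cdom d" for z
      using that by (auto simp: cinv_pchart[OF c d] cinv_cmap[OF c] cinv_cmap[OF d])
    show "cinv (pchart c d) ` (cmap c ` cdom c \<times> cmap d ` cdom d) = cdom c \<times> cdom d"
    proof
      show "cinv (pchart c d) ` (cmap c ` cdom c \<times> cmap d ` cdom d) \<subseteq> cdom c \<times> cdom d"
        by (auto simp: cinv_pchart[OF c d] cinv_cmap[OF c] cinv_cmap[OF d])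
      show "cdom c \<times> cdom d \<subseteq> cinv (pchart c d) ` (cmap c ` cdom c \<times> cmap d ` cdom d)"
      proof
        fix p assume p: "p \<in> cdom c \<times> cdom d"
        then have "p = cinv (pchart c d) (cmap c (fst p), cmap d (snd p))"
          by (auto simp: cinv_pchart[OF c d] cinv_cmap[OF c] cinv_cmap[OF d])
        moreover have "(cmap c (fst p), cmap d (snd p)) \<in> cmap c ` cdom c \<times> cmap d ` cdom d"
          using p by auto
        ultimately show "p \<in> cinv (pchart c d) ` (cmap c ` cdom c \<times> cmap d ` cdom d)" by (rule image_eqI)
      qed
    qed
  qed
  then show ?thesis
    using op open_Times[OF open_cdom[OF c] open_cdom[OF d]] by (simp add: is_chart_def pchart_image)
qed

lemma smooth_on_fst_snd:
  fixes f :: "'a::model_space \<Rightarrow> 'c::real_normed_vector" and g :: "'b::model_space \<Rightarrow> 'd::real_normed_vector"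
  assumes "smooth_on S f" "smooth_on T g" "open S" "open T"
  shows "smooth_on (S \<times> T) (\<lambda>z. (f (fst z), g (snd z)))"
proof -
  have op: "open (S \<times> T)" using assms(3,4) by (rule open_Times)
  have "smooth_on (S \<times> T) (\<lambda>z. f (fst z))"
    by (rule smooth_on_compose[OF smooth_on_bounded_linear[OF bounded_linear_fst op] assms(1) _ op]) auto
  moreover have "smooth_on (S \<times> T) (\<lambda>z. g (snd z))"
    by (rule smooth_on_compose[OF smooth_on_bounded_linear[OF bounded_linear_snd op] assms(2) _ op]) auto
  ultimately show ?thesis using op by (rule smooth_on_Pair)
qed

lemma manifold_prod:
  fixes M :: "('m::{t2_space, second_countable_topology}, 'e::model_space) atlas"
    and N :: "('n::{t2_space, second_countable_topology}, 'f::model_space) atlas"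
  assumes M: "manifold M" and N: "manifold N"
  shows "manifold (prod_atlas M N)"
  unfolding manifold_def
proof (intro conjI ballI)
  show "is_chart k" if "k \<in> prod_atlas M N" for k
    using that by (elim prod_atlasE) (simp add: is_chart_pchart manifold_chart[OF M] manifold_chart[OF N])
  fix k k' assume "k \<in> prod_atlas M N" "k' \<in> prod_atlas M N"
  then obtain c d c' d' where c: "c \<in> M" "c' \<in> M" and d: "d \<in> N" "d' \<in> N"
    and k: "k = pchart c d" "k' = pchart c' d'" by (auto elim!: prod_atlasE)
  note cc = manifold_chart[OF M c(1)] and cc' = manifold_chart[OF M c(2)]
    and cd = manifold_chart[OF N d(1)] and cd' = manifold_chart[OF N d(2)]
  let ?S = "cmap c ` (cdom c \<inter> cdom c')" and ?T = "cmap d ` (cdom d \<inter> cdom d')"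
  have op: "open ?S" "open ?T"
    by (intro open_chart_image cc cd open_cdom cc' cd')+
  have "smooth_on (?S \<times> ?T) (\<lambda>z. ((cmap c' \<circ> cinv c) (fst z), (cmap d' \<circ> cinv d) (snd z)))"
  proof (rule smooth_on_fst_snd[OF _ _ op])
    show "smooth_on ?S (cmap c' \<circ> cinv c)" using M c by (simp add: manifold_def)
    show "smooth_on ?T (cmap d' \<circ> cinv d)" using N d by (simp add: manifold_def)
  qed
  then have "smooth_on (?S \<times> ?T) (cmap k' \<circ> cinv k)"
    by (rule smooth_on_cong[OF open_Times[OF op], THEN iffD1, rotated])
       (auto simp: k cinv_pchart[OF cc cd])
  moreover have "cmap k ` (cdom k \<inter> cdom k') = ?S \<times> ?T"
    by (simp add: k Times_Int_Times pchart_image)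
  ultimately show "smooth_on (cmap k ` (cdom k \<inter> cdom k')) (cmap k' \<circ> cinv k)" by simp
qed

text \<open>
  The inverse of a product chart is a product of maps only on the image of the chart, so \<open>F\<close> is
  compared with a product map on an open set only.
\<close>

lemma frechet_derivative_product_map:
  assumes "open S" "(x, y) \<in> S" "\<And>z. z \<in> S \<Longrightarrow> F z = (f (fst z), g (snd z))"
    and f: "f differentiable (at x)" and g: "g differentiable (at y)"
  shows "frechet_derivative F (at (x, y)) (v, w)
    = (frechet_derivative f (at x) v, frechet_derivative g (at y) w)"
proof -
  have f': "(f has_derivative frechet_derivative f (at x)) (at (fst (x, y)))"
    and g': "(g has_derivative frechet_derivative g (at y)) (at (snd (x, y)))"
    using f g by (simp_all add: frechet_derivative_works)
  have "((\<lambda>z. (f (fst z), g (snd z))) has_derivative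
      (\<lambda>z. (frechet_derivative f (at x) (fst z), frechet_derivative g (at y) (snd z)))) (at (x, y))"
    by (intro has_derivative_Pair has_derivative_compose[where f = fst, OF _ f']
          has_derivative_compose[where f = snd, OF _ g']
          has_derivative_fst has_derivative_snd has_derivative_ident)
  from frechet_derivative_at[OF this]
  have "frechet_derivative F (at (x, y))
      = (\<lambda>z. (frechet_derivative f (at x) (fst z), frechet_derivative g (at y) (snd z)))"
    using differentiable_cong_open(2)[OF assms(1-3)] by simp
  then show ?thesis by simp
qed

section \<open>Smooth maps into and out of products\<close>

lemma smooth_map_const: "a \<in> carrier B \<Longrightarrow> smooth_map_on A B S (\<lambda>_. a)"
  by (auto simp: smooth_map_on_iff smooth_fun_const)

lemma smooth_map_Pair:
  fixes A :: "('a::{t2_space, second_countable_topology}, 'd::model_space) atlas"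
    and M :: "('m::{t2_space, second_countable_topology}, 'e::model_space) atlas"
    and N :: "('n::{t2_space, second_countable_topology}, 'f::model_space) atlas"
  assumes A: "manifold A" and M: "manifold M" and N: "manifold N" and S: "open S"
    and f: "smooth_map_on A M S f" and g: "smooth_map_on A N S g"
  shows "smooth_map_on A (prod_atlas M N) S (\<lambda>p. (f p, g p))"
  unfolding smooth_map_on_iff
proof (intro conjI ballI)
  show "(\<lambda>p. (f p, g p)) ` S \<subseteq> carrier (prod_atlas M N)"
    using f g by (auto simp: smooth_map_on_def carrier_prod)
  show "continuous_on S (\<lambda>p. (f p, g p))"
    using f g by (simp add: smooth_map_on_def continuous_on_Pair)
  fix k assume "k \<in> prod_atlas M N"
  then obtain c d where c: "c \<in> M" and d: "d \<in> N" and k: "k = pchart c d" by (rule prod_atlasE)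
  let ?T = "S \<inter> (\<lambda>p. (f p, g p)) -` cdom k"
  have eq: "?T = (S \<inter> f -` cdom c) \<inter> (S \<inter> g -` cdom d)" by (auto simp: k)
  have oT: "open ?T" unfolding eq
    by (intro open_Int smooth_map_on_open_vimage[OF f S] smooth_map_on_open_vimage[OF g S]
          open_cdom manifold_chart[OF M c] manifold_chart[OF N d])
  have "smooth_fun A ?T (\<lambda>p. cmap c (f p))"
    by (rule smooth_fun_subset[of A "S \<inter> f -` cdom c"]) (use f c k in \<open>auto simp: smooth_map_on_iff\<close>)
  moreover have "smooth_fun A ?T (\<lambda>p. cmap d (g p))"
    by (rule smooth_fun_subset[of A "S \<inter> g -` cdom d"]) (use g d k in \<open>auto simp: smooth_map_on_iff\<close>)
  ultimately have "smooth_fun A ?T (\<lambda>p. (cmap c (f p), cmap d (g p)))"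
    by (rule smooth_fun_Pair[OF A oT])
  then show "smooth_fun A ?T (\<lambda>p. cmap k (f p, g p))" by (simp add: k)
qed

context
  fixes M :: "('m::{t2_space, second_countable_topology}, 'e::model_space) atlas"
    and N :: "('n::{t2_space, second_countable_topology}, 'f::model_space) atlas"
  assumes M: "manifold M" and N: "manifold N"
begin

lemma smooth_map_fst: "smooth_map (prod_atlas M N) M fst"
  unfolding smooth_map_on_iff
proof (intro conjI ballI)
  show "fst ` carrier (prod_atlas M N) \<subseteq> carrier M" by (auto simp: carrier_prod)
  show "continuous_on (carrier (prod_atlas M N)) fst" by (rule continuous_on_fst[OF continuous_on_id])
  fix c assume c: "c \<in> M"
  note cc = manifold_chart[OF M c] and MN = manifold_prod[OF M N]
  have op: "open (carrier (prod_atlas M N) \<inter> fst -` cdom c)"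
    by (intro open_Int open_carrier[OF MN] open_vimage_fst open_cdom cc)
  show "smooth_fun (prod_atlas M N) (carrier (prod_atlas M N) \<inter> fst -` cdom c) (\<lambda>p. cmap c (fst p))"
  proof (rule smooth_fun_chartI[OF MN op])
    fix p assume p: "p \<in> carrier (prod_atlas M N) \<inter> fst -` cdom c"
    then obtain d where d: "d \<in> N" "snd p \<in> cdom d" by (auto simp: carrier_prod dest: carrier_chart)
    note cd = manifold_chart[OF N d(1)]
    let ?k = "pchart c d"
    have k: "?k \<in> prod_atlas M N" "p \<in> cdom ?k"
      using p by (auto simp: pchart_in_prod_atlas c d mem_Times_iff)
    have oi: "open (cmap ?k ` cdom ?k)" by (rule open_cmap_image[OF is_chart_pchart[OF cc cd]])
    have "smooth_on (cmap ?k ` cdom ?k) fst"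
      by (rule smooth_on_bounded_linear[OF bounded_linear_fst oi])
    then have "smooth_on (cmap ?k ` cdom ?k) (\<lambda>x. cmap c (fst (cinv ?k x)))"
      by (rule smooth_on_cong[OF oi, THEN iffD1, rotated]) (auto simp: cinv_pchart[OF cc cd] cinv_cmap[OF cc])
    then show "\<exists>k\<in>prod_atlas M N. \<exists>T. open T \<and> p \<in> T \<and> p \<in> cdom k \<and>
        smooth_on (cmap k ` (cdom k \<inter> T)) (\<lambda>x. cmap c (fst (cinv k x)))"
      using k by (intro bexI[of _ ?k] exI[of _ UNIV]) simp_all
  qed
qed

lemma smooth_map_snd: "smooth_map (prod_atlas M N) N snd"
  unfolding smooth_map_on_iff
proof (intro conjI ballI)
  show "snd ` carrier (prod_atlas M N) \<subseteq> carrier N" by (auto simp: carrier_prod)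
  show "continuous_on (carrier (prod_atlas M N)) snd" by (rule continuous_on_snd[OF continuous_on_id])
  fix d assume d: "d \<in> N"
  note cd = manifold_chart[OF N d] and MN = manifold_prod[OF M N]
  have op: "open (carrier (prod_atlas M N) \<inter> snd -` cdom d)"
    by (intro open_Int open_carrier[OF MN] open_vimage_snd open_cdom cd)
  show "smooth_fun (prod_atlas M N) (carrier (prod_atlas M N) \<inter> snd -` cdom d) (\<lambda>p. cmap d (snd p))"
  proof (rule smooth_fun_chartI[OF MN op])
    fix p assume p: "p \<in> carrier (prod_atlas M N) \<inter> snd -` cdom d"
    then obtain c where c: "c \<in> M" "fst p \<in> cdom c" by (auto simp: carrier_prod dest: carrier_chart)
    note cc = manifold_chart[OF M c(1)]
    let ?k = "pchart c d"
    have k: "?k \<in> prod_atlas M N" "p \<in> cdom ?k"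
      using p by (auto simp: pchart_in_prod_atlas c d mem_Times_iff)
    have oi: "open (cmap ?k ` cdom ?k)" by (rule open_cmap_image[OF is_chart_pchart[OF cc cd]])
    have "smooth_on (cmap ?k ` cdom ?k) snd"
      by (rule smooth_on_bounded_linear[OF bounded_linear_snd oi])
    then have "smooth_on (cmap ?k ` cdom ?k) (\<lambda>x. cmap d (snd (cinv ?k x)))"
      by (rule smooth_on_cong[OF oi, THEN iffD1, rotated]) (auto simp: cinv_pchart[OF cc cd] cinv_cmap[OF cd])
    then show "\<exists>k\<in>prod_atlas M N. \<exists>T. open T \<and> p \<in> T \<and> p \<in> cdom k \<and>
        smooth_on (cmap k ` (cdom k \<inter> T)) (\<lambda>x. cmap d (snd (cinv k x)))"
      using k by (intro bexI[of _ ?k] exI[of _ UNIV]) simp_all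
  qed
qed

end

lemma differential_ident:
  assumes A: "manifold A" and p: "p \<in> carrier A" and v: "v \<in> tangent A p"
  shows "differential A A (\<lambda>p. p) p v = v"
proof -
  obtain c where c: "c \<in> A" "p \<in> cdom c" using carrier_chart[OF p] by blast
  show ?thesis
  proof (rule tangent_eqI[OF differential_tangent[OF A A smooth_map_ident[OF A] p v] v c])
    show "differential A A (\<lambda>p. p) p v c = v c"
      using differential_chart[OF A smooth_map_ident[OF A] v c c] transition_derivative_ident[OF A c]
      by (simp add: o_def)
  qed
qed

lemma differential_const: "differential A B (\<lambda>_. a) p v = 0"
  by (auto simp: differential_def Let_def o_def fun_eq_iff)

lemma submersionI:
  assumes "manifold A" "manifold B" "smooth_map A B \<phi>"
    and "\<And>p v. p \<in> carrier A \<Longrightarrow> v \<in> tangent B (\<phi> p) \<Longrightarrow> \<exists>z\<in>tangent A p. differential A B \<phi> p z = v"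
  shows "submersion A B \<phi>"
  unfolding submersion_def
proof (intro conjI ballI equalityI subsetI)
  fix p v assume p: "p \<in> carrier A"
  show "v \<in> tangent B (\<phi> p)" if "v \<in> differential A B \<phi> p ` tangent A p"
    using that differential_tangent[OF assms(1-3) p] by blast
  show "v \<in> differential A B \<phi> p ` tangent A p" if "v \<in> tangent B (\<phi> p)"
    using assms(4)[OF p that] by blast
qed (rule assms(3))

section \<open>Tangent vectors of a product\<close>

text \<open>
  The factors of a product chart, recovered from it; this works if its domain is not empty, and then
  the argument \<open>undefined\<close> of the irrelevant component does not matter.
\<close>

definition lchart :: "('a \<times> 'b, 'e \<times> 'f) chart \<Rightarrow> ('a, 'e) chart" where
  "lchart k = Chart (fst ` cdom k) (\<lambda>x. fst (cmap k (x, undefined)))"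

definition rchart :: "('a \<times> 'b, 'e \<times> 'f) chart \<Rightarrow> ('b, 'f) chart" where
  "rchart k = Chart (snd ` cdom k) (\<lambda>y. snd (cmap k (undefined, y)))"

lemma lchart_pchart: "cdom d \<noteq> {} \<Longrightarrow> lchart (pchart c d) = c"
  by (cases c) (auto simp: lchart_def)

lemma rchart_pchart: "cdom c \<noteq> {} \<Longrightarrow> rchart (pchart c d) = d"
  by (cases d) (auto simp: rchart_def)

text \<open>The vector \<open>(v, w)\<close> under the identification \<open>T(M \<times> N) = T M \<times> T N\<close> at \<open>p\<close>.\<close>

definition tpair ::
    "('m, 'e::model_space) atlas \<Rightarrow> ('n, 'f::model_space) atlas \<Rightarrow> 'm \<times> 'n
     \<Rightarrow> ('m, 'e) tvec \<Rightarrow> ('n, 'f) tvec \<Rightarrow> ('m \<times> 'n, 'e \<times> 'f) tvec" where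
  "tpair M N p v w = (\<lambda>k. if k \<in> prod_atlas M N \<and> p \<in> cdom k then (v (lchart k), w (rchart k)) else 0)"

lemma tpair_pchart:
  assumes "c \<in> M" "d \<in> N" "a \<in> cdom c" "b \<in> cdom d"
  shows "tpair M N (a, b) v w (pchart c d) = (v c, w d)"
proof -
  have "lchart (pchart c d) = c" "rchart (pchart c d) = d"
    using assms by (auto intro: lchart_pchart rchart_pchart)
  then show ?thesis using assms by (simp add: tpair_def pchart_in_prod_atlas)
qed

lemma tpair_notin: "\<not> (k \<in> prod_atlas M N \<and> p \<in> cdom k) \<Longrightarrow> tpair M N p v w k = 0"
  by (simp only: tpair_def if_False)

lemma tpair_eqI:
  assumes "\<And>c d. c \<in> M \<Longrightarrow> d \<in> N \<Longrightarrow> a \<in> cdom c \<Longrightarrow> b \<in> cdom d \<Longrightarrow> u (pchart c d) = (v c, w d)"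
    and "\<And>k. \<not> (k \<in> prod_atlas M N \<and> (a, b) \<in> cdom k) \<Longrightarrow> u k = 0"
  shows "u = tpair M N (a, b) v w"
proof
  fix k show "u k = tpair M N (a, b) v w k"
  proof (cases "k \<in> prod_atlas M N \<and> (a, b) \<in> cdom k")
    case True
    then obtain c d where k: "c \<in> M" "d \<in> N" "k = pchart c d" by (auto elim: prod_atlasE)
    then have ab: "a \<in> cdom c" "b \<in> cdom d" using True by auto
    show ?thesis unfolding k(3) tpair_pchart[OF k(1,2) ab] by (rule assms(1)[OF k(1,2) ab])
  next
    case False
    show ?thesis by (simp only: assms(2)[OF False] tpair_notin[OF False])
  qed
qed

lemma tpair_add: "tpair M N p (v + v') (w + w') = tpair M N p v w + tpair M N p v' w'"
  by (auto simp: tpair_def fun_eq_iff)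

lemma tpair_scale: "tpair M N p (tscale r v) (tscale r w) = tscale r (tpair M N p v w)"
  by (auto simp: tpair_def fun_eq_iff)

lemma tpair_minus: "tpair M N p (- v) (- w) = - tpair M N p v w"
  by (auto simp: tpair_def fun_eq_iff)

lemma tpair_zero: "tpair M N p 0 0 = 0"
  by (auto simp: tpair_def fun_eq_iff zero_prod_def)

context
  fixes M :: "('m::{t2_space, second_countable_topology}, 'e::model_space) atlas"
    and N :: "('n::{t2_space, second_countable_topology}, 'f::model_space) atlas"
  assumes M: "manifold M" and N: "manifold N"
begin

lemma tpair_inject:
  assumes "v \<in> tangent M a" "v' \<in> tangent M a" "w \<in> tangent N b" "w' \<in> tangent N b"
    and "a \<in> carrier M" "b \<in> carrier N"
    and eq: "tpair M N (a, b) v w = tpair M N (a, b) v' w'"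
  shows "v = v' \<and> w = w'"
proof -
  obtain c where c: "c \<in> M" "a \<in> cdom c" using carrier_chart[OF assms(5)] by blast
  obtain d where d: "d \<in> N" "b \<in> cdom d" using carrier_chart[OF assms(6)] by blast
  have "v c = v' c \<and> w d = w' d"
    using fun_cong[OF eq, of "pchart c d"] by (simp add: tpair_pchart[OF c(1) d(1) c(2) d(2)])
  then show ?thesis using tangent_eqI[OF assms(1,2) c] tangent_eqI[OF assms(3,4) d] by simp
qed

lemma tpair_tangent:
  assumes v: "v \<in> tangent M a" and w: "w \<in> tangent N b"
  shows "tpair M N (a, b) v w \<in> tangent (prod_atlas M N) (a, b)"
proof (rule tangentI)
  fix k k' assume *: "k \<in> prod_atlas M N" "k' \<in> prod_atlas M N" "(a, b) \<in> cdom k" "(a, b) \<in> cdom k'"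
  obtain c d where k: "c \<in> M" "d \<in> N" "k = pchart c d" using *(1) by (rule prod_atlasE)
  obtain c' d' where k': "c' \<in> M" "d' \<in> N" "k' = pchart c' d'" using *(2) by (rule prod_atlasE)
  have p: "a \<in> cdom c" "b \<in> cdom d" "a \<in> cdom c'" "b \<in> cdom d'" using * k k' by auto
  note cc = manifold_chart[OF M k(1)] and cd = manifold_chart[OF N k(2)]
  have "frechet_derivative (cmap k' \<circ> cinv k) (at (cmap c a, cmap d b)) (v c, w d)
    = (frechet_derivative (cmap c' \<circ> cinv c) (at (cmap c a)) (v c),
       frechet_derivative (cmap d' \<circ> cinv d) (at (cmap d b)) (w d))"
  proof (rule frechet_derivative_product_map)
    show "open (cmap c ` cdom c \<times> cmap d ` cdom d)" by (intro open_Times open_cmap_image cc cd)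
    show "(cmap c a, cmap d b) \<in> cmap c ` cdom c \<times> cmap d ` cdom d" using p by simp
    show "(cmap k' \<circ> cinv k) z = ((cmap c' \<circ> cinv c) (fst z), (cmap d' \<circ> cinv d) (snd z))"
      if "z \<in> cmap c ` cdom c \<times> cmap d ` cdom d" for z
      using that by (auto simp: k k' cinv_pchart[OF cc cd])
    have "smooth_on (cmap c ` (cdom c \<inter> cdom c')) (cmap c' \<circ> cinv c)"
      using M k k' by (simp add: manifold_def)
    then show "cmap c' \<circ> cinv c differentiable at (cmap c a)"
      by (rule smooth_on_imp_differentiable) (use p in simp)
    have "smooth_on (cmap d ` (cdom d \<inter> cdom d')) (cmap d' \<circ> cinv d)"
      using N k k' by (simp add: manifold_def)
    then show "cmap d' \<circ> cinv d differentiable at (cmap d b)"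
      by (rule smooth_on_imp_differentiable) (use p in simp)
  qed
  also have "\<dots> = (v c', w d')"
    using tangentD(1)[OF v k(1) k'(1) p(1,3)] tangentD(1)[OF w k(2) k'(2) p(2,4)] by argo
  finally have "frechet_derivative (cmap k' \<circ> cinv k) (at (cmap c a, cmap d b)) (v c, w d) = (v c', w d')" .
  moreover have "tpair M N (a, b) v w k = (v c, w d)" "tpair M N (a, b) v w k' = (v c', w d')"
    unfolding k(3) k'(3) by (intro tpair_pchart k(1,2) k'(1,2) p)+
  moreover have "cmap k (a, b) = (cmap c a, cmap d b)" by (simp add: k)
  ultimately show "tpair M N (a, b) v w k'
      = frechet_derivative (cmap k' \<circ> cinv k) (at (cmap k (a, b))) (tpair M N (a, b) v w k)"
    by argo
qed (rule tpair_notin)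

lemma differential_Pair:
  fixes A :: "('a::{t2_space, second_countable_topology}, 'd::model_space) atlas"
  assumes A: "manifold A" and f: "smooth_map A M f" and g: "smooth_map A N g" and p: "p \<in> carrier A"
  shows "differential A (prod_atlas M N) (\<lambda>p. (f p, g p)) p v
    = tpair M N (f p, g p) (differential A M f p v) (differential A N g p v)"
proof (rule tpair_eqI)
  fix k assume "\<not> (k \<in> prod_atlas M N \<and> (f p, g p) \<in> cdom k)"
  then show "differential A (prod_atlas M N) (\<lambda>p. (f p, g p)) p v k = 0" by (rule differential_notin)
next
  fix c d assume cd: "c \<in> M" "d \<in> N" "f p \<in> cdom c" "g p \<in> cdom d"
  define e where "e = some_chart A p"
  have e: "e \<in> A" "p \<in> cdom e" using some_chart[OF p] by (auto simp: e_def)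
  have "((\<lambda>x. ((cmap c \<circ> f \<circ> cinv e) x, (cmap d \<circ> g \<circ> cinv e) x)) has_derivative
      (\<lambda>v. (frechet_derivative (cmap c \<circ> f \<circ> cinv e) (at (cmap e p)) v,
            frechet_derivative (cmap d \<circ> g \<circ> cinv e) (at (cmap e p)) v))) (at (cmap e p))"
    by (rule has_derivative_Pair[OF chart_rep_has_derivative[OF A f e(1) cd(1) e(2) cd(3)]
          chart_rep_has_derivative[OF A g e(1) cd(2) e(2) cd(4)]])
  note der0 = frechet_derivative_at[OF this, symmetric]
  have der: "frechet_derivative (\<lambda>x. ((cmap c \<circ> f \<circ> cinv e) x, (cmap d \<circ> g \<circ> cinv e) x)) (at (cmap e p)) v
    = (frechet_derivative (cmap c \<circ> f \<circ> cinv e) (at (cmap e p)) v,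
       frechet_derivative (cmap d \<circ> g \<circ> cinv e) (at (cmap e p)) v)" for v by (simp only: der0)
  have eq: "cmap (pchart c d) \<circ> (\<lambda>p. (f p, g p)) \<circ> cinv e
      = (\<lambda>x. ((cmap c \<circ> f \<circ> cinv e) x, (cmap d \<circ> g \<circ> cinv e) x))" by auto
  have in_k: "pchart c d \<in> prod_atlas M N \<and> (f p, g p) \<in> cdom (pchart c d)"
    using cd by (simp add: pchart_in_prod_atlas)
  show "differential A (prod_atlas M N) (\<lambda>p. (f p, g p)) p v (pchart c d)
      = (differential A M f p v c, differential A N g p v d)"
    unfolding differential_def Let_def e_def[symmetric] eq
    by (simp only: in_k cd der simp_thms if_True)
qed

text \<open>The identity of \<open>M \<times> N\<close> is the pair of the two projections.\<close>

lemma differential_fst_snd: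
  assumes a: "a \<in> carrier M" and b: "b \<in> carrier N" and v: "v \<in> tangent M a" and w: "w \<in> tangent N b"
  shows "differential (prod_atlas M N) M fst (a, b) (tpair M N (a, b) v w) = v \<and>
    differential (prod_atlas M N) N snd (a, b) (tpair M N (a, b) v w) = w"
proof -
  note MN = manifold_prod[OF M N] and fst = smooth_map_fst[OF M N] and snd = smooth_map_snd[OF M N]
  let ?z = "tpair M N (a, b) v w"
  have ab: "(a, b) \<in> carrier (prod_atlas M N)" using a b by (simp add: carrier_prod)
  have z: "?z \<in> tangent (prod_atlas M N) (a, b)" by (rule tpair_tangent[OF v w])
  have "?z = differential (prod_atlas M N) (prod_atlas M N) (\<lambda>p. (fst p, snd p)) (a, b) ?z"
    using differential_ident[OF MN ab z] by simp
  also have "\<dots> = tpair M N (a, b) (differential (prod_atlas M N) M fst (a, b) ?z)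
      (differential (prod_atlas M N) N snd (a, b) ?z)"
    by (simp only: differential_Pair[OF MN fst snd ab] fst_conv snd_conv)
  finally have eq: "tpair M N (a, b) (differential (prod_atlas M N) M fst (a, b) ?z)
      (differential (prod_atlas M N) N snd (a, b) ?z) = ?z" by (rule sym)
  have "differential (prod_atlas M N) M fst (a, b) ?z \<in> tangent M a"
    using differential_tangent[OF MN M fst ab z] by simp
  moreover have "differential (prod_atlas M N) N snd (a, b) ?z \<in> tangent N b"
    using differential_tangent[OF MN N snd ab z] by simp
  ultimately show ?thesis by (rule tpair_inject[OF _ v _ w a b eq])
qed

lemmas differential_fst = differential_fst_snd[THEN conjunct1]
  and differential_snd = differential_fst_snd[THEN conjunct2]

lemma submersion_fst: "submersion (prod_atlas M N) M fst"
proof (rule submersionI[OF manifold_prod[OF M N] M smooth_map_fst[OF M N]])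
  fix p v assume p: "p \<in> carrier (prod_atlas M N)" and "v \<in> tangent M (fst p)"
  moreover obtain a b where "p = (a, b)" by (cases p)
  ultimately show "\<exists>z\<in>tangent (prod_atlas M N) p. differential (prod_atlas M N) M fst p z = v"
    using tpair_tangent[OF _ tangent_zero[OF N]] differential_fst[OF _ _ _ tangent_zero[OF N]]
    by (intro bexI[of _ "tpair M N p v 0"]) (auto simp: carrier_prod)
qed

lemma submersion_snd: "submersion (prod_atlas M N) N snd"
proof (rule submersionI[OF manifold_prod[OF M N] N smooth_map_snd[OF M N]])
  fix p v assume p: "p \<in> carrier (prod_atlas M N)" and "v \<in> tangent N (snd p)"
  moreover obtain a b where "p = (a, b)" by (cases p)
  ultimately show "\<exists>z\<in>tangent (prod_atlas M N) p. differential (prod_atlas M N) N snd p z = v"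
    using tpair_tangent[OF tangent_zero[OF M]] differential_snd[OF _ _ tangent_zero[OF M]]
    by (intro bexI[of _ "tpair M N p 0 v"]) (auto simp: carrier_prod)
qed

end

section \<open>The pair groupoid\<close>

lemma pair_groupoid_simps [simp]:
  "arrows (pair_groupoid M) = prod_atlas M M" "objects (pair_groupoid M) = M"
  "tgt (pair_groupoid M) = fst" "src (pair_groupoid M) = snd"
  "one (pair_groupoid M) = (\<lambda>x. (x, x))" "ginv (pair_groupoid M) = prod.swap"
  "mul (pair_groupoid M) = (\<lambda>g h. (fst g, snd h))"
  by (simp_all add: pair_groupoid_def)

context
  fixes M :: "('m::{t2_space, second_countable_topology}, 'e::model_space) atlas"
  assumes M: "manifold M"
begin

lemma smooth_map_swap: "smooth_map (prod_atlas M M) (prod_atlas M M) prod.swap"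
proof -
  note MM = manifold_prod[OF M M]
  have "prod.swap = (\<lambda>p::'m \<times> 'm. (snd p, fst p))" by auto
  then show ?thesis
    using smooth_map_Pair[OF MM M M open_carrier[OF MM] smooth_map_snd[OF M M] smooth_map_fst[OF M M]]
    by simp
qed

lemma smooth_map_diag: "smooth_map M (prod_atlas M M) (\<lambda>x. (x, x))"
  by (rule smooth_map_Pair[OF M M M open_carrier[OF M] smooth_map_ident[OF M] smooth_map_ident[OF M]])

text \<open>
  The product of composable pairs is the restriction of \<open>((a, b), (c, d)) \<mapsto> (a, d)\<close>, which is smooth
  on all pairs of arrows.
\<close>

lemma lie_groupoid_pair: "lie_groupoid (pair_groupoid M)"
proof -
  note MM = manifold_prod[OF M M]
  note MM2 = manifold_prod[OF MM MM]
  let ?C = "carrier (prod_atlas M M)"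
  have "smooth_map_on (prod_atlas (prod_atlas M M) (prod_atlas M M)) (prod_atlas M M) (?C \<times> ?C)
      (\<lambda>z. (fst (fst z), snd (snd z)))"
  proof (rule smooth_map_Pair[OF MM2 M M])
    show op: "open (?C \<times> ?C)" by (intro open_Times open_carrier[OF MM])
    show "smooth_map_on (prod_atlas (prod_atlas M M) (prod_atlas M M)) M (?C \<times> ?C) (\<lambda>z. fst (fst z))"
      by (rule smooth_map_on_compose[OF MM2 MM M op open_carrier[OF MM]
            smooth_map_fst[OF MM MM, unfolded carrier_prod[of "prod_atlas M M"]] smooth_map_fst[OF M M]])
         auto
    show "smooth_map_on (prod_atlas (prod_atlas M M) (prod_atlas M M)) M (?C \<times> ?C) (\<lambda>z. snd (snd z))"
      by (rule smooth_map_on_compose[OF MM2 MM M op open_carrier[OF MM]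
            smooth_map_snd[OF MM MM, unfolded carrier_prod[of "prod_atlas M M"]] smooth_map_snd[OF M M]])
         auto
  qed
  then have mul: "\<exists>S m. open S \<and> (g, h) \<in> S \<and> S \<subseteq> ?C \<times> ?C \<and>
      smooth_map_on (prod_atlas (prod_atlas M M) (prod_atlas M M)) (prod_atlas M M) S m \<and>
      (\<forall>(g', h')\<in>S. snd g' = fst h' \<longrightarrow> m (g', h') = (fst g', snd h'))"
    if "g \<in> ?C" "h \<in> ?C" for g h
    using that open_Times[OF open_carrier[OF MM] open_carrier[OF MM]]
    by (intro exI[of _ "?C \<times> ?C"] exI[of _ "\<lambda>z. (fst (fst z), snd (snd z))"]) auto
  show ?thesis
    unfolding lie_groupoid_def pair_groupoid_simps
  proof (intro conjI ballI impI)
    show "manifold (prod_atlas M M)" "manifold M" by (fact MM M)+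
    show "submersion (prod_atlas M M) M fst" "submersion (prod_atlas M M) M snd"
      by (fact submersion_fst[OF M M] submersion_snd[OF M M])+
    show "smooth_map M (prod_atlas M M) (\<lambda>x. (x, x))"
      "smooth_map (prod_atlas M M) (prod_atlas M M) prod.swap"
      by (fact smooth_map_diag smooth_map_swap)+
    show "\<exists>S m. open S \<and> (g, h) \<in> S \<and> S \<subseteq> ?C \<times> ?C \<and>
      smooth_map_on (prod_atlas (prod_atlas M M) (prod_atlas M M)) (prod_atlas M M) S m \<and>
      (\<forall>(g', h')\<in>S. snd g' = fst h' \<longrightarrow> m (g', h') = (fst g', snd h'))"
      if "g \<in> ?C" "h \<in> ?C" for g h using that by (rule mul)
  qed (auto simp: carrier_prod)
qed

lemma pair_section_eq:
  assumes x: "x \<in> carrier M" and v: "X x \<in> tangent M x"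
  shows "pair_section M X x = tpair M M (x, x) (X x) 0"
  unfolding pair_section_def
  by (simp only: differential_Pair[OF M M M smooth_map_ident[OF M] smooth_map_const[OF x] x]
        differential_ident[OF M x v] differential_const)

lemma pair_section_outside:
  assumes "x \<notin> carrier M"
  shows "pair_section M X x = 0"
proof
  fix k
  have "\<not> (k \<in> prod_atlas M M \<and> (x, x) \<in> cdom k)"
  proof
    assume "k \<in> prod_atlas M M \<and> (x, x) \<in> cdom k"
    then have "(x, x) \<in> carrier (prod_atlas M M)" unfolding carrier_def by blast
    then show False using assms by (simp add: carrier_prod)
  qed
  then show "pair_section M X x k = 0 k" by (simp add: pair_section_def differential_notin)
qed

lemma differential_swap:
  assumes a: "a \<in> carrier M" and b: "b \<in> carrier M" and v: "v \<in> tangent M a" and w: "w \<in> tangent M b"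
  shows "differential (prod_atlas M M) (prod_atlas M M) prod.swap (a, b) (tpair M M (a, b) v w)
    = tpair M M (b, a) w v"
proof -
  note MM = manifold_prod[OF M M]
  have sw: "prod.swap = (\<lambda>p::'m \<times> 'm. (snd p, fst p))" by auto
  have ab: "(a, b) \<in> carrier (prod_atlas M M)" using a b by (simp add: carrier_prod)
  show ?thesis
    unfolding sw differential_Pair[OF M M MM smooth_map_snd[OF M M] smooth_map_fst[OF M M] ab]
    by (simp only: differential_fst[OF M M a b v w] differential_snd[OF M M a b v w] fst_conv snd_conv)
qed

end

lemma smooth_fun_real_line: "smooth_fun real_line S f \<longleftrightarrow> smooth_on S f"
proof -
  have "cinv (Chart UNIV (\<lambda>x::real. x)) x = x" for x
    unfolding cinv_def chart.sel by (rule inv_into_f_f) auto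
  then show ?thesis by (simp add: smooth_fun_def real_line_def)
qed

lemma smooth_on_has_vector_derivative:
  fixes f :: "real \<Rightarrow> 'v::real_normed_vector"
  assumes "smooth_on S f" "x \<in> S"
  shows "(f has_vector_derivative vector_derivative f (at x)) (at x)"
  by (rule vector_derivative_works[THEN iffD1, OF smooth_on_imp_differentiable[OF assms]])

context
  fixes M :: "('m::{t2_space, second_countable_topology}, 'e::model_space) atlas"
  assumes M: "manifold M"
begin

text \<open>
  A straight line in one chart around \<open>a\<close> has, by the chain rule, the prescribed velocity in every chart.
\<close>

lemma ex_curve:
  assumes a: "a \<in> carrier M" and v: "v \<in> tangent M a"
  shows "\<exists>\<gamma> \<epsilon>. 0 < \<epsilon> \<and> smooth_map_on real_line M {-\<epsilon><..<\<epsilon>} \<gamma> \<and> \<gamma> 0 = a \<and>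
    (\<forall>d\<in>M. a \<in> cdom d \<longrightarrow> ((\<lambda>\<tau>. cmap d (\<gamma> \<tau>)) has_vector_derivative v d) (at 0))"
proof -
  obtain c where c: "c \<in> M" "a \<in> cdom c" using carrier_chart[OF a] by blast
  note cc = manifold_chart[OF M c(1)]
  let ?x = "cmap c a" and ?w = "v c"
  define l where "l = (\<lambda>\<tau>::real. ?x + \<tau> *\<^sub>R ?w)"
  have cl: "continuous_on UNIV l" unfolding l_def by (intro continuous_intros)
  have "open (l -` (cmap c ` cdom c))"
    using open_vimage[OF open_cmap_image[OF cc] cl] .
  moreover have "0 \<in> l -` (cmap c ` cdom c)" using c by (simp add: l_def)
  ultimately obtain \<epsilon> where \<epsilon>: "0 < \<epsilon>" "ball 0 \<epsilon> \<subseteq> l -` (cmap c ` cdom c)"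
    using open_contains_ball by blast
  define I where "I = {-\<epsilon><..<\<epsilon>}"
  have oI: "open I" by (simp add: I_def)
  have lI: "l \<tau> \<in> cmap c ` cdom c" if "\<tau> \<in> I" for \<tau>
  proof -
    have "\<tau> \<in> ball 0 \<epsilon>" using that by (auto simp: I_def dist_real_def)
    with \<epsilon>(2) show ?thesis by blast
  qed
  define \<gamma> where "\<gamma> = (\<lambda>\<tau>. cinv c (l \<tau>))"
  have \<gamma>I: "\<gamma> \<tau> \<in> cdom c" if "\<tau> \<in> I" for \<tau>
    unfolding \<gamma>_def by (rule cinv_in_cdom[OF cc lI[OF that]])
  have \<gamma>0: "\<gamma> 0 = a" by (simp add: \<gamma>_def l_def cinv_cmap[OF cc c(2)])
  have sl: "smooth_on I l" unfolding l_def
    by (intro smooth_on_add smooth_on_const smooth_on_scaleR smooth_on_ident oI)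
  have c\<gamma>: "continuous_on I \<gamma>" unfolding \<gamma>_def
    by (rule continuous_on_compose2[OF continuous_cinv[OF cc] continuous_on_subset[OF cl]])
       (use lI in auto)
  have "smooth_map_on real_line M I \<gamma>"
    unfolding smooth_map_on_iff smooth_fun_real_line
  proof (intro conjI ballI)
    show "\<gamma> ` I \<subseteq> carrier M" using \<gamma>I cdom_subset_carrier[OF c(1)] by auto
    show "continuous_on I \<gamma>" by (rule c\<gamma>)
    fix d assume d: "d \<in> M"
    note cd = manifold_chart[OF M d]
    have oJ: "open (I \<inter> \<gamma> -` cdom d)"
      using continuous_on_open_vimage[OF oI, THEN iffD1, OF c\<gamma>] open_cdom[OF cd]
      by (simp add: Int_commute)
    have "smooth_on (I \<inter> \<gamma> -` cdom d) (\<lambda>\<tau>. (cmap d \<circ> cinv c) (l \<tau>))"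
    proof (rule smooth_on_compose[where f = l and g = "cmap d \<circ> cinv c", OF _ _ _ oJ])
      show "smooth_on (I \<inter> \<gamma> -` cdom d) l" by (rule smooth_on_subset[OF sl]) simp
      show "smooth_on (cmap c ` (cdom c \<inter> cdom d)) (cmap d \<circ> cinv c)"
        using M c d by (simp add: manifold_def)
      show "l ` (I \<inter> \<gamma> -` cdom d) \<subseteq> cmap c ` (cdom c \<inter> cdom d)"
      proof
        fix y assume "y \<in> l ` (I \<inter> \<gamma> -` cdom d)"
        then obtain \<tau> where \<tau>: "\<tau> \<in> I" "\<gamma> \<tau> \<in> cdom d" "y = l \<tau>" by auto
        have "y = cmap c (\<gamma> \<tau>)" unfolding \<gamma>_def \<tau>(3) using cmap_cinv[OF cc lI[OF \<tau>(1)]] by simp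
        then show "y \<in> cmap c ` (cdom c \<inter> cdom d)" using \<gamma>I[OF \<tau>(1)] \<tau>(2) by blast
      qed
    qed
    then show "smooth_on (I \<inter> \<gamma> -` cdom d) (\<lambda>\<tau>. cmap d (\<gamma> \<tau>))" by (simp add: \<gamma>_def)
  qed
  moreover have "((\<lambda>\<tau>. cmap d (\<gamma> \<tau>)) has_vector_derivative v d) (at 0)"
    if d: "d \<in> M" "a \<in> cdom d" for d
  proof -
    have "smooth_on (cmap c ` (cdom c \<inter> cdom d)) (cmap d \<circ> cinv c)"
      using M c d by (simp add: manifold_def)
    then have "((cmap d \<circ> cinv c) has_derivative frechet_derivative (cmap d \<circ> cinv c) (at ?x)) (at ?x)"
      by (rule smooth_on_imp_has_derivative) (use c d in simp)
    then have der: "((cmap d \<circ> cinv c) has_derivative frechet_derivative (cmap d \<circ> cinv c) (at ?x))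
        (at (l 0))" by (simp add: l_def)
    have "(l has_derivative (\<lambda>\<tau>. \<tau> *\<^sub>R ?w)) (at 0)" unfolding l_def
      by (auto intro!: derivative_eq_intros)
    from has_derivative_compose[OF this der]
    have "((\<lambda>\<tau>. (cmap d \<circ> cinv c) (l \<tau>)) has_derivative
        (\<lambda>\<tau>. frechet_derivative (cmap d \<circ> cinv c) (at ?x) (\<tau> *\<^sub>R ?w))) (at 0)" .
    then show ?thesis
      unfolding has_vector_derivative_def tangentD(1)[OF v c(1) d(1) c(2) d(2)]
      by (simp add: \<gamma>_def linear_scale[OF transition_linear[OF M c(1) d(1) c(2) d(2)]])
  qed
  ultimately show ?thesis using \<epsilon>(1) \<gamma>0 unfolding I_def by blast
qed

text \<open>
  In \<open>M \<times> M\<close> a curve in the source fibre over \<open>a\<close> is a curve in the first factor, and translation by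
  \<open>(a, b)\<close> replaces the second component \<open>a\<close> by \<open>b\<close>.
\<close>

lemma right_translate_pair:
  assumes a: "a \<in> carrier M" and b: "b \<in> carrier M" and v: "v \<in> tangent M a"
  shows "right_translate (pair_groupoid M) (a, b) (tpair M M (a, a) v 0) = tpair M M (a, b) v 0"
proof -
  have trans: "velocity (prod_atlas M M) (\<lambda>\<tau>. (\<gamma> \<tau>, b)) 0 = tpair M M (a, b) v 0"
    if "\<gamma> 0 = a" and der: "\<And>d. d \<in> M \<Longrightarrow> a \<in> cdom d \<Longrightarrow>
      ((\<lambda>\<tau>. cmap d (\<gamma> \<tau>)) has_vector_derivative v d) (at 0)" for \<gamma> b
  proof (rule tpair_eqI)
    fix k assume "\<not> (k \<in> prod_atlas M M \<and> (a, b) \<in> cdom k)"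
    then show "velocity (prod_atlas M M) (\<lambda>\<tau>. (\<gamma> \<tau>, b)) 0 k = 0"
      by (simp only: velocity_def \<open>\<gamma> 0 = a\<close> if_False)
  next
    fix c d assume cd: "c \<in> M" "d \<in> M" "a \<in> cdom c" "b \<in> cdom d"
    have in_k: "pchart c d \<in> prod_atlas M M \<and> (a, b) \<in> cdom (pchart c d)"
      using cd by (simp add: pchart_in_prod_atlas)
    have "((\<lambda>\<tau>. (cmap c (\<gamma> \<tau>), cmap d b)) has_vector_derivative (v c, 0)) (at 0)"
      by (intro has_vector_derivative_Pair der cd has_vector_derivative_const)
    then have "vector_derivative (\<lambda>\<tau>. (cmap c (\<gamma> \<tau>), cmap d b)) (at 0) = (v c, 0)"
      by (rule vector_derivative_at)
    moreover have "cmap (pchart c d) \<circ> (\<lambda>\<tau>. (\<gamma> \<tau>, b)) = (\<lambda>\<tau>. (cmap c (\<gamma> \<tau>), cmap d b))" by auto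
    ultimately show "velocity (prod_atlas M M) (\<lambda>\<tau>. (\<gamma> \<tau>, b)) 0 (pchart c d) = (v c, 0 d)"
      by (simp only: velocity_def \<open>\<gamma> 0 = a\<close> in_k simp_thms if_True zero_fun_apply)
  qed
  show ?thesis
    unfolding right_translate_def pair_groupoid_simps fst_conv snd_conv
  proof (rule the_equality)
    from ex_curve[OF a v] obtain \<gamma> \<epsilon> where \<gamma>: "0 < \<epsilon>" "smooth_map_on real_line M {-\<epsilon><..<\<epsilon>} \<gamma>" "\<gamma> 0 = a"
      "\<And>d. d \<in> M \<Longrightarrow> a \<in> cdom d \<Longrightarrow> ((\<lambda>\<tau>. cmap d (\<gamma> \<tau>)) has_vector_derivative v d) (at 0)"
      by blast
    have R: "manifold real_line"
      by (auto simp: manifold_def real_line_def is_chart_def homeomorphism_def cinv_def o_def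
            inv_into_f_f[of "\<lambda>x. x"] smooth_on_ident)
    have "smooth_map_on real_line (prod_atlas M M) {-\<epsilon><..<\<epsilon>} (\<lambda>\<tau>. (\<gamma> \<tau>, a))"
      by (rule smooth_map_Pair[OF R M M _ \<gamma>(2) smooth_map_const[OF a]]) simp
    moreover have "velocity (prod_atlas M M) (\<lambda>\<tau>. (\<gamma> \<tau>, a)) 0 = tpair M M (a, a) v 0"
      by (rule trans[OF \<gamma>(3,4)])
    moreover have "velocity (prod_atlas M M) (\<lambda>\<tau>. (\<gamma> \<tau>, b)) 0 = tpair M M (a, b) v 0"
      by (rule trans[OF \<gamma>(3,4)])
    ultimately show "\<exists>\<gamma> \<epsilon>. 0 < \<epsilon> \<and> smooth_map_on real_line (prod_atlas M M) {-\<epsilon><..<\<epsilon>} \<gamma> \<and>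
        (\<forall>\<tau>\<in>{-\<epsilon><..<\<epsilon>}. snd (\<gamma> \<tau>) = a) \<and> \<gamma> 0 = (a, a) \<and>
        velocity (prod_atlas M M) \<gamma> 0 = tpair M M (a, a) v 0 \<and>
        tpair M M (a, b) v 0 = velocity (prod_atlas M M) (\<lambda>\<tau>. (fst (\<gamma> \<tau>), b)) 0"
      using \<gamma>(1,3) by (intro exI[of _ "\<lambda>\<tau>. (\<gamma> \<tau>, a)"] exI[of _ \<epsilon>]) simp
  next
    fix w assume "\<exists>\<gamma> \<epsilon>. 0 < \<epsilon> \<and> smooth_map_on real_line (prod_atlas M M) {-\<epsilon><..<\<epsilon>} \<gamma> \<and>
        (\<forall>\<tau>\<in>{-\<epsilon><..<\<epsilon>}. snd (\<gamma> \<tau>) = a) \<and> \<gamma> 0 = (a, a) \<and>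
        velocity (prod_atlas M M) \<gamma> 0 = tpair M M (a, a) v 0 \<and>
        w = velocity (prod_atlas M M) (\<lambda>\<tau>. (fst (\<gamma> \<tau>), b)) 0"
    then obtain \<gamma> \<epsilon> where \<gamma>: "0 < \<epsilon>" "smooth_map_on real_line (prod_atlas M M) {-\<epsilon><..<\<epsilon>} \<gamma>"
      "\<gamma> 0 = (a, a)" "velocity (prod_atlas M M) \<gamma> 0 = tpair M M (a, a) v 0"
      "w = velocity (prod_atlas M M) (\<lambda>\<tau>. (fst (\<gamma> \<tau>), b)) 0" by (elim exE conjE)
    have "((\<lambda>\<tau>. cmap d (fst (\<gamma> \<tau>))) has_vector_derivative v d) (at 0)"
      if d: "d \<in> M" "a \<in> cdom d" for d
    proof -
      let ?k = "pchart d d"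
      have k: "?k \<in> prod_atlas M M" "\<gamma> 0 \<in> cdom ?k"
        using d \<gamma>(3) by (simp_all add: pchart_in_prod_atlas)
      have "smooth_on ({-\<epsilon><..<\<epsilon>} \<inter> \<gamma> -` cdom ?k) (\<lambda>\<tau>. cmap ?k (\<gamma> \<tau>))"
        using \<gamma>(2) k(1) unfolding smooth_map_on_iff smooth_fun_real_line by blast
      moreover have "0 \<in> {-\<epsilon><..<\<epsilon>} \<inter> \<gamma> -` cdom ?k" using \<gamma>(1) k(2) by simp
      ultimately have "((\<lambda>\<tau>. cmap ?k (\<gamma> \<tau>)) has_vector_derivative
          vector_derivative (\<lambda>\<tau>. cmap ?k (\<gamma> \<tau>)) (at 0)) (at 0)"
        by (rule smooth_on_has_vector_derivative)
      also have "vector_derivative (\<lambda>\<tau>. cmap ?k (\<gamma> \<tau>)) (at 0) = velocity (prod_atlas M M) \<gamma> 0 ?k"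
        using k by (simp add: velocity_def o_def)
      also have "\<dots> = (v d, 0)"
        unfolding \<gamma>(4) tpair_pchart[OF d(1,1) d(2,2)] by simp
      finally have "((\<lambda>\<tau>. fst (cmap ?k (\<gamma> \<tau>))) has_vector_derivative fst (v d, 0::'e)) (at 0)"
        by (rule bounded_linear.has_vector_derivative[OF bounded_linear_fst])
      then show ?thesis by simp
    qed
    with \<gamma>(3) show "w = tpair M M (a, b) v 0" unfolding \<gamma>(5) by (intro trans) simp_all
  qed
qed

lemma right_invariant_pair:
  assumes X: "X \<in> vector_fields M (carrier M)" and a: "a \<in> carrier M" and b: "b \<in> carrier M"
  shows "right_invariant (pair_groupoid M) (pair_section M X) (a, b) = tpair M M (a, b) (X a) 0"
proof -
  have v: "X a \<in> tangent M a" using X a by (simp add: vector_fields_iff)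
  show ?thesis
    using a b by (simp add: right_invariant_def carrier_prod pair_section_eq[where X = X, OF M a v]
        right_translate_pair[OF a b v])
qed

text \<open>
  The inversion exchanges the factors, and the sign is the one in the definition of left-invariant fields.
\<close>

lemma left_invariant_pair:
  assumes X: "X \<in> vector_fields M (carrier M)" and a: "a \<in> carrier M" and b: "b \<in> carrier M"
  shows "left_invariant (pair_groupoid M) (pair_section M X) (a, b) = tpair M M (a, b) 0 (- X b)"
proof -
  have v: "X b \<in> tangent M b" using X b by (simp add: vector_fields_iff)
  have "left_invariant (pair_groupoid M) (pair_section M X) (a, b) = - tpair M M (a, b) 0 (X b)"
    using a b by (simp add: left_invariant_def carrier_prod right_invariant_pair[OF X]
        differential_swap[OF M b a v tangent_zero[OF M]])
  also have "\<dots> = tpair M M (a, b) 0 (- X b)"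
    using tpair_minus[of M M "(a, b)" 0 "X b"] by simp
  finally show ?thesis .
qed

end

section \<open>A singular foliation as a singular subalgebroid\<close>

context
  fixes M :: "('m::{t2_space, second_countable_topology}, 'e::model_space) atlas"
  assumes M: "manifold M"
begin

lemma pair_section_add:
  assumes "\<And>x. x \<in> carrier M \<Longrightarrow> X x \<in> tangent M x" "\<And>x. x \<in> carrier M \<Longrightarrow> Y x \<in> tangent M x"
  shows "pair_section M (X + Y) = pair_section M X + pair_section M Y"
proof
  fix x show "pair_section M (X + Y) x = (pair_section M X + pair_section M Y) x"
  proof (cases "x \<in> carrier M")
    case True
    have XY: "(X + Y) x = X x + Y x" by (rule plus_fun_apply)
    have t: "(X + Y) x \<in> tangent M x"
      unfolding XY by (rule tangent_add[OF M assms[OF True]])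
    have "pair_section M (X + Y) x = tpair M M (x, x) (X x + Y x) (0 + 0)"
      using pair_section_eq[where X = "X + Y", OF M True t] unfolding XY add_0 .
    also have "\<dots> = pair_section M X x + pair_section M Y x"
      unfolding tpair_add pair_section_eq[where X = X, OF M True assms(1)[OF True]]
        pair_section_eq[where X = Y, OF M True assms(2)[OF True]] ..
    also have "\<dots> = (pair_section M X + pair_section M Y) x" by (rule plus_fun_apply[symmetric])
    finally show ?thesis .
  qed (simp add: pair_section_outside[OF M])
qed

lemma pair_section_scale:
  assumes "\<And>x. x \<in> carrier M \<Longrightarrow> X x \<in> tangent M x"
  shows "pair_section M (f \<cdot> X) = f \<cdot> pair_section M X"
proof
  fix x show "pair_section M (f \<cdot> X) x = (f \<cdot> pair_section M X) x"
  proof (cases "x \<in> carrier M")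
    case True
    have "(f \<cdot> X) x \<in> tangent M x"
      unfolding fscale_apply by (rule tangent_scale[OF M assms[OF True]])
    moreover have "tscale (f x) 0 = (0 :: ('m, 'e) tvec)" by (simp add: fun_eq_iff)
    ultimately show ?thesis
      using tpair_scale[of M M "(x, x)" "f x" "X x" 0]
      by (simp only: fscale_apply pair_section_eq[where X = "f \<cdot> X", OF M True]
            pair_section_eq[where X = X, OF M True assms[OF True]])
  next
    case False
    then show ?thesis by (simp add: pair_section_outside[OF M] fscale_apply fun_eq_iff)
  qed
qed

lemma pair_section_zero: "pair_section M 0 = 0"
proof
  fix x show "pair_section M 0 x = 0 x"
    using pair_section_eq[where X = 0, OF M, of x] pair_section_outside[OF M, of x 0] tangent_zero[OF M]
      tpair_zero[of M M "(x, x)"] by (cases "x \<in> carrier M") simp_all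
qed

lemma pair_section_sum:
  assumes "\<And>j x. j < (n::nat) \<Longrightarrow> x \<in> carrier M \<Longrightarrow> X j x \<in> tangent M x"
  shows "pair_section M (\<Sum>j<n. X j) = (\<Sum>j<n. pair_section M (X j)) \<and>
    (\<forall>x\<in>carrier M. (\<Sum>j<n. X j) x \<in> tangent M x)"
  using assms
proof (induction n)
  case 0
  have e: "(\<Sum>j<0. X j) = 0" "(\<Sum>j<0. pair_section M (X j)) = 0"
    by (simp_all only: lessThan_0 sum.empty)
  have "0 x \<in> tangent M x" for x using tangent_zero[OF M, of x] by (simp add: zero_fun_def)
  then show ?case unfolding e using pair_section_zero by blast
next
  case (Suc n)
  have IH: "pair_section M (\<Sum>j<n. X j) = (\<Sum>j<n. pair_section M (X j))"
    "\<And>x. x \<in> carrier M \<Longrightarrow> (\<Sum>j<n. X j) x \<in> tangent M x"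
    using Suc.IH Suc.prems by (auto simp: less_Suc_eq)
  have X: "x \<in> carrier M \<Longrightarrow> X n x \<in> tangent M x" for x using Suc.prems by simp
  have "((\<Sum>j<n. X j) + X n) x \<in> tangent M x" if "x \<in> carrier M" for x
    unfolding plus_fun_apply[of "\<Sum>j<n. X j" "X n" x] by (rule tangent_add[OF M IH(2)[OF that] X[OF that]])
  moreover have "pair_section M ((\<Sum>j<n. X j) + X n) = (\<Sum>j<n. pair_section M (X j)) + pair_section M (X n)"
    unfolding IH(1)[symmetric] by (rule pair_section_add[OF IH(2) X])
  ultimately show ?case unfolding sum.lessThan_Suc by blast
qed

lemma vector_field_tangent:
  "X \<in> vector_fields M W \<Longrightarrow> X x \<in> tangent M x"
  by (cases "x \<in> W") (simp_all add: vector_fields_iff tangent_zero[OF M])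

lemma pair_section_eq_0_iff:
  assumes "X \<in> vector_fields M W" "W \<subseteq> carrier M"
  shows "pair_section M X x = 0 \<longleftrightarrow> X x = 0"
proof (cases "x \<in> carrier M")
  case True
  have eq: "pair_section M X x = tpair M M (x, x) (X x) 0"
    by (rule pair_section_eq[where X = X, OF M True vector_field_tangent[OF assms(1)]])
  show ?thesis
  proof
    assume "pair_section M X x = 0"
    then have "tpair M M (x, x) (X x) 0 = tpair M M (x, x) 0 0" by (simp add: eq tpair_zero)
    then show "X x = 0"
      using tpair_inject[OF M M vector_field_tangent[OF assms(1)] tangent_zero[OF M] tangent_zero[OF M]
          tangent_zero[OF M] True True] by blast
  qed (simp add: eq tpair_zero)
next
  case False
  then show ?thesis using assms by (auto simp: pair_section_outside[OF M] vector_fields_iff)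
qed

lemma supp_pair_section:
  assumes "X \<in> vector_fields M W" "W \<subseteq> carrier M"
  shows "supp (pair_section M X) = supp X"
  unfolding supp_def by (simp add: pair_section_eq_0_iff[OF assms])

lemma pair_section_lie_section:
  assumes X: "X \<in> vector_fields M W" and W: "open W" "W \<subseteq> carrier M"
  shows "pair_section M X \<in> lie_sections (pair_groupoid M) W"
proof -
  note tan = vector_field_tangent[OF X]
  have eq: "pair_section M X x = tpair M M (x, x) (X x) 0" if "x \<in> W" for x
    by (rule pair_section_eq[where X = X, OF M _ tan]) (use that W in blast)
  have "pair_section M X \<in> fields_along M (prod_atlas M M) (\<lambda>x. (x, x)) W"
    unfolding fields_along_iff
  proof (intro conjI ballI allI impI)
    show "pair_section M X x \<in> tangent (prod_atlas M M) (x, x)" if "x \<in> W" for x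
      unfolding eq[OF that] by (rule tpair_tangent[OF M M tan tangent_zero[OF M]])
    show "pair_section M X x = 0" if "x \<notin> W" for x
      using X that unfolding pair_section_eq_0_iff[OF X W(2)] by (simp add: vector_fields_iff)
    fix k assume "k \<in> prod_atlas M M"
    then obtain c d where c: "c \<in> M" and d: "d \<in> M" and k: "k = pchart c d" by (rule prod_atlasE)
    let ?T = "W \<inter> (\<lambda>x. (x, x)) -` cdom k"
    have T: "?T = W \<inter> cdom c \<inter> cdom d" by (auto simp: k)
    have oT: "open ?T" unfolding T
      by (intro open_Int W open_cdom manifold_chart[OF M c] manifold_chart[OF M d])
    have "smooth_fun M ?T (\<lambda>x. X x c)"
      by (rule smooth_fun_subset[of M "W \<inter> cdom c"]) (use X c in \<open>auto simp: vector_fields_iff k\<close>)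
    then have "smooth_fun M ?T (\<lambda>x. (X x c, 0 :: 'e))"
      by (rule smooth_fun_Pair[OF M oT _ smooth_fun_const])
    then show "smooth_fun M ?T (\<lambda>x. pair_section M X x k)"
    proof (rule smooth_fun_cong[OF M oT, THEN iffD1, rotated])
      fix x assume "x \<in> ?T"
      then have x: "x \<in> W" "x \<in> cdom c" "x \<in> cdom d" by (auto simp: k)
      show "(X x c, 0) = pair_section M X x k"
        unfolding eq[OF x(1)] k tpair_pchart[OF c d x(2,3)] by simp
    qed
  qed
  moreover have "differential (prod_atlas M M) M snd (x, x) (pair_section M X x) = 0" if "x \<in> W" for x
    unfolding eq[OF that]
    by (rule differential_snd[OF M M _ _ tan tangent_zero[OF M]]) (use that W in blast)+
  ultimately show ?thesis by (simp add: lie_sections_def)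
qed

text \<open>In a product chart \<open>(X, 0)\<close> is \<open>(x, y) \<mapsto> (X x, 0)\<close>, so both terms of the bracket split.\<close>

lemma algebroid_bracket_pair:
  assumes X: "X \<in> vector_fields M (carrier M)" and Y: "Y \<in> vector_fields M (carrier M)"
    and L: "lie_bracket M X Y \<in> vector_fields M (carrier M)"
  shows "algebroid_bracket (pair_groupoid M) (pair_section M X) (pair_section M Y)
    = pair_section M (lie_bracket M X Y)"
proof
  fix x
  show "algebroid_bracket (pair_groupoid M) (pair_section M X) (pair_section M Y) x
    = pair_section M (lie_bracket M X Y) x"
  proof (cases "x \<in> carrier M")
    case False
    then show ?thesis by (simp add: algebroid_bracket_def pair_section_outside[OF M])
  next
    case True
    define R where "R = (\<lambda>X. right_invariant (pair_groupoid M) (pair_section M X))"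
    have R: "R Z (a, b) (pchart c d) = (Z a c, 0)"
      if "Z \<in> vector_fields M (carrier M)" "c \<in> M" "d \<in> M" "a \<in> cdom c" "b \<in> cdom d" for Z a b c d
    proof -
      have "a \<in> carrier M" "b \<in> carrier M" using that by (auto simp: carrier_def)
      then show ?thesis
        unfolding R_def by (simp add: right_invariant_pair[OF M that(1)] tpair_pchart[OF that(2-5)])
    qed
    have DR: "frechet_derivative (\<lambda>z. R Z (cinv (pchart c d) z) (pchart c d)) (at (cmap c x, cmap d x)) (v, w)
        = (frechet_derivative (\<lambda>y. Z (cinv c y) c) (at (cmap c x)) v, 0)"
      if Z: "Z \<in> vector_fields M (carrier M)" and cd: "c \<in> M" "d \<in> M" "x \<in> cdom c" "x \<in> cdom d"
      for Z c d v w
    proof -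
      note cc = manifold_chart[OF M cd(1)] and cd' = manifold_chart[OF M cd(2)]
      let ?S = "cmap c ` cdom c \<times> cmap d ` cdom d"
      have "frechet_derivative (\<lambda>z. R Z (cinv (pchart c d) z) (pchart c d)) (at (cmap c x, cmap d x)) (v, w)
        = (frechet_derivative (\<lambda>y. Z (cinv c y) c) (at (cmap c x)) v,
           frechet_derivative (\<lambda>y. 0 :: 'e) (at (cmap d x)) w)"
      proof (rule frechet_derivative_product_map)
        show "open ?S" by (intro open_Times open_cmap_image cc cd')
        show "(cmap c x, cmap d x) \<in> ?S" using cd by simp
        show "R Z (cinv (pchart c d) z) (pchart c d) = (Z (cinv c (fst z)) c, 0)" if "z \<in> ?S" for z
        proof -
          have z: "fst z \<in> cmap c ` cdom c" "snd z \<in> cmap d ` cdom d" using that by auto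
          have "cinv (pchart c d) z = (cinv c (fst z), cinv d (snd z))"
            using cinv_pchart[OF cc cd' z] by simp
          then show ?thesis
            using R[OF Z cd(1,2) cinv_in_cdom[OF cc z(1)] cinv_in_cdom[OF cd' z(2)]] by simp
        qed
        have "smooth_fun M (carrier M \<inter> cdom c) (\<lambda>p. Z p c)" using Z cd by (simp add: vector_fields_iff)
        then have "smooth_on (cmap c ` (cdom c \<inter> (carrier M \<inter> cdom c))) (\<lambda>y. Z (cinv c y) c)"
          using cd(1) by (rule smooth_fun_chart_rep)
        then show "(\<lambda>y. Z (cinv c y) c) differentiable at (cmap c x)"
          by (rule smooth_on_imp_differentiable) (use cd True in simp)
        show "(\<lambda>y. 0 :: 'e) differentiable at (cmap d x)" by simp
      qed
      then show ?thesis by simp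
    qed
    have "lie_bracket (prod_atlas M M) (R X) (R Y) (x, x) = tpair M M (x, x) (lie_bracket M X Y x) 0"
    proof (rule tpair_eqI)
      fix k assume "\<not> (k \<in> prod_atlas M M \<and> (x, x) \<in> cdom k)"
      then show "lie_bracket (prod_atlas M M) (R X) (R Y) (x, x) k = 0"
        by (simp only: lie_bracket_def if_False)
    next
      fix c d assume cd: "c \<in> M" "d \<in> M" "x \<in> cdom c" "x \<in> cdom d"
      then have in_k: "pchart c d \<in> prod_atlas M M \<and> (x, x) \<in> cdom (pchart c d)"
        by (simp add: pchart_in_prod_atlas)
      have cm: "cmap (pchart c d) (x, x) = (cmap c x, cmap d x)" by simp
      show "lie_bracket (prod_atlas M M) (R X) (R Y) (x, x) (pchart c d) = (lie_bracket M X Y x c, 0 d)"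
        unfolding lie_bracket_def
        by (simp only: in_k cd simp_thms if_True cm R[OF X cd] R[OF Y cd] DR[OF X cd] DR[OF Y cd]
              diff_Pair diff_self zero_fun_apply)
    qed
    then show ?thesis
      using True pair_section_eq[where X = "lie_bracket M X Y", OF M True vector_field_tangent[OF L]]
      by (simp add: algebroid_bracket_def R_def)
  qed
qed

text \<open>
  The assignment \<open>X \<mapsto> (X, 0)\<close> is linear over the functions on \<open>M\<close>, compatible with the brackets and
  preserves supports, so it carries each property of \<open>F\<close>, generators included, over to its image.
\<close>

lemma singular_subalgebroid_pair:
  assumes F: "singular_foliation M F"
  shows "singular_subalgebroid (pair_groupoid M) (pair_section M ` F)"
proof -
  note oM = open_carrier[OF M]
  have FV: "X \<in> compact_sections M (vector_fields M)" if "X \<in> F" for X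
    using F that by (auto simp: singular_foliation_def)
  have vf: "X \<in> vector_fields M (carrier M)" if "X \<in> F" for X
    using FV[OF that] by (rule compact_fieldsD)
  have sub: "0 \<in> F" "X \<in> F \<Longrightarrow> Y \<in> F \<Longrightarrow> X + Y \<in> F" "f \<in> Cinf M (carrier M) \<Longrightarrow> X \<in> F \<Longrightarrow> f \<cdot> X \<in> F"
    for X Y f using F by (auto simp: singular_foliation_def submodule_def)
  have br: "lie_bracket M X Y \<in> F" if "X \<in> F" "Y \<in> F" for X Y
    using F that by (auto simp: singular_foliation_def)
  have tan: "X x \<in> tangent M x" if "X \<in> F" for X x by (rule vector_field_tangent[OF vf[OF that]])
  have "pair_section M ` F \<subseteq> compact_sections M (lie_sections (pair_groupoid M))"
  proof
    fix \<alpha> assume "\<alpha> \<in> pair_section M ` F"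
    then obtain X where X: "X \<in> F" "\<alpha> = pair_section M X" by blast
    show "\<alpha> \<in> compact_sections M (lie_sections (pair_groupoid M))"
      using pair_section_lie_section[OF vf[OF X(1)] oM subset_refl] compact_fieldsD(4,5)[OF FV[OF X(1)]]
      by (simp add: compact_sections_def X(2) supp_pair_section[OF vf[OF X(1)] subset_refl])
  qed
  moreover have "submodule M (pair_section M ` F)"
    unfolding submodule_def
  proof (intro conjI ballI)
    show "0 \<in> pair_section M ` F" using sub(1) pair_section_zero by (metis imageI)
    show "\<alpha> + \<beta> \<in> pair_section M ` F" if ab: "\<alpha> \<in> pair_section M ` F" "\<beta> \<in> pair_section M ` F" for \<alpha> \<beta>
    proof -
      obtain X Y where XY: "X \<in> F" "\<alpha> = pair_section M X" "Y \<in> F" "\<beta> = pair_section M Y"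
        using ab by blast
      have "\<alpha> + \<beta> = pair_section M (X + Y)"
        unfolding XY(2,4) by (rule pair_section_add[OF tan[OF XY(1)] tan[OF XY(3)], symmetric])
      then show ?thesis using sub(2)[OF XY(1,3)] by blast
    qed
    show "f \<cdot> \<alpha> \<in> pair_section M ` F" if fa: "f \<in> Cinf M (carrier M)" "\<alpha> \<in> pair_section M ` F" for f \<alpha>
    proof -
      obtain X where X: "X \<in> F" "\<alpha> = pair_section M X" using fa by blast
      have "f \<cdot> \<alpha> = pair_section M (f \<cdot> X)"
        unfolding X(2) by (rule pair_section_scale[OF tan[OF X(1)], symmetric])
      then show ?thesis using sub(3)[OF fa(1) X(1)] by blast
    qed
  qed
  moreover have "algebroid_bracket (pair_groupoid M) \<alpha> \<beta> \<in> pair_section M ` F"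
    if ab: "\<alpha> \<in> pair_section M ` F" "\<beta> \<in> pair_section M ` F" for \<alpha> \<beta>
  proof -
    obtain X Y where XY: "X \<in> F" "\<alpha> = pair_section M X" "Y \<in> F" "\<beta> = pair_section M Y"
      using ab by blast
    show ?thesis
      unfolding XY(2,4) algebroid_bracket_pair[OF vf[OF XY(1)] vf[OF XY(3)] vf[OF br[OF XY(1,3)]]]
      using br[OF XY(1,3)] by blast
  qed
  moreover have "locally_finitely_generated M (lie_sections (pair_groupoid M)) (pair_section M ` F)"
    unfolding locally_finitely_generated_def
  proof
    fix p assume p: "p \<in> carrier M"
    have "locally_finitely_generated M (vector_fields M) F" using F by (simp add: singular_foliation_def)
    from bspec[OF this[unfolded locally_finitely_generated_def] p]
    obtain W n and Y :: "nat \<Rightarrow> 'm \<Rightarrow> ('m, 'e) tvec" where W: "open W" "p \<in> W" "W \<subseteq> carrier M"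
      and Y: "\<forall>j<n. Y j \<in> vector_fields M W"
      and gen: "\<forall>f\<in>Cinf_c M W. \<forall>j<n. f \<cdot> Y j \<in> {Z \<in> F. supp Z \<subseteq> W}"
      and span: "\<forall>Z\<in>{Z \<in> F. supp Z \<subseteq> W}. \<exists>f. (\<forall>j<n. f j \<in> Cinf_c M W) \<and> Z = (\<Sum>j<n. f j \<cdot> Y j)"
      by (elim exE conjE)
    have tanY: "Y j x \<in> tangent M x" if "j < n" for j x
      by (rule vector_field_tangent) (use Y that in blast)
    have "pair_section M (Y j) \<in> lie_sections (pair_groupoid M) W" if "j < n" for j
      by (rule pair_section_lie_section[OF _ W(1,3)]) (use Y that in blast)
    moreover have "f \<cdot> pair_section M (Y j) \<in> {Z \<in> pair_section M ` F. supp Z \<subseteq> W}"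
      if f: "f \<in> Cinf_c M W" and j: "j < n" for f j
    proof -
      have Z: "f \<cdot> Y j \<in> F" "supp (f \<cdot> Y j) \<subseteq> W" using gen f j by auto
      have "f \<cdot> pair_section M (Y j) = pair_section M (f \<cdot> Y j)"
        by (rule pair_section_scale[OF tanY[OF j], symmetric])
      then show ?thesis using Z supp_pair_section[OF vf[OF Z(1)] subset_refl] by auto
    qed
    moreover have "\<exists>f. (\<forall>j<n. f j \<in> Cinf_c M W) \<and> Z = (\<Sum>j<n. f j \<cdot> pair_section M (Y j))"
      if Z: "Z \<in> {Z \<in> pair_section M ` F. supp Z \<subseteq> W}" for Z
    proof -
      obtain X where X: "X \<in> F" "Z = pair_section M X" using Z by blast
      have "supp X \<subseteq> W" using Z supp_pair_section[OF vf[OF X(1)] subset_refl] X(2) by simp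
      then obtain f where f: "\<forall>j<n. f j \<in> Cinf_c M W" "X = (\<Sum>j<n. f j \<cdot> Y j)"
        using span X(1) by blast
      have "Z = (\<Sum>j<n. pair_section M (f j \<cdot> Y j))"
        unfolding X(2) f(2)
        by (rule pair_section_sum[THEN conjunct1]) (simp only: fscale_apply tangent_scale[OF M tanY])
      also have "\<dots> = (\<Sum>j<n. f j \<cdot> pair_section M (Y j))"
        by (rule sum.cong[OF refl]) (simp only: lessThan_iff pair_section_scale[OF tanY])
      finally show ?thesis using f(1) by blast
    qed
    ultimately show "\<exists>W. open W \<and> p \<in> W \<and> W \<subseteq> carrier M \<and>
     (\<exists>n. \<exists>Y :: nat \<Rightarrow> 'm \<Rightarrow> ('m \<times> 'm, 'e \<times> 'e) tvec. (\<forall>j<n. Y j \<in> lie_sections (pair_groupoid M) W) \<and>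
        (\<forall>f\<in>Cinf_c M W. \<forall>j<n. f \<cdot> Y j \<in> {Z \<in> pair_section M ` F. supp Z \<subseteq> W}) \<and>
        (\<forall>Z\<in>{Z \<in> pair_section M ` F. supp Z \<subseteq> W}.
           \<exists>f. (\<forall>j<n. f j \<in> Cinf_c M W) \<and> Z = (\<Sum>j<n. f j \<cdot> Y j)))"
      using W by (intro exI[of _ W] conjI exI[of _ n] exI[of _ "\<lambda>j. pair_section M (Y j)"]) auto
  qed
  ultimately show ?thesis unfolding singular_subalgebroid_def pair_groupoid_simps by blast
qed

end

section \<open>Pull-back modules\<close>

lemma Cinf_c_span_zero: "0 \<in> Cinf_c_span A E"
  unfolding Cinf_c_span_def
  by (rule CollectI, rule exI[of _ 0]) simp

lemma Cinf_c_span_generator: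
  assumes "f \<in> Cinf_c A (carrier A)" "Y \<in> E"
  shows "f \<cdot> Y \<in> Cinf_c_span A E"
  unfolding Cinf_c_span_def
  by (rule CollectI, rule exI[of _ "Suc 0"], rule exI[of _ "\<lambda>_. f"], rule exI[of _ "\<lambda>_. Y"])
     (use assms in \<open>simp del: sum.lessThan_Suc add: lessThan_Suc\<close>)

lemma Cinf_c_span_induct [consumes 1, case_names zero add gen]:
  assumes S: "S \<in> Cinf_c_span A E"
    and zero: "P 0" and add: "\<And>S T. P S \<Longrightarrow> P T \<Longrightarrow> P (S + T)"
    and gen: "\<And>f Y. f \<in> Cinf_c A (carrier A) \<Longrightarrow> Y \<in> E \<Longrightarrow> P (f \<cdot> Y)"
  shows "P S"
proof -
  obtain n :: nat and f Y where S': "S = (\<Sum>i<n. f i \<cdot> Y i)"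
    and fY: "\<forall>i<n. f i \<in> Cinf_c A (carrier A) \<and> Y i \<in> E"
    using S unfolding Cinf_c_span_def mem_Collect_eq by (elim exE conjE)
  have "P (\<Sum>i<m. f i \<cdot> Y i)" if "m \<le> n" for m
    using that
  proof (induction m)
    case 0
    show ?case unfolding lessThan_0 sum.empty by (rule zero)
  next
    case (Suc m)
    then show ?case unfolding sum.lessThan_Suc using fY by (intro add gen) auto
  qed
  then show ?thesis unfolding S' by simp
qed

lemma Cinf_c_span_add:
  assumes "S \<in> Cinf_c_span A E" "T \<in> Cinf_c_span A E"
  shows "S + T \<in> Cinf_c_span A E"
proof -
  obtain n :: nat and f Y where S: "S = (\<Sum>i<n. f i \<cdot> Y i)" "\<forall>i<n. f i \<in> Cinf_c A (carrier A) \<and> Y i \<in> E"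
    using assms(1) unfolding Cinf_c_span_def mem_Collect_eq by (elim exE conjE)
  obtain m :: nat and g Z where T: "T = (\<Sum>i<m. g i \<cdot> Z i)" "\<forall>i<m. g i \<in> Cinf_c A (carrier A) \<and> Z i \<in> E"
    using assms(2) unfolding Cinf_c_span_def mem_Collect_eq by (elim exE conjE)
  define h where "h = (\<lambda>i. if i < n then f i else g (i - n))"
  define W where "W = (\<lambda>i. if i < n then Y i else Z (i - n))"
  have "(\<Sum>i<n + m. h i \<cdot> W i) = (\<Sum>i<n. h i \<cdot> W i) + (\<Sum>i<m. h (n + i) \<cdot> W (n + i))"
    by (induction m) (simp_all only: sum.lessThan_Suc lessThan_0 sum.empty add_0_right add_Suc_right
        add.assoc)
  also have "(\<Sum>i<n. h i \<cdot> W i) = S"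
    unfolding S(1) by (rule sum.cong) (simp_all only: h_def W_def lessThan_iff if_True)
  also have "(\<Sum>i<m. h (n + i) \<cdot> W (n + i)) = T"
    unfolding T(1) by (rule sum.cong) (simp_all add: h_def W_def)
  finally have "S + T = (\<Sum>i<n + m. h i \<cdot> W i)" by (rule sym)
  moreover have "\<forall>i<n + m. h i \<in> Cinf_c A (carrier A) \<and> W i \<in> E"
    using S(2) T(2) by (auto simp: h_def W_def)
  ultimately show ?thesis unfolding Cinf_c_span_def by blast
qed

text \<open>
  A pull-back module in terms of a span, for which closure properties and an induction principle are at hand.
\<close>

lemma pullback_iff:
  "X \<in> pullback U V \<phi> F \<longleftrightarrow> X \<in> compact_sections U (vector_fields U) \<and>
     (\<exists>S\<in>Cinf_c_span U ((\<lambda>Y. Y \<circ> \<phi>) ` F). \<forall>p\<in>carrier U. differential U V \<phi> p (X p) = S p)"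
proof -
  have "(\<exists>(n::nat) f Y. (\<forall>i<n. f i \<in> Cinf_c U (carrier U) \<and> Y i \<in> F) \<and> P (\<Sum>i<n. f i \<cdot> (Y i \<circ> \<phi>)))
      \<longleftrightarrow> (\<exists>S\<in>Cinf_c_span U ((\<lambda>Y. Y \<circ> \<phi>) ` F). P S)" (is "?L \<longleftrightarrow> ?R") for P
  proof
    assume ?L
    then obtain n :: nat and f Y where *: "\<forall>i<n. f i \<in> Cinf_c U (carrier U) \<and> Y i \<in> F"
      "P (\<Sum>i<n. f i \<cdot> (Y i \<circ> \<phi>))" by blast
    have "(\<Sum>i<n. f i \<cdot> (Y i \<circ> \<phi>)) \<in> Cinf_c_span U ((\<lambda>Y. Y \<circ> \<phi>) ` F)"
      unfolding Cinf_c_span_def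
      by (rule CollectI, rule exI[of _ n], rule exI[of _ f], rule exI[of _ "\<lambda>i. Y i \<circ> \<phi>"])
         (use *(1) in auto)
    with *(2) show ?R by blast
  next
    assume ?R
    then obtain n :: nat and f Y' where *: "\<forall>i<n. f i \<in> Cinf_c U (carrier U) \<and> Y' i \<in> (\<lambda>Y. Y \<circ> \<phi>) ` F"
      "P (\<Sum>i<n. f i \<cdot> Y' i)" unfolding Cinf_c_span_def by blast
    define Y where "Y = (\<lambda>i. SOME Y. Y \<in> F \<and> Y' i = Y \<circ> \<phi>)"
    have Y: "Y i \<in> F \<and> Y' i = Y i \<circ> \<phi>" if "i < n" for i
    proof -
      have "\<exists>Y. Y \<in> F \<and> Y' i = Y \<circ> \<phi>" using *(1) that by blast
      then show ?thesis unfolding Y_def by (rule someI_ex)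
    qed
    have "(\<Sum>i<n. f i \<cdot> Y' i) = (\<Sum>i<n. f i \<cdot> (Y i \<circ> \<phi>))"
      by (rule sum.cong[OF refl]) (simp only: lessThan_iff Y[THEN conjunct2])
    then have "P (\<Sum>i<n. f i \<cdot> (Y i \<circ> \<phi>))" using *(2) by argo
    moreover have "\<forall>i<n. f i \<in> Cinf_c U (carrier U) \<and> Y i \<in> F" using *(1) Y by blast
    ultimately show ?L by (intro exI conjI)
  qed
  from this[of "\<lambda>S. \<forall>p\<in>carrier U. differential U V \<phi> p (X p) = S p"]
  show ?thesis unfolding pullback_def by blast
qed

lemma kernel_fieldsD:
  "X \<in> kernel_fields U M \<phi> \<Longrightarrow> X \<in> compact_sections U (vector_fields U)"
  "X \<in> kernel_fields U M \<phi> \<Longrightarrow> p \<in> carrier U \<Longrightarrow> differential U M \<phi> p (X p) = 0"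
  by (simp_all add: kernel_fields_def)

lemma pullback_compact: "Z \<in> pullback U M \<phi> F \<Longrightarrow> Z \<in> compact_sections U (vector_fields U)"
  by (simp add: pullback_iff)

context
  fixes U :: "('u::{t2_space, second_countable_topology}, 'd::model_space) atlas"
    and M :: "('m::{t2_space, second_countable_topology}, 'e::model_space) atlas"
    and \<phi> :: "'u \<Rightarrow> 'm"
  assumes U: "manifold U" and \<phi>: "smooth_map U M \<phi>"
begin

lemma kernel_fields_zero: "0 \<in> kernel_fields U M \<phi>"
  unfolding kernel_fields_def
proof (intro CollectI conjI ballI)
  show "(0 :: 'u \<Rightarrow> ('u, 'd) tvec) \<in> compact_sections U (vector_fields U)" by (rule compact_fields_zero[OF U])
  show "differential U M \<phi> p ((0 :: 'u \<Rightarrow> ('u, 'd) tvec) p) = 0" if "p \<in> carrier U" for p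
    unfolding zero_fun_apply[of p] by (rule differential_zero[OF U \<phi> that])
qed

lemma kernel_fields_add:
  assumes "X \<in> kernel_fields U M \<phi>" "Y \<in> kernel_fields U M \<phi>"
  shows "X + Y \<in> kernel_fields U M \<phi>"
  unfolding kernel_fields_def
proof (intro CollectI conjI ballI)
  show "X + Y \<in> compact_sections U (vector_fields U)"
    by (rule compact_fields_add[OF U assms[THEN kernel_fieldsD(1)]])
  show "differential U M \<phi> p ((X + Y) p) = 0" if "p \<in> carrier U" for p
    unfolding plus_fun_apply[of X Y p] differential_add[OF U \<phi> that]
      kernel_fieldsD(2)[OF assms(1) that] kernel_fieldsD(2)[OF assms(2) that] by (rule add_0)
qed

lemma kernel_fields_minus:
  assumes "X \<in> kernel_fields U M \<phi>"
  shows "- X \<in> kernel_fields U M \<phi>"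
  unfolding kernel_fields_def
proof (intro CollectI conjI ballI)
  have "- X = (\<lambda>_. -1) \<cdot> X" by (simp add: fun_eq_iff fscale_apply)
  then show "- X \<in> compact_sections U (vector_fields U)"
    using compact_fields_scale[OF U smooth_fun_const kernel_fieldsD(1)[OF assms]] by metis
  show "differential U M \<phi> p ((- X) p) = 0" if "p \<in> carrier U" for p
    using differential_minus[OF U \<phi> that, of "X p"] kernel_fieldsD(2)[OF assms that] by simp
qed

lemma pullback_add:
  assumes "X \<in> pullback U M \<phi> F" "Y \<in> pullback U M \<phi> F"
  shows "X + Y \<in> pullback U M \<phi> F"
proof -
  obtain S where S: "S \<in> Cinf_c_span U ((\<lambda>Y. Y \<circ> \<phi>) ` F)"
      "\<And>p. p \<in> carrier U \<Longrightarrow> differential U M \<phi> p (X p) = S p"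
    using assms(1) unfolding pullback_iff by blast
  obtain T where T: "T \<in> Cinf_c_span U ((\<lambda>Y. Y \<circ> \<phi>) ` F)"
      "\<And>p. p \<in> carrier U \<Longrightarrow> differential U M \<phi> p (Y p) = T p"
    using assms(2) unfolding pullback_iff by blast
  have "differential U M \<phi> p ((X + Y) p) = (S + T) p" if p: "p \<in> carrier U" for p
    unfolding plus_fun_apply[of X Y p] plus_fun_apply[of S T p] differential_add[OF U \<phi> p]
      S(2)[OF p] T(2)[OF p] ..
  then show ?thesis
    using Cinf_c_span_add[OF S(1) T(1)]
      compact_fields_add[OF U pullback_compact[OF assms(1)] pullback_compact[OF assms(2)]]
    unfolding pullback_iff by blast
qed

lemma kernel_subset_pullback: "kernel_fields U M \<phi> \<subseteq> pullback U M \<phi> F"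
proof
  fix X assume X: "X \<in> kernel_fields U M \<phi>"
  have "differential U M \<phi> p (X p) = (0 :: 'u \<Rightarrow> ('m, 'e) tvec) p" if "p \<in> carrier U" for p
    unfolding zero_fun_apply[of p] by (rule kernel_fieldsD(2)[OF X that])
  then show "X \<in> pullback U M \<phi> F"
    using kernel_fieldsD(1)[OF X] Cinf_c_span_zero unfolding pullback_iff by blast
qed

end

text \<open>
  Along \<open>\<phi>\<close> the fields in \<open>E\<close> are the \<open>K (X \<circ> r)\<close> with \<open>X\<close> in \<open>F\<close>, and \<open>d\<phi>(Z) = K v\<close> means \<open>dr(Z) = v\<close> and
  \<open>do'(Z) = 0\<close>. For \<open>\<phi> = (t, s)\<close> this applies to the right-invariant fields with \<open>K v = (v, 0)\<close>, \<open>r = t\<close>,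
  \<open>o' = s\<close>, and to the left-invariant ones with \<open>K v = (0, v)\<close> and \<open>t\<close>, \<open>s\<close> exchanged. A combination of
  the fields in \<open>E\<close> with coefficients on \<open>U\<close> and on \<open>N\<close> becomes one of the \<open>X \<circ> r\<close> by composing the
  latter coefficients with \<open>\<phi>\<close>. Conversely the fields in \<open>E\<close> need not be compactly supported combinations
  themselves, but a coefficient \<open>f\<close> on \<open>U\<close> only sees them on the compact set \<open>\<phi> (supp f)\<close>, where a cut-off
  function on \<open>N\<close> is 1.
\<close>

lemma pullback_invariant_span:
  fixes U :: "('u::{t2_space, second_countable_topology}, 'd::model_space) atlas"
    and N :: "('n::{t2_space, second_countable_topology}, 'f::model_space) atlas"
    and M :: "('m::{t2_space, second_countable_topology}, 'e::model_space) atlas"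
    and K :: "'u \<Rightarrow> ('m, 'e) tvec \<Rightarrow> ('n, 'f) tvec"
  assumes U: "manifold U" and N: "manifold N" and M: "manifold M"
    and \<phi>: "smooth_map U N \<phi>" and r: "smooth_map U M r"
    and F: "\<And>X p. X \<in> F \<Longrightarrow> p \<in> carrier M \<Longrightarrow> X p \<in> tangent M p"
    and K0: "\<And>p. K p 0 = 0" and Kadd: "\<And>p v w. K p (v + w) = K p v + K p w"
    and Kscale: "\<And>p c v. K p (tscale c v) = tscale c (K p v)"
    and K: "\<And>p v z. p \<in> carrier U \<Longrightarrow> v \<in> tangent M (r p) \<Longrightarrow> z \<in> tangent U p \<Longrightarrow>
      differential U N \<phi> p z = K p v \<longleftrightarrow> differential U M r p z = v \<and> differential U M o' p z = 0"
    and E1: "\<And>Y. Y \<in> E \<Longrightarrow> \<exists>X\<in>F. \<forall>p\<in>carrier U. Y (\<phi> p) = K p (X (r p))"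
    and E2: "\<And>X. X \<in> F \<Longrightarrow> \<exists>Y\<in>E. \<forall>p\<in>carrier U. Y (\<phi> p) = K p (X (r p))"
  shows "pullback U N \<phi> (Cinf_c_span N E)
    = {Z \<in> pullback U M r F. \<forall>p\<in>carrier U. differential U M o' p (Z p) = 0}"
proof -
  note oU = open_carrier[OF U]
  let ?E = "Cinf_c_span U ((\<lambda>Y. Y \<circ> \<phi>) ` Cinf_c_span N E)" and ?F = "Cinf_c_span U ((\<lambda>X. X \<circ> r) ` F)"
  have Ftan: "T p \<in> tangent M (r p)" if T: "T \<in> ?F" and p: "p \<in> carrier U" for T p
    using T
  proof (induction T rule: Cinf_c_span_induct)
    show "(0 :: 'u \<Rightarrow> ('m, 'e) tvec) p \<in> tangent M (r p)"
      unfolding zero_fun_apply[of p] by (rule tangent_zero[OF M])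
    show "(S + T) p \<in> tangent M (r p)" if "S p \<in> tangent M (r p)" "T p \<in> tangent M (r p)" for S T
      unfolding plus_fun_apply[of S T p] by (rule tangent_add[OF M that])
    show "(f \<cdot> Y) p \<in> tangent M (r p)" if "Y \<in> (\<lambda>X. X \<circ> r) ` F" for f Y
      unfolding fscale_apply
      by (rule tangent_scale[OF M]) (use that F smooth_map_on_carrier[OF r p] in auto)
  qed
  have to_F: "\<exists>T\<in>?F. \<forall>p\<in>carrier U. S p = K p (T p)" if "S \<in> ?E" for S
    using that
  proof (induction S rule: Cinf_c_span_induct)
    show "\<exists>T\<in>?F. \<forall>p\<in>carrier U. (0 :: 'u \<Rightarrow> ('n, 'f) tvec) p = K p (T p)"
      by (rule bexI[OF _ Cinf_c_span_zero], rule ballI) (simp only: zero_fun_apply K0)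
    show "\<exists>V\<in>?F. \<forall>p\<in>carrier U. (S + T) p = K p (V p)"
      if "\<exists>V\<in>?F. \<forall>p\<in>carrier U. S p = K p (V p)" "\<exists>V\<in>?F. \<forall>p\<in>carrier U. T p = K p (V p)" for S T
    proof -
      obtain V W where VW: "V \<in> ?F" "W \<in> ?F" "\<And>p. p \<in> carrier U \<Longrightarrow> S p = K p (V p)"
        "\<And>p. p \<in> carrier U \<Longrightarrow> T p = K p (W p)" using \<open>\<exists>V\<in>?F. \<forall>p\<in>carrier U. S p = K p (V p)\<close>
          \<open>\<exists>V\<in>?F. \<forall>p\<in>carrier U. T p = K p (V p)\<close> by (elim bexE) blast
      have "(S + T) p = K p ((V + W) p)" if "p \<in> carrier U" for p
        unfolding plus_fun_apply[of S T p] plus_fun_apply[of V W p] Kadd VW(3)[OF that] VW(4)[OF that] ..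
      then show ?thesis using Cinf_c_span_add[OF VW(1,2)] by blast
    qed
    fix f Y' assume f: "f \<in> Cinf_c U (carrier U)" and "Y' \<in> (\<lambda>Y. Y \<circ> \<phi>) ` Cinf_c_span N E"
    then obtain Y where Y: "Y \<in> Cinf_c_span N E" "Y' = Y \<circ> \<phi>" by blast
    show "\<exists>T\<in>?F. \<forall>p\<in>carrier U. (f \<cdot> Y') p = K p (T p)"
      unfolding Y(2) using Y(1)
    proof (induction Y rule: Cinf_c_span_induct)
      have "(f \<cdot> (0 \<circ> \<phi>)) p = K p ((0 :: 'u \<Rightarrow> ('m, 'e) tvec) p)" for p
      proof -
        have "(f \<cdot> (0 \<circ> \<phi>)) p = (0 :: ('n, 'f) tvec)" by (simp add: fscale_apply fun_eq_iff)
        then show ?thesis unfolding zero_fun_apply[of p] K0 .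
      qed
      then show "\<exists>T\<in>?F. \<forall>p\<in>carrier U. (f \<cdot> (0 \<circ> \<phi>)) p = K p (T p)"
        by (intro bexI[OF _ Cinf_c_span_zero]) blast
      show "\<exists>V\<in>?F. \<forall>p\<in>carrier U. (f \<cdot> ((S + T) \<circ> \<phi>)) p = K p (V p)"
        if ST: "\<exists>V\<in>?F. \<forall>p\<in>carrier U. (f \<cdot> (S \<circ> \<phi>)) p = K p (V p)"
          "\<exists>V\<in>?F. \<forall>p\<in>carrier U. (f \<cdot> (T \<circ> \<phi>)) p = K p (V p)" for S T
      proof -
        obtain V where V: "V \<in> ?F" "\<And>p. p \<in> carrier U \<Longrightarrow> (f \<cdot> (S \<circ> \<phi>)) p = K p (V p)" using ST(1) by blast
        obtain W where W: "W \<in> ?F" "\<And>p. p \<in> carrier U \<Longrightarrow> (f \<cdot> (T \<circ> \<phi>)) p = K p (W p)" using ST(2) by blast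
        have "(f \<cdot> ((S + T) \<circ> \<phi>)) p = K p ((V + W) p)" if "p \<in> carrier U" for p
        proof -
          have "(f \<cdot> ((S + T) \<circ> \<phi>)) p = (f \<cdot> (S \<circ> \<phi>)) p + (f \<cdot> (T \<circ> \<phi>)) p"
            by (simp add: fscale_apply fun_eq_iff scaleR_add_right)
          then show ?thesis
            unfolding plus_fun_apply[of V W p] Kadd V(2)[OF that] W(2)[OF that] .
        qed
        then show ?thesis using Cinf_c_span_add[OF V(1) W(1)] by blast
      qed
      fix h Y assume h: "h \<in> Cinf_c N (carrier N)" and "Y \<in> E"
      then obtain X where X: "X \<in> F" "\<And>p. p \<in> carrier U \<Longrightarrow> Y (\<phi> p) = K p (X (r p))" using E1 by blast
      have "smooth_fun U (carrier U) (\<lambda>p. h (\<phi> p))"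
        by (rule smooth_fun_pullback[OF U N oU \<phi> open_carrier[OF N] Cinf_cD(1)[OF h]
              smooth_map_on_carrier[OF \<phi>]])
      then have g: "(\<lambda>p. f p * h (\<phi> p)) \<in> Cinf_c U (carrier U)" by (rule Cinf_c_mult[OF U oU f])
      have "(f \<cdot> ((h \<cdot> Y) \<circ> \<phi>)) p = K p (((\<lambda>p. f p * h (\<phi> p)) \<cdot> (X \<circ> r)) p)" if "p \<in> carrier U" for p
        unfolding fscale_apply Kscale o_def X(2)[OF that, symmetric] by simp
      then show "\<exists>T\<in>?F. \<forall>p\<in>carrier U. (f \<cdot> ((h \<cdot> Y) \<circ> \<phi>)) p = K p (T p)"
        by (intro bexI[OF ballI Cinf_c_span_generator[OF g imageI[OF X(1)]]])
    qed
  qed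
  have of_F: "\<exists>S\<in>?E. \<forall>p\<in>carrier U. S p = K p (T p)" if "T \<in> ?F" for T
    using that
  proof (induction T rule: Cinf_c_span_induct)
    show "\<exists>S\<in>?E. \<forall>p\<in>carrier U. S p = K p ((0 :: 'u \<Rightarrow> ('m, 'e) tvec) p)"
      by (rule bexI[OF _ Cinf_c_span_zero], rule ballI) (simp only: zero_fun_apply K0)
    show "\<exists>V\<in>?E. \<forall>p\<in>carrier U. V p = K p ((S + T) p)"
      if ST: "\<exists>V\<in>?E. \<forall>p\<in>carrier U. V p = K p (S p)" "\<exists>V\<in>?E. \<forall>p\<in>carrier U. V p = K p (T p)" for S T
    proof -
      obtain V where V: "V \<in> ?E" "\<And>p. p \<in> carrier U \<Longrightarrow> V p = K p (S p)" using ST(1) by blast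
      obtain W where W: "W \<in> ?E" "\<And>p. p \<in> carrier U \<Longrightarrow> W p = K p (T p)" using ST(2) by blast
      have "(V + W) p = K p ((S + T) p)" if "p \<in> carrier U" for p
        unfolding plus_fun_apply[of S T p] plus_fun_apply[of V W p] Kadd V(2)[OF that] W(2)[OF that] ..
      then show ?thesis using Cinf_c_span_add[OF V(1) W(1)] by blast
    qed
    fix f X' assume f: "f \<in> Cinf_c U (carrier U)" and "X' \<in> (\<lambda>X. X \<circ> r) ` F"
    then obtain X where X: "X \<in> F" "X' = X \<circ> r" by blast
    from E2[OF X(1)] obtain Y where Y: "Y \<in> E" "\<And>p. p \<in> carrier U \<Longrightarrow> Y (\<phi> p) = K p (X (r p))" by blast
    have "continuous_on (supp f) \<phi>"
      by (rule continuous_on_subset[of "carrier U"])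
         (use \<phi> Cinf_cD(3)[OF f] in \<open>auto simp: smooth_map_on_def\<close>)
    then have "compact (\<phi> ` supp f)" using Cinf_cD(2)[OF f] by (rule compact_continuous_image)
    moreover have "\<phi> ` supp f \<subseteq> carrier N" using \<phi> Cinf_cD(3)[OF f] by (auto simp: smooth_map_on_def)
    ultimately obtain h where h: "h \<in> Cinf_c N (carrier N)" "\<forall>q\<in>\<phi> ` supp f. h q = 1"
      using ex_plateau[OF N] by blast
    have "(f \<cdot> ((h \<cdot> Y) \<circ> \<phi>)) p = K p ((f \<cdot> X') p)" if p: "p \<in> carrier U" for p
    proof (cases "p \<in> supp f")
      case True
      then have "h (\<phi> p) = 1" using h(2) by blast
      then show ?thesis unfolding X(2) fscale_apply Kscale o_def Y(2)[OF p, symmetric] by simp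
    next
      case False
      then have "f p = 0" by (rule not_in_supp)
      then show ?thesis unfolding X(2) fscale_apply Kscale o_def by simp
    qed
    then show "\<exists>S\<in>?E. \<forall>p\<in>carrier U. S p = K p ((f \<cdot> X') p)"
      by (intro bexI[OF ballI
            Cinf_c_span_generator[OF f imageI[OF Cinf_c_span_generator[OF h(1) Y(1)]]]])
  qed
  show ?thesis
  proof (intro equalityI subsetI)
    fix Z assume "Z \<in> pullback U N \<phi> (Cinf_c_span N E)"
    then obtain S where Z: "Z \<in> compact_sections U (vector_fields U)" and S: "S \<in> ?E"
      "\<And>p. p \<in> carrier U \<Longrightarrow> differential U N \<phi> p (Z p) = S p"
      unfolding pullback_iff by blast
    obtain T where T: "T \<in> ?F" "\<And>p. p \<in> carrier U \<Longrightarrow> S p = K p (T p)" using to_F[OF S(1)] by blast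
    have "differential U M r p (Z p) = T p \<and> differential U M o' p (Z p) = 0" if p: "p \<in> carrier U" for p
      using K[OF p Ftan[OF T(1) p] compact_fieldsD(2)[OF Z p]] S(2)[OF p] T(2)[OF p] by argo
    then show "Z \<in> {Z \<in> pullback U M r F. \<forall>p\<in>carrier U. differential U M o' p (Z p) = 0}"
      using Z T(1) unfolding pullback_iff by blast
  next
    fix Z assume ZZ: "Z \<in> {Z \<in> pullback U M r F. \<forall>p\<in>carrier U. differential U M o' p (Z p) = 0}"
    then obtain T where Z: "Z \<in> compact_sections U (vector_fields U)" and T: "T \<in> ?F"
      "\<And>p. p \<in> carrier U \<Longrightarrow> differential U M r p (Z p) = T p"
      unfolding pullback_iff by blast
    have o0: "p \<in> carrier U \<Longrightarrow> differential U M o' p (Z p) = 0" for p using ZZ by blast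
    obtain S where S: "S \<in> ?E" "\<And>p. p \<in> carrier U \<Longrightarrow> S p = K p (T p)" using of_F[OF T(1)] by blast
    have "differential U N \<phi> p (Z p) = S p" if p: "p \<in> carrier U" for p
      using K[OF p Ftan[OF T(1) p] compact_fieldsD(2)[OF Z p]] S(2)[OF p] T(2)[OF p] o0[OF p] by argo
    then show "Z \<in> pullback U N \<phi> (Cinf_c_span N E)" using Z S(1) unfolding pullback_iff by blast
  qed
qed

section \<open>Comparing the two notions\<close>

text \<open>
  The two legs \<open>r\<close> and \<open>o'\<close> stand for \<open>t\<^sub>U\<close> and \<open>s\<^sub>U\<close> in either order.
\<close>

context
  fixes U :: "('u::{t2_space, second_countable_topology}, 'd::model_space) atlas"
    and M :: "('m::{t2_space, second_countable_topology}, 'e::model_space) atlas"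
    and F :: "('m \<Rightarrow> ('m, 'e) tvec) set" and r o' :: "'u \<Rightarrow> 'm"
  assumes U: "manifold U" and M: "manifold M" and F: "F \<subseteq> vector_fields M (carrier M)"
    and r: "submersion U M r" and o': "smooth_map U M o'"
begin

lemma smooth_r: "smooth_map U M r"
  using r by (simp add: submersion_def)

text \<open>
  A local lift of \<open>X\<close> along \<open>r\<close>, multiplied with a bump function, lies in the pull-back module; its
  component in the kernel of \<open>do'\<close> has the same image under \<open>dr\<close>.
\<close>

lemma related_of_pullback_split:
  fixes N :: "('n::{t2_space, second_countable_topology}, 'g::model_space) atlas"
  assumes split: "pullback U M r F \<subseteq> {A + B | A B. A \<in> kernel_fields U M r \<and> B \<in> kernel_fields U M o'}"
    and X: "X \<in> F"
    and Y: "\<And>p z c. p \<in> carrier U \<Longrightarrow> differential U M r p z = tscale c (X (r p)) \<Longrightarrow>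
      differential U M o' p z = 0 \<Longrightarrow> differential U N \<phi> p z = tscale c (Y (\<phi> p))"
    and \<phi>: "smooth_map U N \<phi>"
  shows "\<exists>Z\<in>vector_fields U (carrier U). related U N \<phi> Z Y"
proof (rule related_glue[OF U \<phi>])
  fix p assume p: "p \<in> carrier U"
  have "X \<in> vector_fields M (carrier M)" using X F by blast
  from submersion_local_lift[OF U M r this p] obtain V h Z where V: "open V" "p \<in> V"
    and h: "h \<in> Cinf_c U (carrier U)" "\<forall>q\<in>V. h q = 1"
    and Z: "Z \<in> compact_sections U (vector_fields U)"
      "\<And>q. q \<in> carrier U \<Longrightarrow> differential U M r q (Z q) = tscale (h q) (X (r q))"
    by blast
  have "differential U M r q (Z q) = (h \<cdot> (X \<circ> r)) q" if "q \<in> carrier U" for q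
    unfolding fscale_apply o_def by (rule Z(2)[OF that])
  then have "Z \<in> pullback U M r F"
    unfolding pullback_iff
    by (intro conjI Z(1) bexI[OF ballI Cinf_c_span_generator[OF h(1) imageI[OF X]]])
  then obtain A B where AB: "Z = A + B" "A \<in> kernel_fields U M r" "B \<in> kernel_fields U M o'"
    using split by blast
  have "differential U N \<phi> q (B q) = tscale (h q) (Y (\<phi> q))" if q: "q \<in> carrier U" for q
  proof (rule Y[OF q _ kernel_fieldsD(2)[OF AB(3) q]])
    have "differential U M r q (Z q) = differential U M r q (A q) + differential U M r q (B q)"
      unfolding AB(1) plus_fun_apply[of A B q] by (rule differential_add[OF U smooth_r q])
    then show "differential U M r q (B q) = tscale (h q) (X (r q))"
      unfolding Z(2)[OF q] kernel_fieldsD(2)[OF AB(2) q] add_0 by (rule sym)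
  qed
  moreover have "B \<in> vector_fields U (carrier U)"
    by (rule compact_fieldsD(1)[OF kernel_fieldsD(1)[OF AB(3)]])
  ultimately show "\<exists>V h Z. open V \<and> p \<in> V \<and> smooth_fun U (carrier U) h \<and>
      (\<forall>q\<in>V. h q = (1::real)) \<and> Z \<in> vector_fields U (carrier U) \<and>
      (\<forall>q\<in>carrier U. differential U N \<phi> q (Z q) = tscale (h q) (Y (\<phi> q)))"
    using V h(2) Cinf_cD(1)[OF h(1)] by blast
qed

text \<open>
  If \<open>dr(Z)\<close> is the sum of the \<open>f\<^sub>i (X\<^sub>i \<circ> r)\<close> and \<open>Z\<^sub>i\<close> lifts \<open>X\<^sub>i\<close> inside the kernel of \<open>do'\<close>, then \<open>Z\<close> differs
  from the sum of the \<open>f\<^sub>i Z\<^sub>i\<close> by an element of the kernel of \<open>dr\<close>.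
\<close>

lemma pullback_split_of_related:
  assumes kern: "kernel_fields U M o' \<subseteq> pullback U M r F"
    and lift: "\<And>X. X \<in> F \<Longrightarrow> \<exists>Z\<in>vector_fields U (carrier U). \<forall>p\<in>carrier U.
      differential U M r p (Z p) = X (r p) \<and> differential U M o' p (Z p) = 0"
  shows "pullback U M r F = {A + B | A B. A \<in> kernel_fields U M r \<and> B \<in> kernel_fields U M o'}"
proof (intro equalityI subsetI)
  fix Z assume "Z \<in> {A + B | A B. A \<in> kernel_fields U M r \<and> B \<in> kernel_fields U M o'}"
  then obtain A B where AB: "Z = A + B" "A \<in> kernel_fields U M r" "B \<in> kernel_fields U M o'" by blast
  show "Z \<in> pullback U M r F"
    unfolding AB(1)
    by (rule pullback_add[OF U smooth_r]) (use AB kern kernel_subset_pullback[OF U smooth_r] in blast)+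
next
  fix Z assume "Z \<in> pullback U M r F"
  then obtain S where Z: "Z \<in> compact_sections U (vector_fields U)"
    and S: "S \<in> Cinf_c_span U ((\<lambda>X. X \<circ> r) ` F)"
      "\<And>p. p \<in> carrier U \<Longrightarrow> differential U M r p (Z p) = S p"
    unfolding pullback_iff by blast
  have "\<exists>B\<in>kernel_fields U M o'. \<forall>p\<in>carrier U. differential U M r p (B p) = S p"
    using S(1)
  proof (induction S rule: Cinf_c_span_induct)
    show "\<exists>B\<in>kernel_fields U M o'. \<forall>p\<in>carrier U.
        differential U M r p (B p) = (0 :: 'u \<Rightarrow> ('m, 'e) tvec) p"
    proof (rule bexI[OF _ kernel_fields_zero[OF U o']], rule ballI)
      fix p assume p: "p \<in> carrier U"
      show "differential U M r p ((0 :: 'u \<Rightarrow> ('u, 'd) tvec) p) = (0 :: 'u \<Rightarrow> ('m, 'e) tvec) p"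
        unfolding zero_fun_apply[of p] by (rule differential_zero[OF U smooth_r p])
    qed
    show "\<exists>B\<in>kernel_fields U M o'. \<forall>p\<in>carrier U. differential U M r p (B p) = (S + T) p"
      if ST: "\<exists>B\<in>kernel_fields U M o'. \<forall>p\<in>carrier U. differential U M r p (B p) = S p"
        "\<exists>B\<in>kernel_fields U M o'. \<forall>p\<in>carrier U. differential U M r p (B p) = T p" for S T
    proof -
      obtain A where A: "A \<in> kernel_fields U M o'" "\<And>p. p \<in> carrier U \<Longrightarrow> differential U M r p (A p) = S p"
        using ST(1) by blast
      obtain B where B: "B \<in> kernel_fields U M o'" "\<And>p. p \<in> carrier U \<Longrightarrow> differential U M r p (B p) = T p"
        using ST(2) by blast
      have "differential U M r p ((A + B) p) = (S + T) p" if p: "p \<in> carrier U" for p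
        unfolding plus_fun_apply[of A B p] plus_fun_apply[of S T p] differential_add[OF U smooth_r p]
          A(2)[OF p] B(2)[OF p] ..
      then show ?thesis using kernel_fields_add[OF U o' A(1) B(1)] by blast
    qed
    fix f X' assume f: "f \<in> Cinf_c U (carrier U)" and "X' \<in> (\<lambda>X. X \<circ> r) ` F"
    then obtain X where X: "X \<in> F" "X' = X \<circ> r" by blast
    from lift[OF X(1)] obtain B where B: "B \<in> vector_fields U (carrier U)"
      "\<And>p. p \<in> carrier U \<Longrightarrow> differential U M r p (B p) = X (r p)"
      "\<And>p. p \<in> carrier U \<Longrightarrow> differential U M o' p (B p) = 0" by blast
    have "differential U M o' p ((f \<cdot> B) p) = 0" if p: "p \<in> carrier U" for p
      unfolding fscale_apply differential_scale[OF U o' p] B(3)[OF p] by (simp add: fun_eq_iff)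
    then have "f \<cdot> B \<in> kernel_fields U M o'"
      using compact_fields_scale_c[OF U f B(1)] by (simp add: kernel_fields_def)
    moreover have "differential U M r p ((f \<cdot> B) p) = (f \<cdot> X') p" if p: "p \<in> carrier U" for p
      unfolding fscale_apply differential_scale[OF U smooth_r p] B(2)[OF p] X(2) o_def ..
    ultimately show "\<exists>B\<in>kernel_fields U M o'. \<forall>p\<in>carrier U. differential U M r p (B p) = (f \<cdot> X') p"
      by blast
  qed
  then obtain B where B: "B \<in> kernel_fields U M o'" "\<And>p. p \<in> carrier U \<Longrightarrow> differential U M r p (B p) = S p"
    by blast
  have mB: "- B \<in> kernel_fields U M o'" by (rule kernel_fields_minus[OF U o' B(1)])
  have "differential U M r p ((Z + - B) p) = 0" if p: "p \<in> carrier U" for p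
  proof -
    have "(Z + - B) p = Z p + - B p" by (simp add: fun_eq_iff)
    then show ?thesis
      by (simp only: differential_add[OF U smooth_r p] differential_minus[OF U smooth_r p] S(2)[OF p]
            B(2)[OF p] add.right_inverse)
  qed
  then have "Z + - B \<in> kernel_fields U M r"
    using compact_fields_add[OF U Z kernel_fieldsD(1)[OF mB]] by (simp add: kernel_fields_def)
  moreover have "Z = (Z + - B) + B" by (simp add: add.assoc)
  ultimately show "Z \<in> {A + B | A B. A \<in> kernel_fields U M r \<and> B \<in> kernel_fields U M o'}"
    using B(1) by blast
qed

end

theorem proposition2p10:
  fixes M :: "('m::{t2_space, second_countable_topology}, 'e::model_space) atlas"
    and U :: "('u::{t2_space, second_countable_topology}, 'd::model_space) atlas"
    and F :: "('m \<Rightarrow> ('m, 'e) tvec) set"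
    and t\<^sub>U s\<^sub>U :: "'u \<Rightarrow> 'm"
  assumes "manifold M" and "singular_foliation M F" and "manifold U"
    and "submersion U M t\<^sub>U" and "submersion U M s\<^sub>U"
  shows "foliation_bisubmersion M F U t\<^sub>U s\<^sub>U \<longleftrightarrow>
    bisubmersion (pair_groupoid M) (pair_section M ` F) U (\<lambda>p. (t\<^sub>U p, s\<^sub>U p))"
proof -
  note M = assms(1) and U = assms(3)
  let ?t = t\<^sub>U and ?s = s\<^sub>U
  let ?\<phi> = "\<lambda>p. (?t p, ?s p)" and ?N = "prod_atlas M M" and ?G = "pair_groupoid M"
  let ?R = "\<lambda>X. right_invariant ?G (pair_section M X)" and ?L = "\<lambda>X. left_invariant ?G (pair_section M X)"
  let ?kt = "kernel_fields U M ?t" and ?ks = "kernel_fields U M ?s"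
  note N = manifold_prod[OF M M]
  have t: "smooth_map U M ?t" and s: "smooth_map U M ?s" using assms(4,5) by (simp_all add: submersion_def)
  have \<phi>: "smooth_map U ?N ?\<phi>" by (rule smooth_map_Pair[OF U M M open_carrier[OF U] t s])
  have FV: "F \<subseteq> vector_fields M (carrier M)"
    using assms(2) by (auto simp: singular_foliation_def dest: compact_fieldsD(1))
  have vf: "X \<in> vector_fields M (carrier M)" if "X \<in> F" for X using FV that by blast
  have Ftan: "X x \<in> tangent M x" if "X \<in> F" for X x by (rule vector_field_tangent[OF M vf[OF that]])
  have Fminus: "- X \<in> F" if X: "X \<in> F" for X
  proof -
    have "(\<lambda>_. -1) \<in> Cinf M (carrier M)" by (simp add: Cinf_iff smooth_fun_const)
    then have "(\<lambda>_. -1) \<cdot> X \<in> F" using assms(2) X by (simp add: singular_foliation_def submodule_def)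
    moreover have "(\<lambda>_. -1) \<cdot> X = - X" by (simp add: fun_eq_iff fscale_apply)
    ultimately show ?thesis by simp
  qed
  have car: "?t p \<in> carrier M" "?s p \<in> carrier M" if "p \<in> carrier U" for p
    using smooth_map_on_carrier[OF t that] smooth_map_on_carrier[OF s that] .
  have d\<phi>: "differential U ?N ?\<phi> p z = tpair M M (?\<phi> p) (differential U M ?t p z) (differential U M ?s p z)"
    if "p \<in> carrier U" for p z
    by (rule differential_Pair[OF M M U t s that])
  have R: "?R X (?\<phi> p) = tpair M M (?\<phi> p) (X (?t p)) 0" if "X \<in> F" "p \<in> carrier U" for X p
    by (rule right_invariant_pair[OF M vf[OF that(1)] car[OF that(2)]])
  have L: "?L X (?\<phi> p) = tpair M M (?\<phi> p) 0 (- X (?s p))" if "X \<in> F" "p \<in> carrier U" for X p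
    by (rule left_invariant_pair[OF M vf[OF that(1)] car[OF that(2)]])
  \<comment> \<open>as \<open>- F = F\<close>, the sign of the left-invariant fields is harmless\<close>
  have Lm: "?L (- X) (?\<phi> p) = tpair M M (?\<phi> p) 0 (X (?s p))" if "X \<in> F" "p \<in> carrier U" for X p
    using L[OF Fminus[OF that(1)] that(2)] by simp
  have inj: "differential U ?N ?\<phi> p z = tpair M M (?\<phi> p) v w \<longleftrightarrow>
      differential U M ?t p z = v \<and> differential U M ?s p z = w"
    if p: "p \<in> carrier U" and "v \<in> tangent M (?t p)" "w \<in> tangent M (?s p)" "z \<in> tangent U p" for p v w z
    using tpair_inject[OF M M differential_tangent[OF U M t p that(4)] that(2)
        differential_tangent[OF U M s p that(4)] that(3) car[OF p]] d\<phi>[OF p] by auto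
  have t0: "tscale c 0 = (0 :: ('m, 'e) tvec)" for c by (simp add: fun_eq_iff)
  \<comment> \<open>both invariant pull-backs are pull-backs of \<open>F\<close> along one leg, intersected with the kernel of the other\<close>
  have pR: "pullback U ?N ?\<phi> (Cinf_c_span ?N (right_invariant ?G ` pair_section M ` F))
      = {Z \<in> pullback U M ?t F. \<forall>p\<in>carrier U. differential U M ?s p (Z p) = 0}"
  proof (rule pullback_invariant_span[where K = "\<lambda>p v. tpair M M (?\<phi> p) v 0", OF U N M \<phi> t])
    show "X p \<in> tangent M p" if "X \<in> F" for X p by (rule Ftan[OF that])
    show "tpair M M (?\<phi> p) 0 0 = 0" for p by (rule tpair_zero)
    show "tpair M M (?\<phi> p) (v + w) 0 = tpair M M (?\<phi> p) v 0 + tpair M M (?\<phi> p) w 0" for p v w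
      using tpair_add[of M M "?\<phi> p" v w 0 0] by (simp only: add_0)
    show "tpair M M (?\<phi> p) (tscale c v) 0 = tscale c (tpair M M (?\<phi> p) v 0)" for p c v
      using tpair_scale[of M M "?\<phi> p" c v 0] by (simp only: t0)
    show "differential U ?N ?\<phi> p z = tpair M M (?\<phi> p) v 0 \<longleftrightarrow>
        differential U M ?t p z = v \<and> differential U M ?s p z = 0"
      if "p \<in> carrier U" "v \<in> tangent M (?t p)" "z \<in> tangent U p" for p v z
      by (rule inj[OF that(1,2) tangent_zero[OF M] that(3)])
    show "\<exists>X\<in>F. \<forall>p\<in>carrier U. Y (?\<phi> p) = tpair M M (?\<phi> p) (X (?t p)) 0"
      if "Y \<in> right_invariant ?G ` pair_section M ` F" for Y using that R by blast
    show "\<exists>Y\<in>right_invariant ?G ` pair_section M ` F. \<forall>p\<in>carrier U. Y (?\<phi> p) = tpair M M (?\<phi> p) (X (?t p)) 0"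
      if "X \<in> F" for X using that R by blast
  qed
  have pL: "pullback U ?N ?\<phi> (Cinf_c_span ?N (left_invariant ?G ` pair_section M ` F))
      = {Z \<in> pullback U M ?s F. \<forall>p\<in>carrier U. differential U M ?t p (Z p) = 0}"
  proof (rule pullback_invariant_span[where K = "\<lambda>p v. tpair M M (?\<phi> p) 0 v", OF U N M \<phi> s])
    show "X p \<in> tangent M p" if "X \<in> F" for X p by (rule Ftan[OF that])
    show "tpair M M (?\<phi> p) 0 0 = 0" for p by (rule tpair_zero)
    show "tpair M M (?\<phi> p) 0 (v + w) = tpair M M (?\<phi> p) 0 v + tpair M M (?\<phi> p) 0 w" for p v w
      using tpair_add[of M M "?\<phi> p" 0 0 v w] by (simp only: add_0)
    show "tpair M M (?\<phi> p) 0 (tscale c v) = tscale c (tpair M M (?\<phi> p) 0 v)" for p c v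
      using tpair_scale[of M M "?\<phi> p" c 0 v] by (simp only: t0)
    show "differential U ?N ?\<phi> p z = tpair M M (?\<phi> p) 0 v \<longleftrightarrow>
        differential U M ?s p z = v \<and> differential U M ?t p z = 0"
      if "p \<in> carrier U" "v \<in> tangent M (?s p)" "z \<in> tangent U p" for p v z
      using inj[OF that(1) tangent_zero[OF M] that(2,3)] by blast
    show "\<exists>X\<in>F. \<forall>p\<in>carrier U. Y (?\<phi> p) = tpair M M (?\<phi> p) 0 (X (?s p))"
      if Y: "Y \<in> left_invariant ?G ` pair_section M ` F" for Y
    proof -
      obtain X where X: "X \<in> F" "Y = ?L X" using Y by blast
      have "Y (?\<phi> p) = tpair M M (?\<phi> p) 0 ((- X) (?s p))" if "p \<in> carrier U" for p
        unfolding X(2) using L[OF X(1) that] by simp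
      then show ?thesis using Fminus[OF X(1)] by blast
    qed
    show "\<exists>Y\<in>left_invariant ?G ` pair_section M ` F. \<forall>p\<in>carrier U. Y (?\<phi> p) = tpair M M (?\<phi> p) 0 (X (?s p))"
      if "X \<in> F" for X using that Lm Fminus by blast
  qed
  have comm: "{A + B | A B. A \<in> ?ks \<and> B \<in> ?kt} = {A + B | A B. A \<in> ?kt \<and> B \<in> ?ks}"
    by (metis (no_types, opaque_lifting) add.commute)
  have kR: "{Z \<in> pullback U M ?t F. \<forall>p\<in>carrier U. differential U M ?s p (Z p) = 0} = ?ks
      \<longleftrightarrow> ?ks \<subseteq> pullback U M ?t F"
    using pullback_compact[where U = U and M = M and \<phi> = ?t] unfolding kernel_fields_def by blast
  have kL: "{Z \<in> pullback U M ?s F. \<forall>p\<in>carrier U. differential U M ?t p (Z p) = 0} = ?kt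
      \<longleftrightarrow> ?kt \<subseteq> pullback U M ?s F"
    using pullback_compact[where U = U and M = M and \<phi> = ?s] unfolding kernel_fields_def by blast
  \<comment> \<open>what remains of the two notions once the properties that always hold are removed\<close>
  have bis: "bisubmersion ?G (pair_section M ` F) U ?\<phi> \<longleftrightarrow>
      (\<forall>X\<in>F. (\<exists>Z\<in>vector_fields U (carrier U). related U ?N ?\<phi> Z (?R X)) \<and>
             (\<exists>Z\<in>vector_fields U (carrier U). related U ?N ?\<phi> Z (?L X))) \<and>
      ?ks \<subseteq> pullback U M ?t F \<and> ?kt \<subseteq> pullback U M ?s F"
    unfolding bisubmersion_def pair_groupoid_simps o_def fst_conv snd_conv pR pL kR kL
    using lie_groupoid_pair[OF M] singular_subalgebroid_pair[OF M assms(2)] U \<phi> assms(4,5) by simp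
  have fol: "foliation_bisubmersion M F U ?t ?s \<longleftrightarrow>
      pullback U M ?t F = {A + B | A B. A \<in> ?kt \<and> B \<in> ?ks} \<and>
      pullback U M ?s F = {A + B | A B. A \<in> ?ks \<and> B \<in> ?kt}"
    unfolding foliation_bisubmersion_def comm using assms(4,5)
    by (auto simp only: simp_thms eq_commute[of _ "pullback U M ?s F"])
  show ?thesis
    unfolding bis
  proof
    assume "foliation_bisubmersion M F U ?t ?s"
    then have pt: "pullback U M ?t F = {A + B | A B. A \<in> ?kt \<and> B \<in> ?ks}"
      and ps: "pullback U M ?s F = {A + B | A B. A \<in> ?ks \<and> B \<in> ?kt}" unfolding fol by blast+
    have "?ks \<subseteq> pullback U M ?t F"
    proof
      fix B assume "B \<in> ?ks"
      moreover have "B = 0 + B" by simp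
      ultimately show "B \<in> pullback U M ?t F" unfolding pt using kernel_fields_zero[OF U t] by blast
    qed
    moreover have "?kt \<subseteq> pullback U M ?s F"
    proof
      fix B assume "B \<in> ?kt"
      moreover have "B = 0 + B" by simp
      ultimately show "B \<in> pullback U M ?s F" unfolding ps using kernel_fields_zero[OF U s] by blast
    qed
    moreover have "\<exists>Z\<in>vector_fields U (carrier U). related U ?N ?\<phi> Z (?R X)" if X: "X \<in> F" for X
    proof (rule related_of_pullback_split[OF U M FV assms(4) s _ X _ \<phi>])
      show "pullback U M ?t F \<subseteq> {A + B | A B. A \<in> ?kt \<and> B \<in> ?ks}" using pt by blast
      show "differential U ?N ?\<phi> p z = tscale c (?R X (?\<phi> p))"
        if "p \<in> carrier U" "differential U M ?t p z = tscale c (X (?t p))" "differential U M ?s p z = 0" for p z c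
        using tpair_scale[of M M "?\<phi> p" c "X (?t p)" 0]
        by (simp only: d\<phi>[OF that(1)] that(2,3) R[OF X that(1)] t0)
    qed
    moreover have "\<exists>Z\<in>vector_fields U (carrier U). related U ?N ?\<phi> Z (?L X)" if X: "X \<in> F" for X
    proof (rule related_of_pullback_split[OF U M FV assms(5) t _ Fminus[OF X] _ \<phi>])
      show "pullback U M ?s F \<subseteq> {A + B | A B. A \<in> ?ks \<and> B \<in> ?kt}" using ps by blast
      show "differential U ?N ?\<phi> p z = tscale c (?L X (?\<phi> p))"
        if "p \<in> carrier U" "differential U M ?s p z = tscale c ((- X) (?s p))" "differential U M ?t p z = 0" for p z c
      proof -
        have "(- X) (?s p) = - X (?s p)" by simp
        then show ?thesis
          using tpair_scale[of M M "?\<phi> p" c 0 "- X (?s p)"]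
          by (simp only: d\<phi>[OF that(1)] that(2,3) L[OF X that(1)] t0)
      qed
    qed
    ultimately show "(\<forall>X\<in>F. (\<exists>Z\<in>vector_fields U (carrier U). related U ?N ?\<phi> Z (?R X)) \<and>
             (\<exists>Z\<in>vector_fields U (carrier U). related U ?N ?\<phi> Z (?L X))) \<and>
      ?ks \<subseteq> pullback U M ?t F \<and> ?kt \<subseteq> pullback U M ?s F" by blast
  next
    assume *: "(\<forall>X\<in>F. (\<exists>Z\<in>vector_fields U (carrier U). related U ?N ?\<phi> Z (?R X)) \<and>
             (\<exists>Z\<in>vector_fields U (carrier U). related U ?N ?\<phi> Z (?L X))) \<and>
      ?ks \<subseteq> pullback U M ?t F \<and> ?kt \<subseteq> pullback U M ?s F"
    have Ztan: "Z p \<in> tangent U p" if "Z \<in> vector_fields U (carrier U)" for Z p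
      by (rule vector_field_tangent[OF U that])
    have "pullback U M ?t F = {A + B | A B. A \<in> ?kt \<and> B \<in> ?ks}"
    proof (rule pullback_split_of_related[OF U M FV assms(4) s])
      show "?ks \<subseteq> pullback U M ?t F" using * by blast
      fix X assume X: "X \<in> F"
      then obtain Z where Z: "Z \<in> vector_fields U (carrier U)" "related U ?N ?\<phi> Z (?R X)" using * by blast
      have "differential U M ?t p (Z p) = X (?t p) \<and> differential U M ?s p (Z p) = 0" if p: "p \<in> carrier U" for p
        using Z(2) R[OF X p] inj[OF p Ftan[OF X] tangent_zero[OF M] Ztan[OF Z(1)]] p
        unfolding related_def by simp
      then show "\<exists>Z\<in>vector_fields U (carrier U). \<forall>p\<in>carrier U.
          differential U M ?t p (Z p) = X (?t p) \<and> differential U M ?s p (Z p) = 0" using Z(1) by blast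
    qed
    moreover have "pullback U M ?s F = {A + B | A B. A \<in> ?ks \<and> B \<in> ?kt}"
    proof (rule pullback_split_of_related[OF U M FV assms(5) t])
      show "?kt \<subseteq> pullback U M ?s F" using * by blast
      fix X assume X: "X \<in> F"
      obtain Z where Z: "Z \<in> vector_fields U (carrier U)" "related U ?N ?\<phi> Z (?L (- X))"
        using * Fminus[OF X] by blast
      have "differential U M ?s p (Z p) = X (?s p) \<and> differential U M ?t p (Z p) = 0" if p: "p \<in> carrier U" for p
        using Z(2) Lm[OF X p] inj[OF p tangent_zero[OF M] Ftan[OF X] Ztan[OF Z(1)]] p
        unfolding related_def by simp
      then show "\<exists>Z\<in>vector_fields U (carrier U). \<forall>p\<in>carrier U.
          differential U M ?s p (Z p) = X (?s p) \<and> differential U M ?t p (Z p) = 0" using Z(1) by blast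
    qed
    ultimately show "foliation_bisubmersion M F U ?t ?s" unfolding fol by blast
  qed
qed

end
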